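(* Let $k$ be a positive integer. Suppose that for some positive integer $n$ the polynomial $T_{n,k}(x)$ is irreducible over $\mathbb{Q}$ and has full Galois group. Then for every prime $p$ such that $p\not\equiv\pm1 \pmod 5$ or $p\not\equiv\pm1\pmod 7$ (at least one of the two conditions holding), the polynomial $T_{p,k}(x)$ is irreducible over $\mathbb{Q}$ and has full Galois group.
   Context: $S_k(1)$ denotes the complex vector space of holomorphic cusp forms of weight $k$ for $SL_2(\mathbb{Z})$. For a positive integer $n$, the Hecke operator $T_n$ acts on $S_k(1)$ by $(T_nf)(z)=\frac1n\sum_{ad=n}a^k\sum_{0\le b<d}f\left(\frac{az+b}{d}\right)$, and $T_{n,k}(x)$ is the characteristic polynomial of $T_n$ acting on $S_k(1)$; it is monic with integer coefficients and degree $d_k=\dim S_k(1)$. "Full Galois group" means that the Galois group over $\mathbb{Q}$ of the splitting field of the polynomial is the full symmetric group $S_{d_k}$ on its $d_k$ roots. *)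

theory Defs
  imports
    "HOL-Complex_Analysis.Complex_Analysis"
    "HOL-Library.Function_Algebras"
    "HOL-Number_Theory.Cong"
    "HOL-Algebra.Algebraic_Closure_Type"
    "HOL-Algebra.Generated_Fields"
    "HOL-Algebra.Bij"
    "Jordan_Normal_Form.Char_Poly"
begin

hide_const (open) Divisibility.prime Divisibility.irreducible

section \<open>Cusp forms of level one\<close>

definition upper_half_plane :: "complex set" where
  "upper_half_plane = {z. Im z > 0}"

definition fscale :: "complex \<Rightarrow> (complex \<Rightarrow> complex) \<Rightarrow> complex \<Rightarrow> complex" where
  "fscale c f = (\<lambda>z. c * f z)"

global_interpretation cfun: vector_space fscale
  by standard (auto simp: fscale_def fun_eq_iff algebra_simps)

text \<open>
  A function on the upper half plane is represented by its extension by zero to the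
  whole complex plane, so that equality of cusp forms is equality of HOL functions.
\<close>

definition cusp_forms :: "nat \<Rightarrow> (complex \<Rightarrow> complex) set" where
  "cusp_forms k = {f.
     f holomorphic_on upper_half_plane \<and>
     (\<forall>a b c d :: int. a * d - b * c = 1 \<longrightarrow> (\<forall>z\<in>upper_half_plane.
        f ((of_int a * z + of_int b) / (of_int c * z + of_int d))
          = (of_int c * z + of_int d) ^ k * f z)) \<and>
     (\<exists>q :: nat \<Rightarrow> complex. q 0 = 0 \<and> (\<forall>z\<in>upper_half_plane.
        (\<lambda>m. q m * exp (2 * of_real pi * \<i> * of_nat m * z)) sums f z)) \<and>
     (\<forall>z. z \<notin> upper_half_plane \<longrightarrow> f z = 0)}"

section \<open>Hecke operators and their characteristic polynomials\<close>

text \<open>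
  For positive \<open>a\<close> and \<open>d\<close> the map \<open>z \<mapsto> (a z + b) / d\<close> preserves the upper half plane and its
  complement, so the extension by zero needs no separate treatment here.
\<close>

definition hecke_op :: "nat \<Rightarrow> nat \<Rightarrow> (complex \<Rightarrow> complex) \<Rightarrow> complex \<Rightarrow> complex" where
  "hecke_op k n f = (\<lambda>z. 1 / of_nat n *
     (\<Sum>(a, d) \<in> {(a, d). a * d = n}. of_nat a ^ k *
        (\<Sum>b<d. f ((of_nat a * z + of_nat b) / of_nat d))))"

text \<open>
  The characteristic polynomial of an endomorphism \<open>T\<close> of a finite-dimensional space \<open>V\<close> of
  functions; it does not depend on the chosen basis. Column \<open>j\<close> of the matrix holds the
  coordinates of the image of the \<open>j\<close>-th basis vector.
\<close>

definition basis_list :: "(complex \<Rightarrow> complex) set \<Rightarrow> (complex \<Rightarrow> complex) list \<Rightarrow> bool" where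
  "basis_list V bs \<longleftrightarrow> distinct bs \<and> cfun.independent (set bs) \<and> cfun.span (set bs) = V"

definition matrix_of ::
    "(complex \<Rightarrow> complex) list \<Rightarrow> ((complex \<Rightarrow> complex) \<Rightarrow> (complex \<Rightarrow> complex)) \<Rightarrow> complex mat" where
  "matrix_of bs T = mat (length bs) (length bs)
     (\<lambda>(i, j). cfun.representation (set bs) (T (bs ! j)) (bs ! i))"

definition charpoly_on ::
    "(complex \<Rightarrow> complex) set \<Rightarrow> ((complex \<Rightarrow> complex) \<Rightarrow> (complex \<Rightarrow> complex)) \<Rightarrow> complex poly" where
  "charpoly_on V T = char_poly (matrix_of (SOME bs. basis_list V bs) T)"

definition hecke_poly :: "nat \<Rightarrow> nat \<Rightarrow> complex poly" where
  "hecke_poly n k = charpoly_on (cusp_forms k) (hecke_op k n)"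

section \<open>Irreducibility and Galois group over the rationals\<close>

definition irreducible_over_Q :: "complex poly \<Rightarrow> bool" where
  "irreducible_over_Q f \<longleftrightarrow> (\<exists>g :: rat poly. f = map_poly of_rat g \<and> irreducible g)"

definition roots :: "complex poly \<Rightarrow> complex set" where
  "roots f = {x. poly f x = 0}"

text \<open>
  The subfield of the complex numbers generated by the roots; as the characteristic is zero, it
  contains the rationals.
\<close>

definition splitting_field :: "complex poly \<Rightarrow> complex set" where
  "splitting_field f = generate_field ring_of_type_algebra (roots f)"

definition galois_group :: "complex poly \<Rightarrow> (complex \<Rightarrow> complex) monoid" where
  "galois_group f =
     (let K = splitting_field f; L = ring_of_type_algebra\<lparr>carrier := K\<rparr> in
      (BijGroup K)\<lparr>carrier := {s \<in> extensional K. s \<in> ring_iso L L \<and> (\<forall>x\<in>\<rat>. s x = x)}\<rparr>)"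

text \<open>
  \<open>f\<close> has as many distinct roots as its degree, and the action on them identifies the Galois group
  with the group of all permutations of the roots.
\<close>

definition full_galois_group :: "complex poly \<Rightarrow> bool" where
  "full_galois_group f \<longleftrightarrow> card (roots f) = Polynomial.degree f \<and>
     (\<lambda>s. restrict s (roots f)) \<in> iso (galois_group f) (BijGroup (roots f))"

end

theory Submission
  imports Defs
begin

text \<open>
  Suppose that \<open>T\<^sub>n\<close> has an irreducible characteristic polynomial with full Galois group. Since
  \<open>T\<^sub>p\<close> commutes with \<open>T\<^sub>n\<close>, its eigenvalues are \<open>h(\<lambda>)\<close>, where
  \<open>\<lambda>\<close> runs through the eigenvalues of \<open>T\<^sub>n\<close> and \<open>h\<close> is a rational polynomial.
  If \<open>h\<close> is injective on the eigenvalues, then both operators generate the same field and irreducibility and the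
  Galois action carry over. Otherwise \<open>h\<close> is constant on the eigenvalues, because the symmetric group is doubly
  transitive, and \<open>T\<^sub>p\<close> is a scalar. Then every cusp form with \<open>a\<^sub>1 = 0\<close> satisfies
  \<open>a\<^sub>p = 0\<close>. But if the dimension is at least 2, the space contains some \<open>\<Delta>\<^sup>2
  E\<^sub>4\<^sup>a E\<^sub>6\<^sup>b\<close>, whose \<open>p\<close>-th coefficient is, up to a unit and powers of
  \<open>p\<close>, congruent to \<open>(p - 1)\<^sup>i (p + 1)\<^sup>j\<close> with \<open>i, j > 0\<close> modulo 5 and modulo
  7.

  The structure of the ring of modular forms is only needed in small weights. There it follows from the elementary bound that a
  nonzero form of weight \<open>k\<close> vanishes at the cusp to an order of at most \<open>k / (2 \<pi> \<surd>3)\<close>.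
  Rational cusp forms need not be known to span: one nonzero rational form suffices, as its images under the powers of
  \<open>T\<^sub>n\<close> are linearly independent when the characteristic polynomial of \<open>T\<^sub>n\<close> is irreducible.
\<close>

section \<open>Modular forms as power series in the nome\<close>

text \<open>The valence formula would give at most k / 12 zeros at the cusp; the maximum modulus
  bound gives about k / 10.9 and is used in the form \<open>3 * k \<le> 32 * m\<close>. The weights
  in the gap (14 for order 1, 22 and 26 for order 2) are excluded by multiplying a hypothetical form
  by E4, E4^2 or E6. The number 32/3 is tight there: a product of weight 32, compared up to q^2,
  meets the bound with equality. The moduli 5 and 7 enter because 240 is divisible by 5 and 504 by
  7. One of E4, E6 becomes 1, the operator q d/dq acts on polynomials in the other, and coefficients
  at primes become elementary. Rational coefficients come from a projection of the complex numbers
  onto the rationals, linear over the rationals. Applied to the coefficients of a polynomial in a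
  Hecke operator, it preserves identities between rational power series. It makes h rational,
  supplies a rational inverse of h, and shows that the characteristic polynomial of the second
  operator is rational.\<close>

definition nome :: "complex \<Rightarrow> complex" where
  "nome z = exp (2 * of_real pi * \<i> * z)"

definition qeval :: "complex fps \<Rightarrow> complex \<Rightarrow> complex" where
  "qeval F z = eval_fps F (nome z)"

text \<open>The operator theta = q d/dq: it multiplies the n-th coefficient by n and is d/dz divided
  by 2 pi i. It is defined over any commutative ring because the congruences need it over the
  integers.\<close>

definition qderiv :: "'a::comm_ring_1 fps \<Rightarrow> 'a fps" where
  "qderiv F = fps_X * fps_deriv F"

text \<open>A form is represented by its q-expansion. Holomorphy at the cusp is then part of the
  type, as a formal power series has no negative exponents, and holomorphy on the half plane is the
  condition on the radius.\<close>

definition mforms :: "nat \<Rightarrow> complex fps set" where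
  "mforms k = {F. fps_conv_radius F \<ge> 1 \<and>
     (\<forall>a b c d :: int. a * d - b * c = 1 \<longrightarrow> (\<forall>z\<in>upper_half_plane.
        qeval F ((of_int a * z + of_int b) / (of_int c * z + of_int d))
          = (of_int c * z + of_int d) ^ k * qeval F z))}"

lemma norm_nome: "norm (nome z) = exp (- (2 * pi * Im z))"
  by (simp add: nome_def)

lemma norm_nome_less_1: "z \<in> upper_half_plane \<Longrightarrow> norm (nome z) < 1"
  by (simp add: norm_nome upper_half_plane_def)

lemma nome_power: "nome z ^ m = nome (of_nat m * z)"
  by (simp add: nome_def exp_of_nat_mult [symmetric] mult_ac)

lemma nome_nonzero [simp]: "nome z \<noteq> 0"
  by (simp add: nome_def)

lemma nome_surj:
  assumes "w \<noteq> 0" obtains z where "nome z = w"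
proof
  show "nome (ln w / (2 * of_real pi * \<i>)) = w"
    using assms by (simp add: nome_def)
qed

lemma has_field_derivative_nome [derivative_intros]:
  "(nome has_field_derivative 2 * of_real pi * \<i> * nome z) (at z within A)"
  unfolding nome_def by (auto intro!: derivative_eq_intros)

lemma nome_in_conv_radius:
  "fps_conv_radius F \<ge> 1 \<Longrightarrow> z \<in> upper_half_plane \<Longrightarrow> ereal (norm (nome z)) < fps_conv_radius F"
  using norm_nome_less_1[of z] less_le_trans[of "ereal (norm (nome z))" 1] by simp

lemma open_upper_half_plane: "open upper_half_plane"
  unfolding upper_half_plane_def using open_halfspace_Im_gt[of 0] by simp

lemma Im_moebius:
  fixes a b c d :: real
  shows "Im ((of_real a * z + of_real b) / (of_real c * z + of_real d))
     = (a * d - b * c) * Im z / (norm (of_real c * z + of_real d))\<^sup>2"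
proof -
  have "norm (of_real c * z + of_real d) ^ 2 = (c * Re z + d)\<^sup>2 + (c * Im z)\<^sup>2"
    by (simp add: cmod_power2)
  thus ?thesis
    by (simp add: Im_divide algebra_simps power2_eq_square diff_divide_distrib)
qed

lemma Im_moebius_int:
  fixes a b c d :: int
  shows "Im ((of_int a * z + of_int b) / (of_int c * z + of_int d))
     = of_int (a * d - b * c) * Im z / (norm (of_int c * z + of_int d))\<^sup>2"
  using Im_moebius[of "of_int a" z "of_int b" "of_int c" "of_int d"] by simp

lemma automorphy_nonzero:
  fixes c d :: int
  assumes "z \<in> upper_half_plane" "c \<noteq> 0 \<or> d \<noteq> 0"
  shows "of_int c * z + of_int d \<noteq> 0"
proof
  assume "of_int c * z + of_int d = 0"
  hence "Im (of_int c * z + of_int d) = 0" "Re (of_int c * z + of_int d) = 0" by simp_all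
  with assms show False by (auto simp: upper_half_plane_def)
qed

lemma moebius_in_upper_half_plane:
  fixes a b c d :: int
  assumes "z \<in> upper_half_plane" "a * d - b * c > 0"
  shows "(of_int a * z + of_int b) / (of_int c * z + of_int d) \<in> upper_half_plane"
proof -
  have "c \<noteq> 0 \<or> d \<noteq> 0" using assms(2) by auto
  from automorphy_nonzero[OF assms(1) this] show ?thesis
    using assms by (simp add: upper_half_plane_def Im_moebius_int del: of_int_diff of_int_mult)
qed

lemma mformsD_radius: "F \<in> mforms k \<Longrightarrow> fps_conv_radius F \<ge> 1"
  by (simp add: mforms_def)

lemma mformsD:
  fixes a b c d :: int
  assumes "F \<in> mforms k" "a * d - b * c = 1" "z \<in> upper_half_plane"
  shows "qeval F ((of_int a * z + of_int b) / (of_int c * z + of_int d))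
          = (of_int c * z + of_int d) ^ k * qeval F z"
  using assms by (auto simp: mforms_def)

lemma mformsI:
  assumes "fps_conv_radius F \<ge> 1"
    and "\<And>(a::int) (b::int) (c::int) (d::int) z. a * d - b * c = 1 \<Longrightarrow> z \<in> upper_half_plane \<Longrightarrow>
        qeval F ((of_int a * z + of_int b) / (of_int c * z + of_int d))
          = (of_int c * z + of_int d) ^ k * qeval F z"
  shows "F \<in> mforms k"
  using assms by (auto simp: mforms_def)

lemma moebius_1:
  fixes a b c d :: int
  assumes "a * d - b * c = 1" "z \<in> upper_half_plane"
  shows "(of_int a * z + of_int b) / (of_int c * z + of_int d) \<in> upper_half_plane"
  using moebius_in_upper_half_plane[of z a d b c] assms by simp

lemma qeval_add:
  "fps_conv_radius F \<ge> 1 \<Longrightarrow> fps_conv_radius G \<ge> 1 \<Longrightarrow> z \<in> upper_half_plane \<Longrightarrow>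
    qeval (F + G) z = qeval F z + qeval G z"
  by (simp add: qeval_def eval_fps_add nome_in_conv_radius)

lemma qeval_diff:
  "fps_conv_radius F \<ge> 1 \<Longrightarrow> fps_conv_radius G \<ge> 1 \<Longrightarrow> z \<in> upper_half_plane \<Longrightarrow>
    qeval (F - G) z = qeval F z - qeval G z"
  by (simp add: qeval_def eval_fps_diff nome_in_conv_radius)

lemma qeval_mult:
  "fps_conv_radius F \<ge> 1 \<Longrightarrow> fps_conv_radius G \<ge> 1 \<Longrightarrow> z \<in> upper_half_plane \<Longrightarrow>
    qeval (F * G) z = qeval F z * qeval G z"
  by (simp add: qeval_def eval_fps_mult nome_in_conv_radius)

lemma qeval_const [simp]: "qeval (fps_const c) z = c"
  by (simp add: qeval_def)

lemma radius_add: "fps_conv_radius F \<ge> 1 \<Longrightarrow> fps_conv_radius G \<ge> 1 \<Longrightarrow> fps_conv_radius (F + G) \<ge> 1"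
  for F G :: "complex fps"
  using fps_conv_radius_add[of F G] by (meson min.boundedI order_trans)

lemma radius_diff: "fps_conv_radius F \<ge> 1 \<Longrightarrow> fps_conv_radius G \<ge> 1 \<Longrightarrow> fps_conv_radius (F - G) \<ge> 1"
  for F G :: "complex fps"
  using fps_conv_radius_diff[of F G] by (meson min.boundedI order_trans)

lemma radius_mult: "fps_conv_radius F \<ge> 1 \<Longrightarrow> fps_conv_radius G \<ge> 1 \<Longrightarrow> fps_conv_radius (F * G) \<ge> 1"
  for F G :: "complex fps"
  using fps_conv_radius_mult[of F G] by (meson min.boundedI order_trans)

lemma radius_qderiv: "fps_conv_radius F \<ge> 1 \<Longrightarrow> fps_conv_radius (qderiv F) \<ge> 1"
  for F :: "complex fps"
  unfolding qderiv_def by (intro radius_mult order_trans[OF _ fps_conv_radius_deriv]) auto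

lemma has_field_derivative_qeval:
  assumes "fps_conv_radius F \<ge> 1" "z \<in> upper_half_plane"
  shows "(qeval F has_field_derivative 2 * of_real pi * \<i> * qeval (qderiv F) z) (at z within A)"
proof -
  have r: "fps_conv_radius (fps_deriv F) \<ge> 1"
    using assms(1) fps_conv_radius_deriv[of F] by (rule order_trans)
  have "(eval_fps F has_field_derivative eval_fps (fps_deriv F) (nome z)) (at (nome z))"
    by (rule has_field_derivative_eval_fps) (rule nome_in_conv_radius[OF assms])
  from DERIV_chain2[OF this has_field_derivative_nome]
  have "(qeval F has_field_derivative eval_fps (fps_deriv F) (nome z) * (2 * of_real pi * \<i> * nome z)) (at z within A)"
    unfolding qeval_def by simp
  also have "eval_fps (fps_deriv F) (nome z) * (2 * of_real pi * \<i> * nome z)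
      = 2 * of_real pi * \<i> * qeval (qderiv F) z"
    using nome_in_conv_radius[OF r assms(2)]
    by (simp add: qeval_def qderiv_def eval_fps_mult mult_ac)
  finally show ?thesis .
qed

text \<open>The nome maps the half plane above height \<open>y\<close> onto a punctured disc around
  0. The function given by \<open>F\<close> vanishes there, at 0 itself by continuity, and therefore
  has no nonzero coefficient.\<close>

lemma qeval_eq_0_imp:
  assumes "fps_conv_radius F \<ge> 1" "y > 0" "\<And>z. Im z > y \<Longrightarrow> qeval F z = 0"
  shows "F = 0"
proof -
  have r: "fps_conv_radius F > 0" using assms(1) by (rule less_le_trans[rotated]) simp
  have ev: "eval_fps F w = 0" if w: "w \<noteq> 0" "norm w < exp (- (2 * pi * y))" for w
  proof -
    from w(1) obtain z where z: "nome z = w" by (rule nome_surj)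
    have "Im z > y" using w(2) unfolding z[symmetric] norm_nome by simp
    from assms(3)[OF this] show ?thesis using z by (simp add: qeval_def)
  qed
  have c: "isCont (eval_fps F) 0"
    using has_field_derivative_eval_fps[of 0 F UNIV] r by (intro DERIV_isCont) (auto simp: zero_ereal_def)
  have "\<forall>\<^sub>F w in at 0. eval_fps F w = 0"
    unfolding eventually_at by (rule exI[of _ "exp (- (2 * pi * y))"]) (auto intro!: ev)
  hence "(eval_fps F \<longlongrightarrow> 0) (at 0)" by (rule tendsto_eventually)
  with c have "eval_fps F 0 = 0"
    by (simp add: isCont_def) (metis LIM_unique)
  hence "eval_fps F w = 0" if "norm w < exp (- (2 * pi * y))" for w
    using ev[of w] that by (cases "w = 0") auto
  hence "eventually (\<lambda>w. eval_fps F w = eval_fps 0 w) (nhds 0)"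
    by (subst eventually_nhds_metric) (auto intro!: exI[of _ "exp (- (2 * pi * y))"])
  from eval_fps_eqD[OF r _ this] show ?thesis by simp
qed

section \<open>Closure properties of the spaces of modular forms\<close>

lemma mforms_0 [simp]: "0 \<in> mforms k"
  by (rule mformsI) (auto simp: qeval_def)

lemma mforms_add: "F \<in> mforms k \<Longrightarrow> G \<in> mforms k \<Longrightarrow> F + G \<in> mforms k"
  by (rule mformsI) (simp_all add: radius_add mformsD_radius qeval_add moebius_1 mformsD ring_distribs)

lemma mforms_diff: "F \<in> mforms k \<Longrightarrow> G \<in> mforms k \<Longrightarrow> F - G \<in> mforms k"
  by (rule mformsI) (simp_all add: radius_diff mformsD_radius qeval_diff moebius_1 mformsD ring_distribs)

lemma mforms_mult: "F \<in> mforms k \<Longrightarrow> G \<in> mforms l \<Longrightarrow> F * G \<in> mforms (k + l)"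
  by (rule mformsI) (simp_all add: radius_mult mformsD_radius qeval_mult moebius_1 mformsD power_add)

lemma mforms_const_mult: "F \<in> mforms k \<Longrightarrow> fps_const c * F \<in> mforms k"
  by (rule mformsI) (simp_all add: radius_mult mformsD_radius qeval_mult moebius_1 mformsD)

lemma mforms_1: "1 \<in> mforms 0"
  by (rule mformsI) (auto simp: qeval_def)

lemma mforms_power: "F \<in> mforms k \<Longrightarrow> F ^ n \<in> mforms (n * k)"
  by (induction n) (auto simp: mforms_1 intro: mforms_mult)

text \<open>Minus the identity fixes every point but has automorphy factor (-1)^k.\<close>

lemma mforms_odd:
  assumes "F \<in> mforms k" "odd k" shows "F = 0"
proof (rule qeval_eq_0_imp[of F 1])
  show "fps_conv_radius F \<ge> 1" by (rule mformsD_radius) fact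
  fix z assume "Im z > 1"
  hence z: "z \<in> upper_half_plane" by (simp add: upper_half_plane_def)
  from mformsD[OF assms(1), of "-1" "-1" 0 0 z] z assms(2) show "qeval F z = 0" by simp
qed simp

text \<open>Both sides of the transformation law are differentiated. The Moebius map has derivative
  (cz + d)^(-2), which shifts the weight by 2; the derivative of the automorphy factor leaves the
  term with \<open>c\<close>, the defect that keeps theta F from being modular.\<close>

lemma qeval_moebius_deriv:
  fixes a b c d :: int
  assumes F: "F \<in> mforms k" and det: "a * d - b * c = 1" and z: "z \<in> upper_half_plane"
  shows "2 * of_real pi * \<i> * qeval (qderiv F) ((of_int a * z + of_int b) / (of_int c * z + of_int d))
     = (of_int c * z + of_int d) ^ (k + 2) * (2 * of_real pi * \<i> * qeval (qderiv F) z)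
       + of_nat k * of_int c * (of_int c * z + of_int d) ^ (k + 1) * qeval F z"
proof -
  define j where "j = (\<lambda>z::complex. of_int c * z + of_int d)"
  define g where "g = (\<lambda>z::complex. (of_int a * z + of_int b) / j z)"
  let ?K = "2 * of_real pi * \<i> :: complex"
  note r = mformsD_radius[OF F]
  have "c \<noteq> 0 \<or> d \<noteq> 0" using det by auto
  from automorphy_nonzero[OF z this] have jz: "j z \<noteq> 0" by (simp add: j_def)
  have det': "of_int a * of_int d - of_int b * of_int c = (1::complex)"
    using det by (metis of_int_1 of_int_diff of_int_mult)
  have gz: "g z \<in> upper_half_plane" unfolding g_def j_def by (rule moebius_1[OF det z])
  have dj: "(j has_field_derivative of_int c) (at z)"
    unfolding j_def by (auto intro!: derivative_eq_intros)
  have "(g has_field_derivative (of_int a * j z - (of_int a * z + of_int b) * of_int c) / (j z * j z)) (at z)"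
    unfolding g_def by (rule derivative_eq_intros dj refl jz | simp)+
  also have "of_int a * j z - (of_int a * z + of_int b) * of_int c = 1"
    using det' by (simp add: j_def algebra_simps)
  finally have dg: "(g has_field_derivative 1 / (j z * j z)) (at z)" .
  have "((\<lambda>z. qeval F (g z)) has_field_derivative (?K * qeval (qderiv F) (g z)) * (1 / (j z * j z))) (at z)"
    using DERIV_chain2[OF has_field_derivative_qeval[OF r gz] dg] .
  moreover have "((\<lambda>z. j z ^ k * qeval F z) has_field_derivative
      of_nat k * (of_int c * j z ^ (k - 1)) * qeval F z + ?K * qeval (qderiv F) z * j z ^ k) (at z)"
    by (rule DERIV_mult DERIV_power[OF dj, THEN DERIV_cong] has_field_derivative_qeval[OF r z] | simp)+
  moreover have "\<forall>\<^sub>F w in nhds z. qeval F (g w) = j w ^ k * qeval F w"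
    using eventually_nhds_in_open[OF open_upper_half_plane z]
    by eventually_elim (unfold g_def j_def, rule mformsD[OF F det])
  ultimately have "?K * qeval (qderiv F) (g z) * (1 / (j z * j z)) =
      of_nat k * (of_int c * j z ^ (k - 1)) * qeval F z + ?K * qeval (qderiv F) z * j z ^ k"
    by (subst (asm) DERIV_cong_ev[OF refl _ refl]) (auto dest: DERIV_unique)
  hence "?K * qeval (qderiv F) (g z) = (j z * j z) *
      (of_nat k * (of_int c * j z ^ (k - 1)) * qeval F z + ?K * qeval (qderiv F) z * j z ^ k)"
    using jz by (simp add: field_simps)
  also have "\<dots> = j z ^ (k + 2) * (?K * qeval (qderiv F) z) + of_nat k * of_int c * j z ^ (k + 1) * qeval F z"
    by (cases k) (simp_all add: algebra_simps)
  finally show ?thesis by (simp add: g_def j_def)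
qed

text \<open>
  The first Rankin--Cohen bracket: the non-modular terms of the two derivatives cancel.
\<close>

lemma mforms_bracket:
  assumes F: "F \<in> mforms k" and G: "G \<in> mforms l"
  shows "of_nat k * F * qderiv G - of_nat l * G * qderiv F \<in> mforms (k + l + 2)"
proof (rule mformsI)
  note r = mformsD_radius[OF F] mformsD_radius[OF G]
  have on: "of_nat n = (fps_const (of_nat n) :: complex fps)" for n by (simp add: fps_of_nat)
  have rn: "fps_conv_radius (of_nat n :: complex fps) \<ge> 1" for n unfolding on by simp
  show "1 \<le> fps_conv_radius (of_nat k * F * qderiv G - of_nat l * G * qderiv F)"
    by (intro radius_diff radius_mult radius_qderiv r rn)
  have ev: "qeval (of_nat k * F * qderiv G - of_nat l * G * qderiv F) w =
     of_nat k * qeval F w * qeval (qderiv G) w - of_nat l * qeval G w * qeval (qderiv F) w"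
    if "w \<in> upper_half_plane" for w
    by (subst qeval_diff qeval_mult, (intro radius_diff radius_mult radius_qderiv r rn that)+)+
       (simp add: on)
  fix a b c d :: int and z :: complex
  assume det: "a * d - b * c = 1" and z: "z \<in> upper_half_plane"
  define w where "w = (of_int a * z + of_int b) / (of_int c * z + of_int d)"
  define j where "j = of_int c * z + of_int d"
  let ?K = "2 * of_real pi * \<i> :: complex"
  have w: "w \<in> upper_half_plane" unfolding w_def by (rule moebius_1[OF det z])
  have 1: "?K * qeval (qderiv F) w = j ^ (k + 2) * (?K * qeval (qderiv F) z)
        + of_nat k * of_int c * j ^ (k + 1) * qeval F z"
    unfolding w_def j_def by (rule qeval_moebius_deriv[OF F det z])
  have 2: "?K * qeval (qderiv G) w = j ^ (l + 2) * (?K * qeval (qderiv G) z)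
        + of_nat l * of_int c * j ^ (l + 1) * qeval G z"
    unfolding w_def j_def by (rule qeval_moebius_deriv[OF G det z])
  have 3: "qeval F w = j ^ k * qeval F z" "qeval G w = j ^ l * qeval G z"
    unfolding w_def j_def by (rule mformsD[OF F det z] mformsD[OF G det z])+
  have "?K * (of_nat k * qeval F w * qeval (qderiv G) w - of_nat l * qeval G w * qeval (qderiv F) w)
     = of_nat k * qeval F w * (?K * qeval (qderiv G) w) - of_nat l * qeval G w * (?K * qeval (qderiv F) w)"
    by (simp add: algebra_simps)
  also have "\<dots> = ?K * (j ^ (k + l + 2) * (of_nat k * qeval F z * qeval (qderiv G) z - of_nat l * qeval G z * qeval (qderiv F) z))"
    unfolding 1 2 3 by (simp add: algebra_simps power_add)
  finally have "of_nat k * qeval F w * qeval (qderiv G) w - of_nat l * qeval G w * qeval (qderiv F) w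
     = j ^ (k + l + 2) * (of_nat k * qeval F z * qeval (qderiv G) z - of_nat l * qeval G z * qeval (qderiv F) z)"
    by (subst (asm) mult_cancel_left) simp
  thus "qeval (of_nat k * F * qderiv G - of_nat l * G * qderiv F) w
     = j ^ (k + l + 2) * qeval (of_nat k * F * qderiv G - of_nat l * G * qderiv F) z"
    by (simp add: ev w z)
qed

section \<open>Vanishing of forms of large order at the cusp\<close>

text \<open>The lattice is discrete, so only finitely many of its vectors have norm at most 1. As
  (0, 1) is one of them, a minimum over these is a minimum over all nonzero vectors.\<close>

lemma exists_shortest_lattice_vector:
  assumes z: "z \<in> upper_half_plane"
  obtains c d :: int where "(c, d) \<noteq> (0, 0)"
    "\<And>m n :: int. (m, n) \<noteq> (0, 0) \<Longrightarrow> norm (of_int c * z + of_int d) \<le> norm (of_int m * z + of_int n)"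
proof -
  define y where "y = Im z"
  have y: "y > 0" using z by (simp add: y_def upper_half_plane_def)
  define f where "f = (\<lambda>p :: int \<times> int. norm (of_int (fst p) * z + of_int (snd p)))"
  define S where "S = {p. p \<noteq> (0, 0) \<and> f p \<le> 1}"
  define N where "N = \<lceil>1 / y\<rceil> + \<lceil>1 + norm z / y\<rceil>"
  have "S \<subseteq> {-N..N} \<times> {-N..N}"
  proof safe
    fix c d assume "(c, d) \<in> S"
    hence n: "norm (of_int c * z + of_int d) \<le> 1" by (simp add: S_def f_def)
    have "\<bar>of_int c\<bar> * y = \<bar>Im (of_int c * z + of_int d)\<bar>" using y by (simp add: y_def abs_mult)
    also have "\<dots> \<le> 1" using abs_Im_le_cmod n by (rule order_trans)
    finally have c: "\<bar>real_of_int c\<bar> \<le> 1 / y" using y by (simp add: field_simps)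
    have "\<bar>real_of_int d\<bar> = norm ((of_int c * z + of_int d) - of_int c * z)" by simp
    also have "\<dots> \<le> 1 + \<bar>real_of_int c\<bar> * norm z"
      using n by (intro order_trans[OF norm_triangle_ineq4]) (simp add: norm_mult)
    also have "\<dots> \<le> 1 + (1 / y) * norm z" using c by (intro add_mono mult_right_mono) auto
    finally have d: "\<bar>real_of_int d\<bar> \<le> 1 + norm z / y" by simp
    have "0 \<le> 1 / y" "0 \<le> norm z / y" using y by simp_all
    with c d have "\<bar>c\<bar> \<le> N" "\<bar>d\<bar> \<le> N" unfolding N_def by linarith+
    thus "c \<in> {-N..N}" "d \<in> {-N..N}" by auto
  qed
  hence fin: "finite S" by (rule finite_subset) simp
  have ne: "(0, 1) \<in> S" by (simp add: S_def f_def)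
  obtain p where p: "p \<in> S" "\<And>q. q \<in> S \<Longrightarrow> f p \<le> f q"
  proof
    show "arg_min_on f S \<in> S" using arg_min_if_finite(1)[OF fin, of f] ne by blast
    show "f (arg_min_on f S) \<le> f q" if "q \<in> S" for q
      using arg_min_least[OF fin _ that, of f] ne by blast
  qed
  obtain c d where [simp]: "p = (c, d)" by (cases p)
  show thesis
  proof
    show "(c, d) \<noteq> (0, 0)" using p(1) by (simp add: S_def f_def)
    fix m n :: int assume mn: "(m, n) \<noteq> (0, 0)"
    show "norm (of_int c * z + of_int d) \<le> norm (of_int m * z + of_int n)"
    proof (cases "(m, n) \<in> S")
      case True
      from p(2)[OF this] show ?thesis by (simp add: f_def)
    next
      case False
      hence "norm (of_int m * z + of_int n) > 1" using mn by (auto simp: S_def f_def)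
      moreover have "norm (of_int c * z + of_int d) \<le> 1" using p(1) by (simp add: S_def f_def)
      ultimately show ?thesis by linarith
    qed
  qed
qed

text \<open>A shortest vector cz + d as lower row makes the imaginary part of the image w as large
  as possible. The lattice spanned by w and 1 is the old one divided by cz + d, so its nonzero
  vectors have norm at least 1. For w - t with |Re w - t| at most 1/2 this gives (Im w)^2 at least
  3/4.\<close>

lemma reduce_to_fundamental_domain:
  assumes z: "z \<in> upper_half_plane"
  obtains a b c d :: int where "a * d - b * c = 1"
    "Im ((of_int a * z + of_int b) / (of_int c * z + of_int d)) \<ge> sqrt 3 / 2"
proof -
  obtain c d :: int where cd: "(c, d) \<noteq> (0, 0)"
    "\<And>m n :: int. (m, n) \<noteq> (0, 0) \<Longrightarrow> norm (of_int c * z + of_int d) \<le> norm (of_int m * z + of_int n)"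
    using exists_shortest_lattice_vector[OF z] by blast
  define j where "j = of_int c * z + of_int d"
  have jnz: "j \<noteq> 0" using automorphy_nonzero[OF z] cd(1) by (auto simp: j_def)
  \<comment> \<open>A common divisor could be divided out and would leave a shorter vector. So (c,
    d) is primitive and can be completed to a matrix of determinant 1.\<close>
  have "gcd c d = 1"
  proof -
    define g where "g = gcd c d"
    have g: "g > 0" using cd(1) by (auto simp: g_def gcd_pos_int)
    obtain c' d' where c'd': "c = g * c'" "d = g * d'" unfolding g_def
      by (metis dvdE gcd_dvd1 gcd_dvd2)
    with cd(1) have "(c', d') \<noteq> (0, 0)" by auto
    from cd(2)[OF this] have "norm j \<le> norm (of_int c' * z + of_int d')" by (simp add: j_def)
    moreover have "j = of_int g * (of_int c' * z + of_int d')"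
      by (simp add: j_def c'd' algebra_simps)
    hence "norm j = of_int g * norm (of_int c' * z + of_int d')"
      using g by (simp add: norm_mult)
    moreover from this jnz have "norm (of_int c' * z + of_int d') > 0" by auto
    ultimately have "real_of_int g \<le> 1" by (simp add: mult_le_cancel_right2)
    with g show ?thesis unfolding g_def by linarith
  qed
  then obtain u v where "u * c + v * d = 1" using bezout_int[of c d] by auto
  define a b where "a = v" and "b = -u"
  have det: "a * d - b * c = 1" using \<open>u * c + v * d = 1\<close> by (simp add: a_def b_def)
  define w where "w = (of_int a * z + of_int b) / j"
  have w: "w \<in> upper_half_plane" unfolding w_def j_def by (rule moebius_1[OF det z])
  \<comment> \<open>The translation by \<open>t\<close> enters only the estimate: it does not change
    the imaginary part, so the matrix needs no adjustment.\<close>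
  define t where "t = round (Re w)"
  have "norm (of_int 1 * w + of_int (-t)) \<ge> 1"
  proof -
    have "(a - t * c, b - t * d) \<noteq> (0, 0)"
    proof
      assume "(a - t * c, b - t * d) = (0, 0)"
      hence "a = t * c" "b = t * d" by auto
      with det show False by simp
    qed
    from cd(2)[OF this] have "norm j \<le> norm ((w - of_int t) * j)"
      using jnz by (simp add: w_def ring_distribs) (simp add: j_def algebra_simps)
    thus ?thesis using jnz by (simp add: norm_mult)
  qed
  hence "1 \<le> (norm (w - of_int t))\<^sup>2" by simp
  also have "\<dots> = (Re w - of_int t)\<^sup>2 + (Im w)\<^sup>2" by (simp add: cmod_power2)
  finally have 1: "1 \<le> (Re w - of_int t)\<^sup>2 + (Im w)\<^sup>2" .
  have "\<bar>Re w - of_int t\<bar> \<le> \<bar>1 / 2\<bar>" unfolding t_def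
    using of_int_round_abs_le[of "Re w"] by (simp add: abs_minus_commute)
  hence "(Re w - of_int t)\<^sup>2 \<le> (1 / 2)\<^sup>2" by (rule power2_le_iff_abs_le[THEN iffD2, rotated, OF order_trans]) simp_all
  also have "(1 / 2)\<^sup>2 = (1 / 4 :: real)" by (simp add: power2_eq_square)
  finally have "(Re w - of_int t)\<^sup>2 \<le> 1 / 4" .
  from add_right_mono[OF this, of "(Im w)\<^sup>2"] 1 have "3 / 4 \<le> (Im w)\<^sup>2" by simp
  hence "sqrt (3 / 4) \<le> Im w" using w
    by (intro real_le_lsqrt) (auto simp: upper_half_plane_def)
  hence "sqrt 3 / 2 \<le> Im w" by (simp add: real_sqrt_divide)
  from that[OF det] this show thesis by (simp add: w_def j_def)
qed

text \<open>The function y^k exp(-cy) has its maximum at y = k/c and decreases beyond it. The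
  inequality ln x \<le> x - 1 at x = y2/y1 takes the place of the derivative.\<close>

lemma power_exp_decreasing:
  fixes y1 y2 c :: real
  assumes "0 < y1" "y1 < y2" "real k < c * y1"
  shows "y2 ^ k * exp (- (c * y2)) < y1 ^ k * exp (- (c * y1))"
proof -
  have "ln (y2 / y1) \<le> y2 / y1 - 1" using assms by (intro ln_le_minus_one) auto
  hence "real k * ln (y2 / y1) \<le> real k * ((y2 - y1) / y1)"
    using assms by (intro mult_left_mono) (auto simp: field_simps)
  also have "\<dots> < c * y1 * ((y2 - y1) / y1)"
    using assms by (intro mult_strict_right_mono) auto
  also have "\<dots> = c * y2 - c * y1" using assms by (simp add: field_simps)
  finally have "exp (real k * ln (y2 / y1)) < exp (c * y2 - c * y1)" by simp
  also have "exp (real k * ln (y2 / y1)) = (y2 / y1) ^ k"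
    using assms by (simp add: exp_of_nat_mult)
  finally show ?thesis using assms
    by (simp add: power_divide exp_diff exp_minus field_simps)
qed

text \<open>
  Write \<open>F = q\<^sup>m G\<close>. The function \<open>|F|\<^sup>2 y\<^sup>k\<close> is \<open>SL\<^sub>2(\<int>)\<close>-invariant, so its values are bounded by
  those on \<open>y \<ge> \<surd>3 / 2\<close>; but \<open>|G|\<close> is largest on the boundary of a disc, and the remaining factor
  \<open>y\<^sup>k exp (- 4 \<pi> m y)\<close> is strictly larger on a horizontal line slightly below \<open>\<surd>3 / 2\<close>.
\<close>

lemma mforms_vanish:
  assumes F: "F \<in> mforms k" and m: "m \<ge> 1" "\<And>i. i < m \<Longrightarrow> fps_nth F i = 0" and k: "3 * k \<le> 32 * m"
  shows "F = 0"
proof -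
  define G where "G = fps_shift m F"
  \<comment> \<open>43/50 = 0.86 lies just below half the root of 3, which is 0.866..., and 4 * 3.14
    * 0.86 = 10.80... still exceeds 32/3. The first inequality leaves room below the fundamental
    domain, the second puts \<open>y1\<close> beyond the maximum at k / (4 pi m).\<close>
  define y1 :: real where "y1 = 43 / 50"
  define y2 :: real where "y2 = sqrt 3 / 2"
  note rF = mformsD_radius[OF F]
  have rG: "fps_conv_radius G \<ge> 1" unfolding G_def using rF by simp
  have FG: "F = fps_X ^ m * G" unfolding G_def
    by (rule fps_ext) (auto simp: fps_X_power_mult_nth m(2))
  have "sqrt (1.7225 ^ 2) < sqrt (3 :: real)" by (intro real_sqrt_less_mono) (simp add: power2_eq_square)
  hence y12: "0 < y1" "y1 < y2" by (simp_all add: y1_def y2_def)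
  have kc: "real k < 4 * pi * real m * y1"
  proof -
    have "real k \<le> 32 / 3 * real m" using k by linarith
    also have "32 / 3 * real m < 4 * (314 / 100) * y1 * real m"
      using m(1) by (intro mult_strict_right_mono) (auto simp: y1_def)
    also have "\<dots> \<le> 4 * pi * y1 * real m"
      using pi_approx y12 by (intro mult_right_mono mult_left_mono) auto
    finally show ?thesis by (simp add: mult_ac)
  qed
  define h where "h = (\<lambda>y::real. y ^ k * exp (- (4 * pi * real m * y)))"
  have h12: "h y2 < h y1" unfolding h_def by (rule power_exp_decreasing[OF y12 kc])
  have hdec: "h y \<le> h y2" if "y \<ge> y2" for y
  proof (cases "y = y2")
    case False
    have "4 * pi * real m * y1 \<le> 4 * pi * real m * y2" using y12 by (intro mult_left_mono) auto
    with kc have "real k < 4 * pi * real m * y2" by linarith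
    from power_exp_decreasing[OF _ _ this, of y] that False y12 show ?thesis by (simp add: h_def)
  qed auto
  have hpos: "h y > 0" if "y > 0" for y using that by (simp add: h_def)
  define \<phi> where "\<phi> = (\<lambda>z. (norm (qeval F z))\<^sup>2 * Im z ^ k)"
  have phi_eq: "\<phi> z = (norm (qeval G z))\<^sup>2 * h (Im z)" if z: "z \<in> upper_half_plane" for z
  proof -
    have "qeval F z = nome z ^ m * qeval G z"
      unfolding FG by (subst qeval_mult) (auto simp: rG z qeval_def eval_fps_X_power)
    hence "(norm (qeval F z))\<^sup>2 = (norm (nome z) ^ m)\<^sup>2 * (norm (qeval G z))\<^sup>2"
      by (simp add: norm_mult norm_power power_mult_distrib)
    also have "(norm (nome z) ^ m)\<^sup>2 = exp (- (4 * pi * real m * Im z))"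
      by (simp add: norm_nome power_mult [symmetric] exp_of_nat_mult [symmetric] algebra_simps)
    finally show ?thesis by (simp add: \<phi>_def h_def mult_ac)
  qed
  have phi_inv: "\<phi> ((of_int a * z + of_int b) / (of_int c * z + of_int d)) = \<phi> z"
    if det: "a * d - b * c = 1" and z: "z \<in> upper_half_plane" for a b c d :: int and z
  proof -
    have "c \<noteq> 0 \<or> d \<noteq> 0" using det by auto
    from automorphy_nonzero[OF z this] show ?thesis
      unfolding \<phi>_def mformsD[OF F det z] Im_moebius_int det
      by (simp add: norm_mult norm_power power_mult_distrib power_divide power_mult [symmetric] mult_ac)
  qed
  \<comment> \<open>The radius of the circle onto which the nome maps the line of height
    \<open>y1\<close>; points of at least that height land in the closed disc.\<close>
  define r where "r = exp (- (2 * pi * y1))"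
  have r: "0 < r" "r < 1" using y12 by (simp_all add: r_def)
  have sub: "cball (0::complex) r \<subseteq> eball 0 (fps_conv_radius G)"
  proof
    fix w :: complex assume "w \<in> cball 0 r"
    hence "norm w < 1" using r by simp
    hence "ereal (norm w) < 1" by simp
    also note rG
    finally show "w \<in> eball 0 (fps_conv_radius G)" by (simp add: eball_def)
  qed
  have cont: "continuous_on (cball 0 r) (eval_fps G)"
    using continuous_on_eval_fps sub by (rule continuous_on_subset)
  have "sphere 0 r \<noteq> ({} :: complex set)" "compact (sphere 0 r :: complex set)" using r by auto
  moreover have "continuous_on (sphere 0 r) (\<lambda>w. norm (eval_fps G w))"
    by (intro continuous_on_norm continuous_on_subset[OF cont]) auto
  ultimately obtain w0 where w0: "w0 \<in> sphere 0 r"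
    "\<And>w. w \<in> sphere 0 r \<Longrightarrow> norm (eval_fps G w) \<le> norm (eval_fps G w0)"
    using continuous_attains_sup[of "sphere 0 r" "\<lambda>w. norm (eval_fps G w)"] by blast
  define B where "B = norm (eval_fps G w0)"
  have max: "norm (eval_fps G w) \<le> B" if "w \<in> cball 0 r" for w
  proof (rule maximum_modulus_frontier[of "eval_fps G" "cball 0 r"])
    show "eval_fps G holomorphic_on interior (cball 0 r)"
      by (rule holomorphic_on_eval_fps) (use sub in auto)
    show "continuous_on (closure (cball 0 r)) (eval_fps G)" using cont by simp
    fix z assume "z \<in> frontier (cball 0 r :: complex set)"
    thus "norm (eval_fps G z) \<le> B" using w0(2) r by (simp add: B_def frontier_cball)
  qed (use that in auto)
  have phi_le: "\<phi> z \<le> B\<^sup>2 * h y2" if z: "z \<in> upper_half_plane" for z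
  proof -
    obtain a b c d :: int where det: "a * d - b * c = 1"
      and Im: "Im ((of_int a * z + of_int b) / (of_int c * z + of_int d)) \<ge> sqrt 3 / 2"
      by (rule reduce_to_fundamental_domain[OF z])
    define w where "w = (of_int a * z + of_int b) / (of_int c * z + of_int d)"
    have wy: "Im w \<ge> y2" using Im by (simp add: w_def y2_def)
    hence w: "w \<in> upper_half_plane" using y12 by (simp add: upper_half_plane_def)
    have "norm (nome w) \<le> r" unfolding norm_nome r_def using wy y12 by simp
    hence "norm (qeval G w) \<le> B" unfolding qeval_def by (intro max) simp
    have "\<phi> z = \<phi> w" unfolding w_def phi_inv[OF det z] ..
    also have "\<dots> = (norm (qeval G w))\<^sup>2 * h (Im w)" by (rule phi_eq[OF w])
    also have "\<dots> \<le> B\<^sup>2 * h y2"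
      using \<open>norm (qeval G w) \<le> B\<close> hdec[OF wy] hpos[of "Im w"] wy y12
      by (intro mult_mono power_mono) auto
    finally show ?thesis .
  qed
  have "w0 \<noteq> 0" using w0(1) r by auto
  then obtain z0 where z0: "nome z0 = w0" by (rule nome_surj)
  have "norm (nome z0) = r" using w0(1) z0 by simp
  hence Imz0: "Im z0 = y1" unfolding norm_nome r_def by simp
  have z0H: "z0 \<in> upper_half_plane" using Imz0 y12 by (simp add: upper_half_plane_def)
  have "B\<^sup>2 * h y1 = \<phi> z0" using phi_eq[OF z0H] Imz0 by (simp add: B_def qeval_def z0)
  also have "\<dots> \<le> B\<^sup>2 * h y2" by (rule phi_le[OF z0H])
  \<comment> \<open>The maximum \<open>B\<close> is attained at height \<open>y1\<close>, where the
    invariant function is still bounded by its values on the fundamental domain. As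
    \<open>h y2 < h y1\<close>, only B = 0 is possible.\<close>
  finally have "B = 0" using h12 by (simp add: mult_le_cancel_left)
  hence "eval_fps G w = 0" if "norm w \<le> r" for w using max[of w] that by simp
  hence "qeval G z = 0" if "Im z > y1" for z
    using that unfolding qeval_def by (simp add: norm_nome r_def)
  hence "G = 0" using rG y12 by (intro qeval_eq_0_imp[of G y1])
  thus ?thesis by (simp add: FG)
qed

section \<open>Eisenstein series\<close>

definition divisor_sum :: "nat \<Rightarrow> nat \<Rightarrow> nat" where
  "divisor_sum j n = (\<Sum>d | d dvd n. d ^ j)"

definition sigma_fps :: "nat \<Rightarrow> 'a::comm_ring_1 fps" where
  "sigma_fps j = Abs_fps (\<lambda>n. of_nat (divisor_sum j n))"

definition power_fps :: "nat \<Rightarrow> complex fps" where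
  "power_fps n = Abs_fps (\<lambda>r. of_nat r ^ n)"

lemma fps_nth_qderiv [simp]: "fps_nth (qderiv F) n = of_nat n * fps_nth F n"
  by (cases n) (auto simp: qderiv_def)

lemma fps_nth_qderiv_funpow: "fps_nth ((qderiv ^^ j) F) n = of_nat n ^ j * fps_nth F n"
  by (induction j) (auto simp: mult_ac)

lemma radius_qderiv_funpow: "fps_conv_radius F \<ge> 1 \<Longrightarrow> fps_conv_radius ((qderiv ^^ j) F) \<ge> 1"
  for F :: "complex fps"
  by (induction j) (auto intro: radius_qderiv)

lemma radius_geometric: "fps_conv_radius (Abs_fps (\<lambda>_. 1) :: complex fps) = 1"
  unfolding fps_conv_radius_def by (rule conv_radius_ratio_limit[of 1 1]) (simp_all add: one_ereal_def)

text \<open>Gives the radius of convergence: the geometric series has radius 1, and theta does not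
  bring a radius below 1.\<close>

lemma power_fps_altdef: "power_fps n = (qderiv ^^ n) (Abs_fps (\<lambda>_. 1))"
  by (rule fps_ext) (simp add: power_fps_def fps_nth_qderiv_funpow)

lemma radius_power_fps: "fps_conv_radius (power_fps n) \<ge> 1"
  unfolding power_fps_altdef by (rule radius_qderiv_funpow) (simp add: radius_geometric)

lemma divisor_sum_0 [simp]: "divisor_sum j 0 = 0"
  by (simp add: divisor_sum_def)

lemma divisor_sum_1 [simp]: "divisor_sum j (Suc 0) = 1"
  by (simp add: divisor_sum_def)

lemma divisor_sum_prime:
  assumes "prime (p :: nat)" shows "divisor_sum j p = 1 + p ^ j"
proof -
  have "{d. d dvd p} = {1, p}" using assms by (auto simp: prime_nat_iff)
  moreover have "p \<noteq> 1" using assms by auto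
  ultimately show ?thesis by (simp add: divisor_sum_def)
qed

lemma divisor_sum_le: "divisor_sum j n \<le> n ^ Suc j"
proof (cases "n = 0")
  case False
  have "divisor_sum j n \<le> (\<Sum>d | d dvd n. n ^ j)"
    unfolding divisor_sum_def using False by (intro sum_mono power_mono) (auto dest: dvd_imp_le)
  also have "\<dots> = card {d. d dvd n} * n ^ j" by simp
  also have "card {d. d dvd n} \<le> card {1..n}"
    using False by (intro card_mono) (auto dest: dvd_imp_le simp: Suc_le_eq intro: Nat.gr0I)
  hence "card {d. d dvd n} * n ^ j \<le> n * n ^ j" by (intro mult_right_mono) auto
  finally show ?thesis by simp
qed auto

section \<open>The Lipschitz formula\<close>

text \<open>Logarithmic differentiation of the reflection formula for Gamma gives pi cot(pi z); the
  right-hand side is this cotangent written in q.\<close>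

lemma Digamma_reflection:
  assumes z: "z \<in> upper_half_plane"
  shows "Digamma (1 - z) - Digamma z = - (of_real pi * \<i> * (1 + nome z) / (1 - nome z))"
proof -
  have ni: "w \<notin> \<int>\<^sub>\<le>\<^sub>0" if "Im w \<noteq> 0" for w using that by (auto elim!: nonpos_Ints_cases)
  have z1: "z \<notin> \<int>\<^sub>\<le>\<^sub>0" "1 - z \<notin> \<int>\<^sub>\<le>\<^sub>0" using z by (auto simp: upper_half_plane_def intro!: ni)
  define s where "s = exp (\<i> * (of_real pi * z))"
  have s: "s \<noteq> 0" by (simp add: s_def)
  have qs: "nome z = s * s" by (simp add: nome_def s_def exp_add [symmetric] algebra_simps)
  have q1: "nome z \<noteq> 1" using norm_nome_less_1[OF z] by auto
  have sin: "sin (of_real pi * z) = (s - inverse s) / (2 * \<i>)"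
    and cos: "cos (of_real pi * z) = (s + inverse s) / 2"
    by (simp_all add: sin_exp_eq cos_exp_eq s_def exp_minus)
  have sn0: "sin (of_real pi * z) \<noteq> 0" using q1 s unfolding sin qs by (auto simp: field_simps)
  have "((\<lambda>w. Gamma w * Gamma (1 - w)) has_field_derivative
      Gamma z * Digamma z * Gamma (1 - z) - Gamma z * (Gamma (1 - z) * Digamma (1 - z))) (at z)"
    by (rule derivative_eq_intros refl z1 | simp)+
  moreover have "(\<lambda>w. Gamma w * Gamma (1 - w)) = (\<lambda>w. of_real pi / sin (of_real pi * w :: complex))"
    by (rule ext) (rule Gamma_reflection_complex)
  moreover have "((\<lambda>w. of_real pi / sin (of_real pi * w :: complex)) has_field_derivative
      - (of_real pi * (cos (of_real pi * z) * of_real pi)) / (sin (of_real pi * z) * sin (of_real pi * z))) (at z)"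
    by (rule derivative_eq_intros refl sn0 | simp)+
  ultimately have "Gamma z * Digamma z * Gamma (1 - z) - Gamma z * (Gamma (1 - z) * Digamma (1 - z)) =
     - (of_real pi * (cos (of_real pi * z) * of_real pi)) / (sin (of_real pi * z) * sin (of_real pi * z))"
    by (metis DERIV_unique)
  hence "Gamma z * Gamma (1 - z) * (Digamma z - Digamma (1 - z)) =
     - (of_real pi * (cos (of_real pi * z) * of_real pi)) / (sin (of_real pi * z) * sin (of_real pi * z))"
    by (simp add: algebra_simps)
  hence "of_real pi / sin (of_real pi * z) * (Digamma z - Digamma (1 - z)) =
     of_real pi / sin (of_real pi * z) * (- (of_real pi * cos (of_real pi * z) / sin (of_real pi * z)))"
    unfolding Gamma_reflection_complex by simp
  hence "Digamma z - Digamma (1 - z) = - (of_real pi * cos (of_real pi * z) / sin (of_real pi * z))"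
    using sn0 by (subst (asm) mult_cancel_left) auto
  hence "Digamma (1 - z) - Digamma z = of_real pi * cos (of_real pi * z) / sin (of_real pi * z)"
    by (simp add: algebra_simps)
  also have "\<dots> = of_real pi * \<i> * ((s + inverse s) / (s - inverse s))"
  proof -
    have "of_real pi * (u / 2) / (v / (2 * \<i>)) = of_real pi * \<i> * (u / v)" for u v :: complex
    proof -
      have "of_real pi * (u / 2) / (v / (2 * \<i>)) = (of_real pi * (u / 2) * (2 * \<i>)) / v"
        by (rule divide_divide_eq_right)
      also have "of_real pi * (u / 2) * (2 * \<i>) = of_real pi * \<i> * (u / 2 * 2)" by (simp only: mult_ac)
      also have "u / 2 * 2 = u" by simp
      finally show ?thesis by (simp only: times_divide_eq_right)
    qed
    thus ?thesis unfolding sin cos .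
  qed
  also have "(s + inverse s) / (s - inverse s) = (s * (s + inverse s)) / (s * (s - inverse s))"
    using s by simp
  also have "s * (s + inverse s) = nome z + 1" using s by (simp add: qs ring_distribs)
  also have "s * (s - inverse s) = nome z - 1" using s by (simp add: qs ring_distribs)
  also have "of_real pi * \<i> * ((nome z + 1) / (nome z - 1)) = - (of_real pi * \<i> * (1 + nome z) / (1 - nome z))"
    using q1 by (simp add: divide_simps) (simp add: algebra_simps)
  finally show ?thesis .
qed

text \<open>The cotangent expansion differentiated n times. If A_n denotes the left-hand side, its
  derivative is -A_(n+1), while each differentiation of a q-series yields the factor 2 pi i and one
  theta.\<close>

lemma Polygamma_reflection:
  assumes z: "z \<in> upper_half_plane" and n: "n > 0"
  shows "(-1) ^ Suc n * Polygamma n z + Polygamma n (1 - z)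
     = (- (2 * of_real pi * \<i>)) ^ Suc n * qeval (power_fps n) z"
proof -
  define A where "A = (\<lambda>n z. (-1) ^ Suc n * Polygamma n z + Polygamma n (1 - z) :: complex)"
  \<comment> \<open>The expansion of pi cot(pi z), which is pi i - 2 pi i (1 + q + q^2 + ...). Its
    constant term disappears after one theta, hence the assumption n > 0.\<close>
  define G where "G = fps_const (of_real pi * \<i>) - fps_const (2 * of_real pi * \<i>) * Abs_fps (\<lambda>_. 1)"
  have rG: "fps_conv_radius G \<ge> 1"
    unfolding G_def by (intro radius_diff radius_mult) (auto simp: radius_geometric)
  note rGn = radius_qderiv_funpow[OF rG]
  have "A n w = (- (2 * of_real pi * \<i>)) ^ n * qeval ((qderiv ^^ n) G) w" if "w \<in> upper_half_plane" for n w
    using that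
  proof (induction n arbitrary: w)
    case (0 w)
    have q1: "nome w \<noteq> 1" using norm_nome_less_1[OF 0] by auto
    have "qeval (Abs_fps (\<lambda>_. 1)) w = 1 / (1 - nome w)"
      unfolding qeval_def eval_fps_def using norm_nome_less_1[OF 0] by (simp add: suminf_geometric)
    hence "qeval G w = of_real pi * \<i> - 2 * of_real pi * \<i> * (1 / (1 - nome w))"
      unfolding G_def using 0 by (simp add: qeval_diff qeval_mult radius_mult radius_geometric)
    also have "\<dots> = - (of_real pi * \<i> * (1 + nome w) / (1 - nome w))"
      using q1 by (simp add: divide_simps) (simp add: algebra_simps)
    also have "\<dots> = A 0 w" using Digamma_reflection[OF 0] by (simp add: A_def)
    finally show ?case by simp
  next
    case (Suc n w)
    have ni: "w \<notin> \<int>\<^sub>\<le>\<^sub>0" if "Im w \<noteq> 0" for w using that by (auto elim!: nonpos_Ints_cases)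
    have w1: "w \<notin> \<int>\<^sub>\<le>\<^sub>0" "1 - w \<notin> \<int>\<^sub>\<le>\<^sub>0"
      using Suc.prems by (auto simp: upper_half_plane_def intro!: ni)
    have "((\<lambda>w. (-1) ^ Suc n * Polygamma n w) has_field_derivative (-1) ^ Suc n * Polygamma (Suc n) w) (at w)"
      by (intro DERIV_cmult has_field_derivative_Polygamma w1)
    moreover have "((\<lambda>w. Polygamma n (1 - w)) has_field_derivative Polygamma (Suc n) (1 - w) * (-1)) (at w)"
      by (rule DERIV_chain2[of "Polygamma n" _ "\<lambda>w. 1 - w"])
        (auto intro!: derivative_eq_intros has_field_derivative_Polygamma w1(2))
    ultimately have "(A n has_field_derivative (-1) ^ Suc n * Polygamma (Suc n) w + Polygamma (Suc n) (1 - w) * (-1)) (at w)"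
      unfolding A_def by (rule DERIV_add)
    also have "(-1) ^ Suc n * Polygamma (Suc n) w + Polygamma (Suc n) (1 - w) * (-1) = - A (Suc n) w"
      by (simp add: A_def)
    finally have 1: "(A n has_field_derivative - A (Suc n) w) (at w)" .
    have 2: "((\<lambda>w. (- (2 * of_real pi * \<i>)) ^ n * qeval ((qderiv ^^ n) G) w) has_field_derivative
         (- (2 * of_real pi * \<i>)) ^ n * (2 * of_real pi * \<i> * qeval (qderiv ((qderiv ^^ n) G)) w)) (at w)"
      by (intro DERIV_cmult has_field_derivative_qeval rGn Suc.prems)
    have "\<forall>\<^sub>F u in nhds w. A n u = (- (2 * of_real pi * \<i>)) ^ n * qeval ((qderiv ^^ n) G) u"
      using eventually_nhds_in_open[OF open_upper_half_plane Suc.prems]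
      by eventually_elim (rule Suc.IH)
    from DERIV_cong_ev[OF refl this refl] 1
    have "((\<lambda>w. (- (2 * of_real pi * \<i>)) ^ n * qeval ((qderiv ^^ n) G) w) has_field_derivative - A (Suc n) w) (at w)"
      by simp
    from DERIV_unique[OF this 2]
    have "- ((- (2 * of_real pi * \<i>)) ^ n * (2 * of_real pi * \<i> * qeval (qderiv ((qderiv ^^ n) G)) w)) = A (Suc n) w"
      unfolding minus_equation_iff[of "A (Suc n) w"] .
    from this [symmetric] show ?case by simp
  qed
  from this[OF z, of n]
  have "A n z = (- (2 * of_real pi * \<i>)) ^ n * qeval ((qderiv ^^ n) G) z" .
  also have "(qderiv ^^ n) G = fps_const (- (2 * of_real pi * \<i>)) * power_fps n"
    by (rule fps_ext) (use n in \<open>simp add: power_fps_def G_def fps_nth_qderiv_funpow\<close>)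
  also have "qeval \<dots> z = - (2 * of_real pi * \<i>) * qeval (power_fps n) z"
    by (subst qeval_mult) (auto simp: radius_power_fps z)
  finally show ?thesis by (simp add: A_def mult_ac)
qed

text \<open>The negative integers are enumerated as -j - 1 because z + (-j - 1) = -(1 - z + j) turns
  a sum over them into a polygamma series at 1 - z.\<close>

lemma range_int_neg: "(UNIV :: int set) = range int \<union> range (\<lambda>j. - int j - 1)"
  "range int \<inter> range (\<lambda>j. - int j - 1) = {}"
proof -
  have "x \<in> range int \<union> range (\<lambda>j. - int j - 1)" for x
  proof (cases "x \<ge> 0")
    case True
    hence "x = int (nat x)" by simp
    thus ?thesis by blast
  next
    case False
    hence "x = - int (nat (- x - 1)) - 1" by simp
    thus ?thesis by blast
  qed
  thus "(UNIV :: int set) = range int \<union> range (\<lambda>j. - int j - 1)" by blast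
qed auto

text \<open>The polygamma series at z runs over the nonnegative shifts, the one at 1 - z over the
  negative shifts; the reflection formula evaluates their sum.\<close>

lemma Lipschitz_formula:
  assumes z: "z \<in> upper_half_plane" and n: "n > 0"
    and sm: "(\<lambda>j::int. inverse ((z + of_int j) ^ Suc n)) summable_on UNIV"
  shows "(\<Sum>\<^sub>\<infinity>j::int. inverse ((z + of_int j) ^ Suc n))
     = (- (2 * of_real pi * \<i>)) ^ Suc n / fact n * qeval (power_fps n) z"
proof -
  define f where "f = (\<lambda>j::int. inverse ((z + of_int j) ^ Suc n))"
  have z0: "z \<noteq> 0" "1 - z \<noteq> 0" using z by (auto simp: upper_half_plane_def)
  have inj: "inj int" "inj (\<lambda>j. - int j - 1)" by (auto intro: injI)
  have sm1: "f summable_on A" for A using sm unfolding f_def by (rule summable_on_subset_banach) auto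
  have reindex: "infsum f (range h) = S" if h: "inj h" and S: "(\<lambda>n. f (h n)) sums S" for h :: "nat \<Rightarrow> int" and S
  proof -
    have "(f \<circ> h) summable_on UNIV" using sm1[of "range h"] h by (simp add: summable_on_reindex)
    hence "((f \<circ> h) has_sum infsum (f \<circ> h) UNIV) UNIV" by (rule has_sum_infsum)
    from has_sum_imp_sums[OF this] have "(\<lambda>n. f (h n)) sums infsum (f \<circ> h) UNIV" by (simp add: o_def)
    with S have "infsum (f \<circ> h) UNIV = S" by (simp add: sums_unique2)
    thus ?thesis using h by (simp add: infsum_reindex)
  qed
  have 1: "infsum f (range int) = (-1) ^ Suc n * Polygamma n z / fact n"
    using Polygamma_LIMSEQ[OF z0(1) n] by (intro reindex inj) (simp add: f_def)
  have "(\<lambda>k. (-1) ^ Suc n * inverse ((1 - z + of_nat k) ^ Suc n)) sums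
     ((-1) ^ Suc n * ((-1) ^ Suc n * Polygamma n (1 - z) / fact n))"
    by (intro sums_mult Polygamma_LIMSEQ z0 n)
  also have "(\<lambda>k. (-1) ^ Suc n * inverse ((1 - z + of_nat k) ^ Suc n)) = (\<lambda>k. f (- int k - 1))"
  proof
    fix k
    have "z + of_int (- int k - 1) = - (1 - z + of_nat k)" by simp
    hence "f (- int k - 1) = inverse ((- (1 - z + of_nat k)) ^ Suc n)" unfolding f_def by (rule arg_cong)
    also have "\<dots> = inverse ((-1) ^ Suc n * (1 - z + of_nat k) ^ Suc n)" by (subst power_minus) simp
    also have "\<dots> = (-1) ^ Suc n * inverse ((1 - z + of_nat k) ^ Suc n)"
      by (subst inverse_mult_distrib) (simp add: power_inverse [symmetric])
    finally show "(-1) ^ Suc n * inverse ((1 - z + of_nat k) ^ Suc n) = f (- int k - 1)" ..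
  qed
  also have "(-1) ^ Suc n * ((-1) ^ Suc n * Polygamma n (1 - z) / fact n) = Polygamma n (1 - z) / fact n"
    by (simp add: mult.assoc [symmetric] flip: power_mult_distrib)
  finally have 2: "infsum f (range (\<lambda>j. - int j - 1)) = Polygamma n (1 - z) / fact n"
    by (intro reindex inj)
  have "infsum f UNIV = infsum f (range int) + infsum f (range (\<lambda>j. - int j - 1))"
    by (subst range_int_neg(1)) (intro infsum_Un_disjoint sm1 range_int_neg(2))
  also have "\<dots> = ((-1) ^ Suc n * Polygamma n z + Polygamma n (1 - z)) / fact n"
    unfolding 1 2 by (rule add_divide_distrib [symmetric])
  also have "\<dots> = (- (2 * of_real pi * \<i>)) ^ Suc n / fact n * qeval (power_fps n) z"
    unfolding Polygamma_reflection[OF z n] by simp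
  finally show ?thesis by (simp add: f_def)
qed

section \<open>Convergence and modularity of the lattice sums\<close>

lemma summable_on_inverse_squares_int: "(\<lambda>m::int. 1 / (1 + \<bar>real_of_int m\<bar>) ^ 2) summable_on UNIV"
proof -
  have "summable (\<lambda>n. inverse (real n ^ 2))" by (rule inverse_power_summable) simp
  hence s: "summable (\<lambda>n. inverse (real (Suc n) ^ 2))" by (subst summable_Suc_iff)
  hence s': "summable (\<lambda>n. inverse (real (Suc (Suc n)) ^ 2))" by (subst summable_Suc_iff)
  have "(\<lambda>m::int. 1 / (1 + \<bar>real_of_int m\<bar>) ^ 2) summable_on range int"
    using s by (subst summable_on_reindex)
      (auto simp: o_def summable_on_UNIV_nonneg_real_iff field_simps intro: injI)
  moreover have "(\<lambda>m::int. 1 / (1 + \<bar>real_of_int m\<bar>) ^ 2) summable_on range (\<lambda>j. - int j - 1)"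
  proof -
    have [simp]: "\<bar>- real k - 1\<bar> = real (Suc k)" for k by simp
    show ?thesis
      using s' by (subst summable_on_reindex)
       (auto simp: o_def summable_on_UNIV_nonneg_real_iff field_simps intro: injI)
  qed
  ultimately show ?thesis
    by (subst range_int_neg(1)) (intro summable_on_Un_disjoint range_int_neg(2))
qed

text \<open>Both 1 + |m| and 1 + |n| are bounded by a multiple of |mz + n|. So the terms are
  dominated by a multiple of (1 + |m|)^(-2) (1 + |n|)^(-2), a product of two convergent series; this
  uses up four powers of |mz + n|.\<close>

lemma eisenstein_summable:
  assumes z: "z \<in> upper_half_plane" and k: "k \<ge> 4"
  shows "(\<lambda>(m, n). inverse ((of_int m * z + of_int n) ^ k)) summable_on (UNIV - {(0 :: int, 0 :: int)})"
proof -
  define y where "y = Im z"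
  have y: "y > 0" using z by (simp add: y_def upper_half_plane_def)
  define K where "K = 1 / y + 1 + norm z / y"
  have K: "K \<ge> 1" using y by (simp add: K_def)
  define g where "g = (\<lambda>m::int. 1 / (1 + \<bar>real_of_int m\<bar>) ^ 2)"
  have gs: "(g has_sum infsum g UNIV) UNIV"
    unfolding g_def by (intro has_sum_infsum summable_on_inverse_squares_int)
  have "(\<lambda>(m, n). g m * g n) summable_on (UNIV \<times> UNIV)"
  proof (rule summable_on_SigmaI)
    show "((\<lambda>n. (\<lambda>(m, n). g m * g n) (m, n)) has_sum g m * infsum g UNIV) UNIV" for m
      using has_sum_cmult_right[OF gs, of "g m"] by simp
    show "(\<lambda>m. g m * infsum g UNIV) summable_on UNIV"
      using has_sum_cmult_left[OF gs] by (rule has_sum_imp_summable)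
  qed (auto simp: g_def)
  hence gg: "(\<lambda>p. (2 * K) ^ k * (case p of (m, n) \<Rightarrow> g m * g n)) summable_on (UNIV - {(0, 0)})"
    by (intro summable_on_cmult_right) (rule summable_on_subset_banach, auto)
  have "(\<lambda>p. norm ((\<lambda>(m, n). inverse ((of_int m * z + of_int n) ^ k)) p)) summable_on (UNIV - {(0, 0)})"
  proof (rule Infinite_Sum.abs_summable_on_comparison_test'[OF gg])
    fix p :: "int \<times> int" assume p: "p \<in> UNIV - {(0, 0)}"
    obtain m n where [simp]: "p = (m, n)" by (cases p)
    define w where "w = of_int m * z + of_int n"
    have "\<bar>of_int m\<bar> * y = \<bar>Im w\<bar>" using y by (simp add: y_def abs_mult w_def)
    also have "\<dots> \<le> norm w" by (rule abs_Im_le_cmod)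
    finally have m1: "\<bar>real_of_int m\<bar> \<le> norm w / y" using y by (simp add: field_simps)
    have "\<bar>real_of_int n\<bar> = norm (w - of_int m * z)" by (simp add: w_def)
    also have "\<dots> \<le> norm w + \<bar>real_of_int m\<bar> * norm z"
      by (intro order_trans[OF norm_triangle_ineq4]) (simp add: norm_mult)
    also have "\<dots> \<le> norm w + (norm w / y) * norm z" using m1 by (intro add_mono mult_right_mono) auto
    finally have n1: "\<bar>real_of_int n\<bar> \<le> norm w + norm w * norm z / y" by simp
    have "0 \<le> norm w / y" "0 \<le> norm w * norm z / y" using y by simp_all
    moreover have "K * norm w = norm w / y + norm w + norm w * norm z / y"
      by (simp add: K_def algebra_simps)
    ultimately have mn: "\<bar>real_of_int m\<bar> \<le> K * norm w" "\<bar>real_of_int n\<bar> \<le> K * norm w"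
      using m1 n1 by (smt (verit) norm_ge_zero)+
    \<comment> \<open>A nonzero integer has absolute value at least 1, so K |mz + n| is at least 1.
      This absorbs the summands 1 and allows the exponent 4 to be raised to k.\<close>
    have "m \<noteq> 0 \<or> n \<noteq> 0" using p by auto
    hence "1 \<le> \<bar>real_of_int m\<bar> \<or> 1 \<le> \<bar>real_of_int n\<bar>" by linarith
    with mn have one: "1 \<le> K * norm w" by linarith
    define W where "W = 2 * (K * norm w)"
    have W: "1 + \<bar>real_of_int m\<bar> \<le> W" "1 + \<bar>real_of_int n\<bar> \<le> W" "1 \<le> W"
      using mn one by (auto simp: W_def)
    have "(1 + \<bar>real_of_int m\<bar>) ^ 2 * (1 + \<bar>real_of_int n\<bar>) ^ 2 \<le> W ^ 2 * W ^ 2"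
      using W by (intro mult_mono power_mono) auto
    also have "\<dots> = W ^ 4" by (simp flip: power_add)
    also have "\<dots> \<le> W ^ k" using W k by (intro power_increasing) auto
    also have "\<dots> = (2 * K) ^ k * norm w ^ k" by (simp add: W_def power_mult_distrib mult_ac)
    finally have le: "(1 + \<bar>real_of_int m\<bar>) ^ 2 * (1 + \<bar>real_of_int n\<bar>) ^ 2 \<le> (2 * K) ^ k * norm w ^ k" .
    have "w \<noteq> 0" using one by auto
    hence wpos: "norm w ^ k > 0" by simp
    have "inverse (norm w ^ k) \<le> (2 * K) ^ k * (1 / ((1 + \<bar>real_of_int m\<bar>) ^ 2 * (1 + \<bar>real_of_int n\<bar>) ^ 2))"
      using le wpos by (simp add: field_simps)
    thus "norm ((\<lambda>(m, n). inverse ((of_int m * z + of_int n) ^ k)) p) \<le> (2 * K) ^ k * (case p of (m, n) \<Rightarrow> g m * g n)"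
      by (simp add: g_def w_def norm_inverse norm_power)
  qed
  thus ?thesis by (rule Infinite_Sum.abs_summable_summable)
qed

definition eisenstein_sum :: "nat \<Rightarrow> complex \<Rightarrow> complex" where
  "eisenstein_sum k z = infsum (\<lambda>(m, n). inverse ((of_int m * z + of_int n) ^ k)) (UNIV - {(0 :: int, 0 :: int)})"

text \<open>The matrix acts on the pairs (m, n) from the right and permutes the nonzero ones. The
  denominator of the Moebius image, taken out of each term, is the factor (cz + d)^k.\<close>

lemma eisenstein_sum_moebius:
  fixes a b c d :: int
  assumes det: "a * d - b * c = 1" and z: "z \<in> upper_half_plane"
  shows "eisenstein_sum k ((of_int a * z + of_int b) / (of_int c * z + of_int d))
     = (of_int c * z + of_int d) ^ k * eisenstein_sum k z"
proof -
  define j where "j = of_int c * z + of_int d"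
  have "c \<noteq> 0 \<or> d \<noteq> 0" using det by auto
  from automorphy_nonzero[OF z this] have j: "j \<noteq> 0" by (simp add: j_def)
  define h where "h = (\<lambda>(m, n). (m * a + n * c, m * b + n * d))"
  define h' where "h' = (\<lambda>(m, n). (m * d - n * c, n * a - m * b))"
  have det': "a * d = 1 + b * c" using det by simp
  have hh': "h' (h p) = p" "h (h' p) = p" for p
  proof -
    obtain m n where p: "p = (m, n)" by (cases p)
    have "(m * a + n * c) * d - (m * b + n * d) * c = m * (a * d - b * c)"
      "(m * b + n * d) * a - (m * a + n * c) * b = n * (a * d - b * c)"
      "(m * d - n * c) * a + (n * a - m * b) * c = m * (a * d - b * c)"
      "(m * d - n * c) * b + (n * a - m * b) * d = n * (a * d - b * c)"
      by (simp_all add: algebra_simps)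
    thus "h' (h p) = p" "h (h' p) = p" by (simp_all add: h_def h'_def p det)
  qed
  have h0: "h (0, 0) = (0, 0)" "h' (0, 0) = (0, 0)" by (simp_all add: h_def h'_def)
  have bij: "bij_betw h (UNIV - {(0, 0)}) (UNIV - {(0, 0)})"
  proof (rule bij_betwI[of _ _ _ h'])
    show "h \<in> UNIV - {(0, 0)} \<rightarrow> UNIV - {(0, 0)}"
    proof
      fix p :: "int \<times> int" assume "p \<in> UNIV - {(0, 0)}"
      hence "h' (h p) \<noteq> (0, 0)" by (simp add: hh')
      thus "h p \<in> UNIV - {(0, 0)}" using h0(2) by (cases "h p = (0, 0)") simp_all
    qed
    show "h' \<in> UNIV - {(0, 0)} \<rightarrow> UNIV - {(0, 0)}"
    proof
      fix p :: "int \<times> int" assume "p \<in> UNIV - {(0, 0)}"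
      hence "h (h' p) \<noteq> (0, 0)" by (simp add: hh')
      thus "h' p \<in> UNIV - {(0, 0)}" using h0(1) by (cases "h' p = (0, 0)") simp_all
    qed
  qed (use hh' in auto)
  have "eisenstein_sum k ((of_int a * z + of_int b) / j) =
      infsum (\<lambda>p. j ^ k * (\<lambda>(m, n). inverse ((of_int m * z + of_int n) ^ k)) (h p)) (UNIV - {(0, 0)})"
    unfolding eisenstein_sum_def
  proof (rule infsum_cong)
    fix p :: "int \<times> int"
    obtain m n where p: "p = (m, n)" by (cases p)
    define W where "W = of_int (m * a + n * c) * z + of_int (m * b + n * d)"
    have "W = of_int m * (of_int a * z + of_int b) + of_int n * j"
      by (simp add: W_def j_def algebra_simps)
    hence "of_int m * ((of_int a * z + of_int b) / j) + of_int n = W / j"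
      using j by (simp add: add_divide_distrib ring_distribs)
    hence "inverse ((of_int m * ((of_int a * z + of_int b) / j) + of_int n) ^ k) = inverse ((W / j) ^ k)"
      by (rule arg_cong)
    also have "\<dots> = j ^ k * inverse (W ^ k)"
      by (simp only: power_divide inverse_divide) (simp only: divide_inverse)
    finally show "(case p of (m, n) \<Rightarrow> inverse ((of_int m * ((of_int a * z + of_int b) / j) + of_int n) ^ k)) =
        j ^ k * (case h p of (m, n) \<Rightarrow> inverse ((of_int m * z + of_int n) ^ k))"
      by (simp only: h_def W_def prod.case p)
  qed
  also have "\<dots> = j ^ k * infsum (\<lambda>p. (\<lambda>(m, n). inverse ((of_int m * z + of_int n) ^ k)) (h p)) (UNIV - {(0, 0)})"
    by (rule infsum_cmult_right')
  also have "\<dots> = j ^ k * eisenstein_sum k z"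
    unfolding eisenstein_sum_def by (subst infsum_reindex_bij_betw[OF bij]) (rule refl)
  finally show ?thesis by (simp add: j_def)
qed

section \<open>Fourier expansion of the Eisenstein series\<close>

lemma radius_sigma_fps: "fps_conv_radius (sigma_fps j :: complex fps) \<ge> 1"
  unfolding fps_conv_radius_def
proof (rule conv_radius_geI_ex')
  fix r :: real assume r: "0 < r" "ereal r < 1"
  have "ereal (norm (complex_of_real r)) < 1" using r by simp
  also note radius_power_fps[of "Suc j"]
  finally have 1: "summable (\<lambda>n. norm (fps_nth (power_fps (Suc j)) n * complex_of_real r ^ n))"
    by (rule norm_summable_fps)
  have 2: "norm (fps_nth (sigma_fps j) n * complex_of_real r ^ n)
      \<le> norm (fps_nth (power_fps (Suc j)) n * complex_of_real r ^ n)" for n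
  proof -
    have "real (divisor_sum j n) \<le> real n ^ Suc j"
      using divisor_sum_le[of j n] by (metis of_nat_le_iff of_nat_power)
    thus ?thesis using r(1)
      by (simp add: sigma_fps_def power_fps_def norm_mult norm_power mult_right_mono)
  qed
  from 1 show "summable (\<lambda>n. fps_nth (sigma_fps j) n * complex_of_real r ^ n)"
    by (rule summable_comparison_test'[where N = 0]) (rule 2)
qed

lemma divisor_sum_codivisors:
  assumes "n > 0" shows "divisor_sum j n = (\<Sum>d | d dvd n. (n div d) ^ j)"
  unfolding divisor_sum_def
  by (rule sum.reindex_bij_witness[of _ "\<lambda>d. n div d" "\<lambda>d. n div d"]) (use assms in auto)

text \<open>Absolute convergence allows the double sum to be regrouped by N = mr. The pairs with
  product N correspond to the divisors m of N with r = N div m, so each group is a divisor sum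
  written over codivisors.\<close>

lemma Lambert_has_sum:
  assumes z: "z \<in> upper_half_plane"
  shows "((\<lambda>(m, r). of_nat r ^ n * nome z ^ (m * r)) has_sum qeval (sigma_fps n) z) ({1..} \<times> {1 :: nat..})"
proof -
  define q where "q = nome z"
  define g where "g = (\<lambda>(N :: nat, m). of_nat (N div m) ^ n * q ^ N)"
  define S where "S = Sigma {1..} (\<lambda>N :: nat. {m. m dvd N})"
  have fin: "finite {m. m dvd N}" if "N \<ge> 1" for N :: nat using that by (intro finite_divisors_nat) auto
  note s = norm_summable_fps[OF nome_in_conv_radius[OF radius_sigma_fps z], of n]
  have outer: "(\<lambda>N. real (divisor_sum n N) * norm q ^ N) summable_on {1..}"
  proof (rule summable_on_subset_banach)
    show "(\<lambda>N. real (divisor_sum n N) * norm q ^ N) summable_on UNIV"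
      using s by (subst summable_on_UNIV_nonneg_real_iff)
        (auto simp: sigma_fps_def norm_mult norm_power q_def)
  qed auto
  have "(\<lambda>(N, m). real (N div m) ^ n * norm q ^ N) summable_on S"
    unfolding S_def
  proof (rule summable_on_SigmaI[OF _ outer])
    fix N :: nat assume N: "N \<in> {1..}"
    show "((\<lambda>m. (\<lambda>(N, m). real (N div m) ^ n * norm q ^ N) (N, m)) has_sum real (divisor_sum n N) * norm q ^ N) {m. m dvd N}"
      using N by (intro has_sum_finiteI fin)
        (auto simp: divisor_sum_codivisors sum_distrib_right)
  qed auto
  also have "(\<lambda>(N, m). real (N div m) ^ n * norm q ^ N) = (\<lambda>p. norm (g p))"
    by (auto simp: g_def norm_mult norm_power fun_eq_iff)
  finally have gs: "g summable_on S" by (rule Infinite_Sum.abs_summable_summable)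
  have "(g has_sum qeval (sigma_fps n) z) S"
    unfolding S_def
  proof (rule has_sum_SigmaI)
    fix N :: nat assume N: "N \<in> {1..}"
    show "((\<lambda>m. g (N, m)) has_sum of_nat (divisor_sum n N) * q ^ N) {m. m dvd N}"
      using N by (intro has_sum_finiteI fin)
        (auto simp: g_def divisor_sum_codivisors sum_distrib_right)
  next
    have "((\<lambda>N. fps_nth (sigma_fps n) N * q ^ N) has_sum qeval (sigma_fps n) z) UNIV"
      using s sums_eval_fps[OF nome_in_conv_radius[OF radius_sigma_fps z], of n]
      unfolding q_def qeval_def by (rule norm_summable_imp_has_sum)
    also have "?this \<longleftrightarrow> ((\<lambda>N. of_nat (divisor_sum n N) * q ^ N) has_sum qeval (sigma_fps n) z) {1..}"
      by (rule has_sum_cong_neutral) (auto simp: sigma_fps_def not_le)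
    finally show "((\<lambda>N. of_nat (divisor_sum n N) * q ^ N) has_sum qeval (sigma_fps n) z) {1..}" .
  qed (use gs in \<open>simp add: S_def\<close>)
  also have "(g has_sum qeval (sigma_fps n) z) S \<longleftrightarrow>
      ((\<lambda>(m, r). of_nat r ^ n * nome z ^ (m * r)) has_sum qeval (sigma_fps n) z) ({1..} \<times> {1 :: nat..})"
    by (rule has_sum_reindex_bij_witness[of _ "\<lambda>(m, r). (m * r, m)" "\<lambda>(N, m). (m, N div m)"])
       (auto simp: S_def g_def q_def Suc_le_eq dvd_imp_le div_greater_zero_iff intro: Nat.gr0I)
  finally show ?thesis .
qed

text \<open>The row m = 0 gives the constant term, the rows with m < 0 repeat those with m > 0
  because k is even, and each row with m > 0 is a Lipschitz sum at mz. The sum of these rows is a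
  Lambert series.\<close>

lemma eisenstein_sum_expansion:
  assumes z: "z \<in> upper_half_plane" and k: "k \<ge> 4" "even k"
  shows "eisenstein_sum k z = (\<Sum>\<^sub>\<infinity>n\<in>UNIV - {0 :: int}. inverse (of_int n ^ k))
     + 2 * ((- (2 * of_real pi * \<i>)) ^ k / fact (k - 1)) * qeval (sigma_fps (k - 1)) z"
proof -
  define f where "f = (\<lambda>(m :: int, n :: int). inverse ((of_int m * z + of_int n) ^ k))"
  define C where "C = (- (2 * of_real pi * \<i>)) ^ k / fact (k - 1)"
  have sm: "f summable_on A" if "A \<subseteq> UNIV - {(0, 0)}" for A
    using eisenstein_summable[OF z k(1)] that unfolding f_def by (rule summable_on_subset_banach)
  define A0 A1 A2 :: "(int \<times> int) set"
    where "A0 = Pair 0 ` (UNIV - {0})" and "A1 = {0<..} \<times> UNIV" and "A2 = {..<0} \<times> UNIV"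
  have A: "UNIV - {(0, 0)} = A0 \<union> (A1 \<union> A2)"
    by (auto simp: A0_def A1_def A2_def)
  have s012: "f summable_on A0" "f summable_on A1" "f summable_on A2" "f summable_on (A1 \<union> A2)"
    by (intro sm; auto simp: A0_def A1_def A2_def)+
  have "eisenstein_sum k z = infsum f (A0 \<union> (A1 \<union> A2))"
    unfolding eisenstein_sum_def A[symmetric] f_def ..
  also have "\<dots> = infsum f A0 + infsum f (A1 \<union> A2)"
    by (intro infsum_Un_disjoint s012) (auto simp: A0_def A1_def A2_def)
  also have "infsum f (A1 \<union> A2) = infsum f A1 + infsum f A2"
    by (intro infsum_Un_disjoint s012) (auto simp: A0_def A1_def A2_def)
  also have "infsum f A0 = (\<Sum>\<^sub>\<infinity>n\<in>UNIV - {0 :: int}. inverse (of_int n ^ k))"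
    unfolding A0_def by (subst infsum_reindex) (auto simp: f_def o_def intro: inj_onI)
  also have "infsum f A2 = infsum f A1"
  proof -
    have "bij_betw (\<lambda>p. - p) A1 A2"
      by (rule bij_betwI[of _ _ _ "\<lambda>p. - p"]) (auto simp: A1_def A2_def)
    hence "infsum f A2 = infsum (\<lambda>p. f (- p)) A1" by (rule infsum_reindex_bij_betw [symmetric])
    also have "\<dots> = infsum f A1"
    proof (rule infsum_cong)
      fix p :: "int \<times> int"
      obtain m n where p: "p = (m, n)" by (cases p)
      have "of_int (- m) * z + of_int (- n) = - (of_int m * z + of_int n)" by simp
      hence "(of_int (- m) * z + of_int (- n)) ^ k = (of_int m * z + of_int n) ^ k"
        by (simp only: power_minus_even[OF k(2)])
      thus "f (- p) = f p" by (simp add: f_def p del: of_int_minus)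
    qed
    finally show ?thesis .
  qed
  also have "infsum f A1 = C * qeval (sigma_fps (k - 1)) z"
  proof -
    have zm: "of_int m * z \<in> upper_half_plane" if "m > 0" for m :: int
      using z that by (simp add: upper_half_plane_def)
    have row: "(\<Sum>\<^sub>\<infinity>n. f (m, n)) = C * qeval (power_fps (k - 1)) (of_int m * z)" if m: "m > 0" for m
    proof -
      have "f summable_on Pair m ` UNIV" by (rule sm) (use m in auto)
      hence "(\<lambda>n. f (m, n)) summable_on UNIV"
        by (subst (asm) summable_on_reindex) (auto simp: o_def intro: inj_onI)
      with Lipschitz_formula[OF zm[OF m], of "k - 1"] show ?thesis using k(1) by (simp add: f_def C_def)
    qed
    define h where "h = (\<lambda>(m, r). of_nat r ^ (k - 1) * nome z ^ (m * r))"
    note L = Lambert_has_sum[OF z, of "k - 1", folded h_def]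
    have row': "(\<Sum>\<^sub>\<infinity>r\<in>{1..}. h (m, r)) = qeval (power_fps (k - 1)) (of_int (int m) * z)" if m: "m \<ge> 1" for m
    proof -
      have u: "of_int (int m) * z \<in> upper_half_plane" using m by (intro zm) auto
      note rr = nome_in_conv_radius[OF radius_power_fps u]
      have "((\<lambda>r. fps_nth (power_fps (k - 1)) r * nome (of_int (int m) * z) ^ r) has_sum
          qeval (power_fps (k - 1)) (of_int (int m) * z)) UNIV"
        using norm_summable_fps[OF rr] sums_eval_fps[OF rr]
        unfolding qeval_def by (rule norm_summable_imp_has_sum)
      also have "?this \<longleftrightarrow> ((\<lambda>r. h (m, r)) has_sum qeval (power_fps (k - 1)) (of_int (int m) * z)) {1..}"
        by (rule has_sum_cong_neutral)
           (use k in \<open>auto simp: not_le h_def power_fps_def nome_power [symmetric] power_mult\<close>)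
      finally show ?thesis by (rule infsumI)
    qed
    have "infsum f A1 = (\<Sum>\<^sub>\<infinity>m\<in>{0<..}. \<Sum>\<^sub>\<infinity>n. f (m, n))"
      unfolding A1_def by (rule infsum_Sigma_banach [symmetric]) (use s012(2) in \<open>simp add: A1_def\<close>)
    also have "\<dots> = (\<Sum>\<^sub>\<infinity>m\<in>{0<..}. C * qeval (power_fps (k - 1)) (of_int m * z))"
      by (rule infsum_cong) (simp add: row)
    also have "\<dots> = C * (\<Sum>\<^sub>\<infinity>m\<in>{0<..}. qeval (power_fps (k - 1)) (of_int m * z))"
      by (rule infsum_cmult_right')
    also have "(\<Sum>\<^sub>\<infinity>m\<in>{0<..}. qeval (power_fps (k - 1)) (of_int m * z)) =
        (\<Sum>\<^sub>\<infinity>m\<in>{1..}. qeval (power_fps (k - 1)) (of_int (int m) * z))"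
    proof -
      have "bij_betw int {1..} {0<..}"
        by (rule bij_betwI[of _ _ _ nat]) auto
      thus ?thesis by (rule infsum_reindex_bij_betw [symmetric])
    qed
    also have "\<dots> = (\<Sum>\<^sub>\<infinity>m\<in>{1..}. \<Sum>\<^sub>\<infinity>r\<in>{1..}. h (m, r))"
      by (rule infsum_cong) (use row' in auto)
    also have "\<dots> = infsum h ({1..} \<times> {1..})"
      by (rule infsum_Sigma_banach) (rule has_sum_imp_summable[OF L])
    also have "\<dots> = qeval (sigma_fps (k - 1)) z" by (rule infsumI[OF L])
    finally show ?thesis .
  qed
  finally show ?thesis by (simp add: C_def)
qed

text \<open>No zeta value is needed to see that the constant term is nonzero. Otherwise the lattice
  sum would be a cusp form of weight at most 10, hence zero, although its first coefficient is a
  nonzero multiple of pi^k. The limit 10 on the weight comes from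
  \<open>3 * k \<le> 32\<close>.\<close>

lemma eisenstein_series_exists:
  assumes k: "k \<ge> 4" "even k" "k \<le> 10"
  obtains c where "c \<noteq> 0" "1 + fps_const c * sigma_fps (k - 1) \<in> mforms k"
proof -
  define Z where "Z = (\<Sum>\<^sub>\<infinity>n\<in>UNIV - {0 :: int}. inverse (of_int n ^ k) :: complex)"
  define C :: complex where "C = 2 * ((- (2 * of_real pi * \<i>)) ^ k / fact (k - 1))"
  have C: "C \<noteq> 0" by (simp add: C_def)
  define G where "G = fps_const Z + fps_const C * sigma_fps (k - 1)"
  have r: "fps_conv_radius (fps_const C * sigma_fps (k - 1)) \<ge> 1"
    by (intro radius_mult radius_sigma_fps) simp
  have rG: "fps_conv_radius G \<ge> 1" unfolding G_def by (intro radius_add r) simp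
  have ev: "qeval G z = eisenstein_sum k z" if "z \<in> upper_half_plane" for z
    unfolding G_def eisenstein_sum_expansion[OF that k(1,2), folded Z_def C_def]
    by (simp add: qeval_add qeval_mult r[simplified] radius_sigma_fps that)
  have G: "G \<in> mforms k"
    by (rule mformsI[OF rG]) (simp add: ev moebius_1 eisenstein_sum_moebius)
  have "Z \<noteq> 0"
  proof
    assume "Z = 0"
    hence "fps_nth G 0 = 0" by (simp add: G_def sigma_fps_def)
    hence "G = 0" using k by (intro mforms_vanish[OF G, of 1]) auto
    hence "fps_nth G 1 = 0" by simp
    thus False using C by (simp add: G_def sigma_fps_def)
  qed
  show thesis
  proof
    show "C / Z \<noteq> 0" using C \<open>Z \<noteq> 0\<close> by simp
    have "1 + fps_const (C / Z) * sigma_fps (k - 1) = fps_const (inverse Z) * G"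
      using \<open>Z \<noteq> 0\<close> by (intro fps_ext) (auto simp: G_def algebra_simps divide_inverse)
    also have "\<dots> \<in> mforms k" by (rule mforms_const_mult[OF G])
    finally show "1 + fps_const (C / Z) * sigma_fps (k - 1) \<in> mforms k" .
  qed
qed

section \<open>The forms of weight 4, 6 and 12, and small weights\<close>

text \<open>The coefficient ring is left open: the same series serve as complex modular forms and,
  over the integers, as the objects of congruences.\<close>

definition E4 :: "'a::comm_ring_1 fps" where "E4 = 1 + 240 * sigma_fps 3"
definition E6 :: "'a::comm_ring_1 fps" where "E6 = 1 - 504 * sigma_fps 5"
text \<open>This is \<open>1728 \<Delta>\<close>, which has visibly integral coefficients.\<close>

definition Disc :: "'a::comm_ring_1 fps" where "Disc = E4 ^ 3 - E6 ^ 2"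

lemma divisor_sum_2: "divisor_sum j 2 = 1 + 2 ^ j"
  by (rule divisor_sum_prime) simp

lemma fps_nth_sigma_fps [simp]: "fps_nth (sigma_fps j) n = of_nat (divisor_sum j n)"
  by (simp add: sigma_fps_def)

lemma fps_mult_nth_low: "fps_nth (F * G) (Suc 0) = fps_nth F 0 * fps_nth G (Suc 0) + fps_nth F (Suc 0) * fps_nth G 0"
  "fps_nth (F * G) 2 = fps_nth F 0 * fps_nth G 2 + fps_nth F (Suc 0) * fps_nth G (Suc 0) + fps_nth F 2 * fps_nth G 0"
  by (simp_all add: fps_mult_nth numeral_2_eq_2)

lemma E4_nth [simp]: "fps_nth E4 0 = 1" "fps_nth E4 (Suc 0) = 240"
  by (simp_all add: E4_def)

lemma E6_nth [simp]: "fps_nth E6 0 = 1" "fps_nth E6 (Suc 0) = - 504"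
  by (simp_all add: E6_def)

lemma Disc_nth [simp]: "fps_nth Disc 0 = 0" "fps_nth Disc (Suc 0) = 1728"
  by (simp_all add: Disc_def power3_eq_cube power2_eq_square fps_mult_nth_low)

lemma mforms_eq:
  assumes "F \<in> mforms k" "G \<in> mforms k" "m \<ge> 1" "3 * k \<le> 32 * m"
    "\<And>i. i < m \<Longrightarrow> fps_nth F i = fps_nth G i"
  shows "F = G"
  using mforms_vanish[OF mforms_diff[OF assms(1,2)], of m] assms(3-) by simp

text \<open>
  The Eisenstein series are known to be \<open>1 + c \<Sum> \<sigma>(n) q\<^sup>n\<close> with some \<open>c \<noteq> 0\<close>. Comparing coefficients in
  \<open>E\<^sub>4\<^sup>2 = E\<^sub>8\<close> and \<open>E\<^sub>4 E\<^sub>6 = E\<^sub>1\<^sub>0\<close> determines the constants without zeta values.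
\<close>

lemma E4_E6_mforms: "(E4 :: complex fps) \<in> mforms 4" "(E6 :: complex fps) \<in> mforms 6"
  and E4_square: "(E4 :: complex fps) ^ 2 = 1 + 480 * sigma_fps 7"
proof -
  obtain c4 where c4: "c4 \<noteq> 0" "1 + fps_const c4 * sigma_fps 3 \<in> mforms 4"
    using eisenstein_series_exists[of 4] by auto
  obtain c6 where c6: "c6 \<noteq> 0" "1 + fps_const c6 * sigma_fps 5 \<in> mforms 6"
    using eisenstein_series_exists[of 6] by auto
  obtain c8 where c8: "c8 \<noteq> 0" "1 + fps_const c8 * sigma_fps 7 \<in> mforms 8"
    using eisenstein_series_exists[of 8] by auto
  obtain c10 where c10: "c10 \<noteq> 0" "1 + fps_const c10 * sigma_fps 9 \<in> mforms 10"
    using eisenstein_series_exists[of 10] by auto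
  have 8: "(1 + fps_const c4 * sigma_fps 3) * (1 + fps_const c4 * sigma_fps 3) = 1 + fps_const c8 * sigma_fps 7"
    using mforms_mult[OF c4(2) c4(2)] c8(2) by (intro mforms_eq[of _ 8 _ 1]) simp_all
  have 10: "(1 + fps_const c4 * sigma_fps 3) * (1 + fps_const c6 * sigma_fps 5) = 1 + fps_const c10 * sigma_fps 9"
    using mforms_mult[OF c4(2) c6(2)] c10(2) by (intro mforms_eq[of _ 10 _ 1]) simp_all
  have c8': "c8 = 2 * c4"
    using arg_cong[OF 8, of "\<lambda>F. fps_nth F (Suc 0)"] by (simp add: fps_mult_nth_low)
  \<comment> \<open>Coefficients of q^2, where 9 and 129 are the sums of third and of seventh powers
    of the divisors of 2.\<close>
  have "c4 * 9 + c4 * c4 + c4 * 9 = 2 * c4 * 129"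
    using arg_cong[OF 8, of "\<lambda>F. fps_nth F 2"] by (simp add: fps_mult_nth_low divisor_sum_2 c8')
  hence "c4 * (c4 - 240) = 0" by (simp add: algebra_simps)
  hence c4': "c4 = 240" using c4(1) by simp
  have c10': "c10 = c4 + c6"
    using arg_cong[OF 10, of "\<lambda>F. fps_nth F (Suc 0)"] by (simp add: fps_mult_nth_low add_ac)
  \<comment> \<open>Here 33 and 513 come from the fifth and ninth powers of the divisors of
    2.\<close>
  have "c6 * 33 + c4 * c6 + c4 * 9 = (c4 + c6) * 513"
    using arg_cong[OF 10, of "\<lambda>F. fps_nth F 2"] by (simp add: fps_mult_nth_low divisor_sum_2 c10')
  hence "240 * (c6 + 504) = 0" unfolding c4' by (simp add: algebra_simps)
  hence "c6 + 504 = 0" by (subst (asm) mult_eq_0_iff) simp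
  hence c6': "c6 = - 504" unfolding eq_neg_iff_add_eq_0 .
  have E4: "1 + fps_const c4 * sigma_fps 3 = E4"
    by (simp add: E4_def c4' numeral_fps_const)
  have E6: "1 + fps_const c6 * sigma_fps 5 = E6"
    by (simp add: E6_def c6' numeral_fps_const flip: fps_const_neg)
  show "(E4 :: complex fps) \<in> mforms 4" using c4(2) by (simp add: E4)
  show "(E6 :: complex fps) \<in> mforms 6" using c6(2) by (simp add: E6)
  show "(E4 :: complex fps) ^ 2 = 1 + 480 * sigma_fps 7"
    using 8 unfolding E4 by (simp add: power2_eq_square c8' c4' numeral_fps_const)
qed

lemma Disc_mforms: "(Disc :: complex fps) \<in> mforms 12"
  unfolding Disc_def using mforms_power[OF E4_E6_mforms(1), of 3] mforms_power[OF E4_E6_mforms(2), of 2]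
  by (intro mforms_diff) simp_all

lemma Disc_nonzero: "(Disc :: complex fps) \<noteq> 0"
  by (metis Disc_nth(2) fps_zero_nth zero_neq_numeral)

text \<open>The bracket of E6 and E4 has weight 12 and vanishes at the cusp, so the coefficient of q
  decides: 6 * 240 + 4 * 504 = 2 * 1728. Modulo 5 and modulo 7 the identity turns into a
  differential equation for a single Eisenstein series.\<close>

lemma bracket_E4_E6: "3 * E6 * qderiv E4 - 2 * E4 * qderiv E6 = (Disc :: complex fps)"
proof -
  have "of_nat 6 * E6 * qderiv E4 - of_nat 4 * E4 * qderiv E6 = fps_const 2 * (Disc :: complex fps)"
    using mforms_bracket[OF E4_E6_mforms(2,1)] mforms_const_mult[OF Disc_mforms, of 2]
    by (intro mforms_eq[of _ 12 _ 2])
       (auto simp: less_Suc_eq numeral_2_eq_2 fps_mult_nth_low mult.assoc)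
  hence "2 * (3 * E6 * qderiv E4 - 2 * E4 * qderiv E6) = 2 * (Disc :: complex fps)"
    by (simp add: numeral_fps_const [symmetric] algebra_simps)
  thus ?thesis by (subst (asm) mult_cancel_left) simp
qed

lemma Disc_power_nth:
  "i < m \<Longrightarrow> fps_nth (Disc ^ m :: 'a::comm_ring_1 fps) i = 0"
  "fps_nth (Disc ^ m :: 'a fps) m = 1728 ^ m"
proof -
  define H :: "'a fps" where "H = fps_shift 1 Disc"
  have D: "Disc = fps_X * H" by (rule fps_ext) (auto simp: H_def)
  have H0: "fps_nth H 0 = 1728" by (simp add: H_def)
  show "i < m \<Longrightarrow> fps_nth (Disc ^ m :: 'a fps) i = 0" "fps_nth (Disc ^ m :: 'a fps) m = 1728 ^ m"
    by (simp_all add: D power_mult_distrib fps_X_power_mult_nth fps_power_zeroth H0)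
qed

lemma fps_mult_nth_order:
  fixes F G :: "'a::comm_ring_1 fps"
  assumes "\<And>i. i < m \<Longrightarrow> fps_nth F i = 0"
  shows "i < m \<Longrightarrow> fps_nth (F * G) i = 0" "fps_nth (F * G) m = fps_nth F m * fps_nth G 0"
proof -
  define H where "H = fps_shift m F"
  have F: "F = fps_X ^ m * H" by (rule fps_ext) (use assms in \<open>auto simp: H_def fps_X_power_mult_nth\<close>)
  have H0: "fps_nth F m = fps_nth H 0" by (simp add: H_def)
  show "i < m \<Longrightarrow> fps_nth (F * G) i = 0" "fps_nth (F * G) m = fps_nth F m * fps_nth G 0"
    by (simp_all add: H0) (simp_all add: F mult.assoc fps_X_power_mult_nth)
qed

text \<open>
  Both products of \<open>F\<close> lie in spaces where the order \<open>m\<close> part is at most one-dimensional; the two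
  resulting formulas for \<open>F\<close> are incompatible.
\<close>

lemma mforms_vanish_by_products:
  assumes F: "F \<in> mforms k" "\<And>i. i < m \<Longrightarrow> fps_nth F i = 0"
    and A: "A \<in> mforms a" "A' \<in> mforms a'" "fps_nth A 0 = 1" "fps_nth A' 0 = 1"
      "k + a = 12 * m + a'" "3 * (k + a) \<le> 32 * Suc m"
    and B: "B \<in> mforms b" "B' \<in> mforms b'" "fps_nth B 0 = 1" "fps_nth B' 0 = 1"
      "k + b = 12 * m + b'" "3 * (k + b) \<le> 32 * Suc m"
    and ne: "A' * B \<noteq> B' * A"
  shows "F = 0"
proof -
  \<comment> \<open>The only possible multiple: \<open>Disc ^ m\<close> begins with 1728^m q^m, and
    the other factors begin with 1.\<close>
  define c where "c = fps_nth F m / 1728 ^ m"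
  have eq: "F * A = fps_const c * (Disc ^ m * A')"
    if A: "A \<in> mforms a" "A' \<in> mforms a'" "fps_nth A 0 = 1" "fps_nth A' 0 = 1"
      "k + a = 12 * m + a'" "3 * (k + a) \<le> 32 * Suc m" for A A' a a'
  proof (rule mforms_eq[of _ "k + a" _ "Suc m"])
    show "F * A \<in> mforms (k + a)" by (intro mforms_mult F A)
    have "Disc ^ m * A' \<in> mforms (m * 12 + a')" by (intro mforms_mult mforms_power Disc_mforms A)
    thus "fps_const c * (Disc ^ m * A') \<in> mforms (k + a)"
      using A(5) by (intro mforms_const_mult) (simp add: mult.commute)
    fix i assume "i < Suc m"
    then consider "i < m" | "i = m" by linarith
    thus "fps_nth (F * A) i = fps_nth (fps_const c * (Disc ^ m * A')) i"
      by cases (simp_all add: fps_mult_nth_order F(2) Disc_power_nth A c_def)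
  qed (use A in auto)
  have "fps_const c * Disc ^ m * (A' * B) = fps_const c * (Disc ^ m * A') * B" by (simp only: mult_ac)
  also have "\<dots> = F * A * B" by (simp only: eq[OF A])
  also have "\<dots> = F * B * A" by (simp only: mult_ac)
  also have "\<dots> = fps_const c * (Disc ^ m * B') * A" by (simp only: eq[OF B])
  also have "\<dots> = fps_const c * Disc ^ m * (B' * A)" by (simp only: mult_ac)
  finally have "fps_const c * Disc ^ m = 0" using ne by (subst (asm) mult_cancel_left) simp
  hence "c = 0" using Disc_nonzero by (auto simp: fps_const_eq_0_iff)
  hence "F * A = 0" by (simp add: eq[OF A])
  moreover have "A \<noteq> 0" using A(3) by auto
  ultimately show ?thesis by simp
qed

section \<open>Weights in which zeros of order 1 and 2 at the cusp are possible\<close>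

lemma E4_cube_neq: "(E4 :: complex fps) ^ 2 * E4 \<noteq> E6 * E6" "E6 * E6 \<noteq> (E4 :: complex fps) ^ 2 * E4"
    "(E4 :: complex fps) * E4 ^ 2 \<noteq> E6 * E6"
  using Disc_nonzero by (auto simp: Disc_def power2_eq_square power3_eq_cube mult_ac)

text \<open>The vanishing bound excludes weights up to 10 and parity the odd ones. In weight 14,
  multiplication by E4 and by E6 leads to multiples of Disc E6 in weight 18 and of Disc E4^2 in
  weight 20.\<close>

lemma weight_of_cusp_form:
  assumes F: "F \<in> mforms k" "fps_nth F 0 = 0" "F \<noteq> 0"
  shows "even k \<and> k \<ge> 12 \<and> k \<noteq> 14"
proof -
  have ev: "even k" using mforms_odd[OF F(1)] F(3) by auto
  have "\<not> 3 * k \<le> 32 * 1" using mforms_vanish[OF F(1), of 1] F(2,3) by auto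
  hence "k \<ge> 11" by simp
  hence "k \<ge> 12" using ev by (cases "k = 11") auto
  moreover have "k \<noteq> 14"
  proof
    assume k: "k = 14"
    have "F = 0"
      using E4_E6_mforms mforms_power[OF E4_E6_mforms(1), of 2] E4_cube_neq F
      by (intro mforms_vanish_by_products[of F k 1 E4 4 E6 6 E6 6 "E4 ^ 2" 8])
         (auto simp: k fps_power_zeroth)
    with F show False by simp
  qed
  ultimately show ?thesis using ev by simp
qed

text \<open>The vanishing bound excludes weights up to 21. The multipliers are E6 and E4^2 in weight
  22, and E4 and E6 in weight 26. The last product has weight 32 and is compared up to q^2, for
  which \<open>3 * 32 \<le> 32 * 3\<close> is just enough.\<close>

lemma weight_of_order_2_form:
  assumes F: "F \<in> mforms k" "fps_nth F 0 = 0" "fps_nth F 1 = 0" "F \<noteq> 0"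
  shows "even k \<and> k \<ge> 24 \<and> k \<noteq> 26"
proof -
  have ev: "even k" using mforms_odd[OF F(1)] F(4) by auto
  have F2: "fps_nth F i = 0" if "i < 2" for i using that F(2,3) by (auto simp: less_2_cases_iff)
  have "\<not> 3 * k \<le> 32 * 2" using mforms_vanish[OF F(1), of 2] F2 F(4) by auto
  hence "k \<ge> 22" by simp
  moreover have "k \<noteq> 22"
  proof
    assume k: "k = 22"
    have "F = 0"
      using E4_E6_mforms mforms_power[OF E4_E6_mforms(1), of 2] E4_cube_neq F F2
      by (intro mforms_vanish_by_products[of F k 2 E6 6 E4 4 "E4 ^ 2" 8 E6 6])
         (auto simp: k fps_power_zeroth)
    with F show False by simp
  qed
  moreover have "k \<noteq> 26"
  proof
    assume k: "k = 26"
    have "F = 0"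
      using E4_E6_mforms mforms_power[OF E4_E6_mforms(1), of 2] E4_cube_neq F F2
      by (intro mforms_vanish_by_products[of F k 2 E4 4 E6 6 E6 6 "E4 ^ 2" 8])
         (auto simp: k fps_power_zeroth)
    with F show False by simp
  qed
  moreover have "k \<noteq> 23" using ev by auto
  ultimately show ?thesis using ev by linarith
qed

text \<open>The bound on \<open>b\<close> matters modulo 5: there E4 is 1, and a small exponent of
  E6 leaves only two products to examine.\<close>

lemma exists_weights:
  assumes "even k" "k \<ge> 4"
  obtains a b where "b \<le> (1 :: nat)" "k = 4 * a + 6 * b"
proof -
  from assms(1) obtain l where l: "k = 2 * l" by (elim evenE)
  show thesis
  proof (cases "even l")
    case True
    then obtain a where "l = 2 * a" by (elim evenE)
    thus ?thesis by (intro that[of 0 a]) (simp_all add: l)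
  next
    case False
    then obtain a where a: "l = 2 * a + 1" by (elim oddE)
    with assms(2) l have "a \<ge> 1" by simp
    thus ?thesis using a by (intro that[of 1 "a - 1"]) (simp_all add: l)
  qed
qed

text \<open>The counterpart for the modulus 7, where E6 is 1 and the exponent of E4 should be small.
  It is determined modulo 3 by k/2 = 2a + 3b; the choice a = 2 needs k \<ge> 8, which the residue
  class of k/2 guarantees.\<close>

lemma exists_weights':
  assumes "even k" "k \<ge> 4"
  obtains a b where "a \<le> (2 :: nat)" "k = 4 * a + 6 * b"
proof -
  from assms(1) obtain l where l: "k = 2 * l" by (elim evenE)
  consider "l mod 3 = 0" | "l mod 3 = 1" | "l mod 3 = 2" by linarith
  thus thesis
  proof cases
    case 1
    thus ?thesis by (intro that[of 0 "l div 3"]) (simp add: l; presburger)+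
  next
    case 2
    have "l \<ge> 4" using assms(2) l 2 by presburger
    thus ?thesis using 2 by (intro that[of 2 "l div 3 - 1"]) (simp add: l; presburger)+
  next
    case 3
    thus ?thesis by (intro that[of 1 "l div 3"]) (simp add: l; presburger)+
  qed
qed

section \<open>Integral forms and congruences modulo 5 and 7\<close>

definition of_int_fps :: "int fps \<Rightarrow> 'a::comm_ring_1 fps" where
  "of_int_fps F = Abs_fps (\<lambda>n. of_int (fps_nth F n))"

lemma of_int_fps_nth [simp]: "fps_nth (of_int_fps F) n = of_int (fps_nth F n)"
  by (simp add: of_int_fps_def)

lemma of_int_fps_add [simp]: "of_int_fps (F + G) = of_int_fps F + of_int_fps G"
  and of_int_fps_diff [simp]: "of_int_fps (F - G) = of_int_fps F - of_int_fps G"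
  and of_int_fps_1 [simp]: "of_int_fps 1 = 1"
  and of_int_fps_numeral [simp]: "of_int_fps (numeral n) = numeral n"
  and of_int_fps_sigma [simp]: "of_int_fps (sigma_fps j) = sigma_fps j"
  and of_int_fps_qderiv [simp]: "of_int_fps (qderiv F) = qderiv (of_int_fps F)"
  by (rule fps_ext; simp add: numeral_fps_const)+

lemma of_int_fps_mult [simp]: "of_int_fps (F * G) = of_int_fps F * of_int_fps G"
  by (rule fps_ext) (simp add: fps_mult_nth)

lemma of_int_fps_power [simp]: "of_int_fps (F ^ n) = of_int_fps F ^ n"
  by (induction n) simp_all

lemma of_int_fps_E4 [simp]: "of_int_fps E4 = E4"
  and of_int_fps_E6 [simp]: "of_int_fps E6 = E6"
  by (simp_all add: E4_def E6_def)

lemma of_int_fps_Disc [simp]: "of_int_fps Disc = Disc"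
  by (simp add: Disc_def)

lemma of_int_fps_inject: "of_int_fps F = (of_int_fps G :: complex fps) \<Longrightarrow> F = G"
  by (simp add: fps_eq_iff)

lemma qderiv_add: "qderiv (F + G) = qderiv F + qderiv G"
  and qderiv_diff: "qderiv (F - G) = qderiv F - qderiv G"
  and qderiv_1: "qderiv 1 = 0"
  by (simp_all add: qderiv_def algebra_simps)

lemma qderiv_numeral: "qderiv (numeral n) = 0"
  by (simp add: qderiv_def numeral_fps_const)

lemma qderiv_mult: "qderiv (F * G) = F * qderiv G + qderiv F * G"
  by (simp add: qderiv_def algebra_simps)

lemma qderiv_power_numeral:
  "qderiv (F ^ numeral n) = numeral n * F ^ pred_numeral n * qderiv F"
proof -
  have "qderiv (F ^ Suc m) = of_nat (Suc m) * F ^ m * qderiv F" for m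
    by (induction m) (simp_all add: qderiv_mult algebra_simps)
  from this[of "pred_numeral n"] show ?thesis
    by (simp only: numeral_eq_Suc [symmetric] of_nat_numeral)
qed

text \<open>The identity was proved by complex analysis; injectivity of the coefficient map carries
  it back to the integers, where it can be reduced.\<close>

lemma bracket_E4_E6_int: "3 * E6 * qderiv E4 - 2 * E4 * qderiv E6 = (Disc :: int fps)"
  by (rule of_int_fps_inject) (simp add: bracket_E4_E6)

lemma E4_square_int: "(E4 :: int fps) ^ 2 = 1 + 480 * sigma_fps 7"
  by (rule of_int_fps_inject) (simp add: E4_square)

section \<open>Congruences between integral power series\<close>

definition fps_cong :: "int \<Rightarrow> int fps \<Rightarrow> int fps \<Rightarrow> bool" where
  "fps_cong m F G \<longleftrightarrow> fps_const m dvd F - G"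

lemma fps_cong_refl [simp]: "fps_cong m F F"
  by (simp add: fps_cong_def)

lemma fps_cong_sym: "fps_cong m F G \<Longrightarrow> fps_cong m G F"
  unfolding fps_cong_def by (subst dvd_minus_iff [symmetric]) simp

lemma fps_cong_trans [trans]: "fps_cong m F G \<Longrightarrow> fps_cong m G H \<Longrightarrow> fps_cong m F H"
  unfolding fps_cong_def by (drule (1) dvd_add) simp

lemma fps_cong_add: "fps_cong m F G \<Longrightarrow> fps_cong m F' G' \<Longrightarrow> fps_cong m (F + F') (G + G')"
  unfolding fps_cong_def by (drule (1) dvd_add) (simp add: algebra_simps)

lemma fps_cong_diff: "fps_cong m F G \<Longrightarrow> fps_cong m F' G' \<Longrightarrow> fps_cong m (F - F') (G - G')"
  unfolding fps_cong_def by (drule (1) dvd_diff) (simp add: algebra_simps)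

lemma fps_cong_mult:
  assumes "fps_cong m F G" "fps_cong m F' G'" shows "fps_cong m (F * F') (G * G')"
proof -
  have "F * F' - G * G' = (F - G) * F' + G * (F' - G')" by (simp add: algebra_simps)
  thus ?thesis using assms unfolding fps_cong_def by (metis dvd_add dvd_mult dvd_mult2)
qed

lemma fps_cong_power: "fps_cong m F G \<Longrightarrow> fps_cong m (F ^ n) (G ^ n)"
  by (induction n) (auto intro: fps_cong_mult)

lemma fps_cong_qderiv:
  assumes "fps_cong m F G" shows "fps_cong m (qderiv F) (qderiv G)"
proof -
  from assms obtain H where H: "F - G = fps_const m * H" unfolding fps_cong_def by (elim dvdE)
  have "qderiv F - qderiv G = qderiv (F - G)" by (simp add: qderiv_diff)
  also have "\<dots> = fps_const m * qderiv H" unfolding H by (simp add: qderiv_def mult_ac)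
  finally show ?thesis by (simp add: fps_cong_def)
qed

lemma fps_congI: "F = G + fps_const m * H \<Longrightarrow> fps_cong m F G"
  by (simp add: fps_cong_def)

lemma fps_cong_nth:
  assumes "fps_cong m F G" shows "[fps_nth F n = fps_nth G n] (mod m)"
proof -
  from assms obtain H where H: "F - G = fps_const m * H" unfolding fps_cong_def by (elim dvdE)
  have "fps_nth F n - fps_nth G n = m * fps_nth H n" using arg_cong[OF H, of "\<lambda>F. fps_nth F n"] by simp
  thus ?thesis by (simp add: cong_iff_dvd_diff)
qed

lemmas fps_cong_intros = fps_cong_add fps_cong_diff fps_cong_mult fps_cong_power fps_cong_refl

lemma E4_mod_5: "fps_cong 5 E4 1"
  by (rule fps_congI[of _ _ _ "48 * sigma_fps 3"]) (simp add: E4_def numeral_fps_const)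

lemma Disc_mod_5: "fps_cong 5 Disc (1 - E6 ^ 2)"
  using fps_cong_diff[OF fps_cong_power[OF E4_mod_5, of 3], of "E6 ^ 2" "E6 ^ 2"] by (simp add: Disc_def)

lemma E6_mod_7: "fps_cong 7 E6 1"
  by (rule fps_congI[of _ _ _ "- 72 * sigma_fps 5"])
     (simp add: E6_def numeral_fps_const fps_const_neg [symmetric] del: fps_const_neg)

lemma Disc_mod_7: "fps_cong 7 Disc (E4 ^ 3 - 1)"
  using fps_cong_diff[OF _ fps_cong_power[OF E6_mod_7, of 2], of "E4 ^ 3" "E4 ^ 3"] by (simp add: Disc_def)

text \<open>\<open>d\<close> is an inverse of \<open>c\<close> modulo \<open>m\<close>, with
  \<open>e\<close> as the witness.\<close>

lemma fps_cong_cancel: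
  assumes "fps_cong m (fps_const c * F) G" "d * c = 1 + m * e"
  shows "fps_cong m F (fps_const d * G)"
proof -
  have "fps_cong m (fps_const d * (fps_const c * F)) (fps_const d * G)"
    by (intro fps_cong_mult fps_cong_refl assms)
  moreover have "fps_cong m (fps_const d * (fps_const c * F)) F"
  proof (rule fps_congI[of _ _ _ "fps_const e * F"])
    have "fps_const d * (fps_const c * F) = fps_const (d * c) * F"
      by (simp add: mult.assoc [symmetric])
    also have "\<dots> = F + fps_const m * (fps_const e * F)"
      unfolding assms(2) by (simp add: algebra_simps flip: fps_const_add fps_const_mult)
    finally show "fps_const d * (fps_const c * F) = F + fps_const m * (fps_const e * F)" .
  qed
  ultimately show ?thesis using fps_cong_sym fps_cong_trans by blast
qed

text \<open>
  As \<open>E\<^sub>4 \<equiv> 1\<close> modulo 5 and \<open>E\<^sub>6 \<equiv> 1\<close> modulo 7, the bracket relation expresses the derivative of the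
  other series as a polynomial in that series. So \<open>\<Delta>\<^sup>2 E\<^sub>4\<^sup>a E\<^sub>6\<^sup>b\<close> becomes a combination of derivatives of
  Eisenstein series, whose coefficients are known.
\<close>

lemma qderiv_E6_mod_5: "fps_cong 5 (qderiv E6) (3 * E6 ^ 2 - 3)"
proof -
  have "2 * (E4 * qderiv E6) = 3 * E6 * qderiv E4 - (Disc :: int fps)"
    using bracket_E4_E6_int by (simp add: algebra_simps)
  also have "fps_cong 5 \<dots> (3 * E6 * qderiv 1 - (1 - E6 ^ 2))"
    by (intro fps_cong_intros fps_cong_qderiv E4_mod_5 Disc_mod_5)
  finally have "fps_cong 5 (2 * (E4 * qderiv E6)) (E6 ^ 2 - 1)" by (simp add: qderiv_1)
  \<comment> \<open>3 is the inverse of 2 modulo 5.\<close>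
  hence 1: "fps_cong 5 (E4 * qderiv E6) (3 * (E6 ^ 2 - 1))"
    using fps_cong_cancel[of 5 2 "E4 * qderiv E6" "E6 ^ 2 - 1" 3 1] by (simp add: numeral_fps_const)
  have 2: "fps_cong 5 (E4 * qderiv E6) (1 * qderiv E6)"
    by (intro fps_cong_intros E4_mod_5)
  from fps_cong_trans[OF fps_cong_sym[OF 2] 1] show ?thesis by (simp add: right_diff_distrib)
qed

lemma qderiv_E4_mod_7: "fps_cong 7 (qderiv E4) (5 * E4 ^ 3 - 5)"
proof -
  have "3 * (E6 * qderiv E4) = 2 * E4 * qderiv E6 + (Disc :: int fps)"
    using bracket_E4_E6_int by (simp add: algebra_simps)
  also have "fps_cong 7 \<dots> (2 * E4 * qderiv 1 + (E4 ^ 3 - 1))"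
    by (intro fps_cong_intros fps_cong_qderiv E6_mod_7 Disc_mod_7)
  finally have "fps_cong 7 (3 * (E6 * qderiv E4)) (E4 ^ 3 - 1)" by (simp add: qderiv_1)
  \<comment> \<open>5 is the inverse of 3 modulo 7.\<close>
  hence 1: "fps_cong 7 (E6 * qderiv E4) (5 * (E4 ^ 3 - 1))"
    using fps_cong_cancel[of 7 3 "E6 * qderiv E4" "E4 ^ 3 - 1" 5 2] by (simp add: numeral_fps_const)
  have 2: "fps_cong 7 (E6 * qderiv E4) (1 * qderiv E4)"
    by (intro fps_cong_intros E6_mod_7)
  from fps_cong_trans[OF fps_cong_sym[OF 2] 1] show ?thesis by (simp add: right_diff_distrib)
qed

text \<open>Modulo 5, theta P = 3 P^2 - 3 for P = E6, so theta changes the parity of the degree in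
  P. The even polynomial (1 - P^2)^2 is therefore matched by odd derivatives of P, and its product
  with P by even ones; comparing polynomials determines the coefficients.\<close>

lemma Disc_square_mod_5:
  fixes a :: nat
  shows "fps_cong 5 (Disc ^ 2 * E4 ^ a) (3 * (qderiv ^^ 3) E6 + 2 * qderiv E6)"
    and "fps_cong 5 (Disc ^ 2 * E4 ^ a * E6) (4 * (qderiv ^^ 4) E6 - 4 * (qderiv ^^ 2) E6)"
proof -
  define P :: "int fps" where "P = E6"
  define x where "x = 3 * P ^ 2 - 3"
  have d1: "fps_cong 5 (qderiv P) x" using qderiv_E6_mod_5 by (simp add: P_def x_def)
  have step: "fps_cong 5 (qderiv F) G'" if "fps_cong 5 F G" "fps_cong 5 (qderiv G) G'" for F G G'
    using fps_cong_trans[OF fps_cong_qderiv[OF that(1)] that(2)] .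
  have "qderiv x = 6 * P * qderiv P"
    by (simp add: x_def qderiv_diff qderiv_mult power2_eq_square qderiv_numeral algebra_simps)
  also have "fps_cong 5 \<dots> (6 * P * x)" by (intro fps_cong_intros d1)
  finally have d2: "fps_cong 5 (qderiv (qderiv P)) (6 * P * x)" by (rule step[OF d1])
  have dx: "fps_cong 5 (qderiv x) (6 * P * x)"
    unfolding \<open>qderiv x = 6 * P * qderiv P\<close> by (intro fps_cong_intros d1)
  have "qderiv (6 * P * x) = 6 * P * qderiv x + 6 * qderiv P * x"
    by (simp add: qderiv_mult qderiv_numeral algebra_simps)
  also have "fps_cong 5 \<dots> (6 * P * (6 * P * x) + 6 * x * x)" by (intro fps_cong_intros d1 dx)
  finally have d3: "fps_cong 5 (qderiv (qderiv (qderiv P))) (6 * P * (6 * P * x) + 6 * x * x)" by (rule step[OF d2])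
  have "qderiv (6 * P * (6 * P * x) + 6 * x * x) =
      72 * P * x * qderiv P + 36 * P * P * qderiv x + 12 * x * qderiv x"
    by (simp add: qderiv_mult qderiv_add qderiv_numeral algebra_simps)
  also have "fps_cong 5 \<dots> (72 * P * x * x + 36 * P * P * (6 * P * x) + 12 * x * (6 * P * x))"
    by (intro fps_cong_intros d1 dx)
  finally have d4: "fps_cong 5 (qderiv (qderiv (qderiv (qderiv P))))
      (72 * P * x * x + 36 * P * P * (6 * P * x) + 12 * x * (6 * P * x))" by (rule step[OF d3])
  have D: "fps_cong 5 (Disc ^ 2 * E4 ^ a) ((1 - P ^ 2) ^ 2 * 1 ^ a)"
    unfolding P_def by (intro fps_cong_intros Disc_mod_5 E4_mod_5)
  have "fps_cong 5 (Disc ^ 2 * E4 ^ a) ((1 - P ^ 2) ^ 2)" using D by simp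
  \<comment> \<open>The witness is a fifth of the difference of two polynomials in P: P^4 - 2 P^2 +
    1 on the left, 486 P^4 - 642 P^2 + 156 on the right.\<close>
  also have "fps_cong 5 \<dots> (3 * (6 * P * (6 * P * x) + 6 * x * x) + 2 * x)"
    by (rule fps_congI[of _ _ _ "- 97 * P ^ 4 + 128 * P ^ 2 - 31"])
       (simp add: x_def power2_eq_square power4_eq_xxxx numeral_fps_const [symmetric] algebra_simps)
  also have "fps_cong 5 \<dots> (3 * qderiv (qderiv (qderiv P)) + 2 * qderiv P)"
    by (intro fps_cong_intros fps_cong_sym[OF d3] fps_cong_sym[OF d1])
  finally show "fps_cong 5 (Disc ^ 2 * E4 ^ a) (3 * (qderiv ^^ 3) E6 + 2 * qderiv E6)"
    by (simp add: P_def numeral_3_eq_3)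
  have P5: "P ^ 5 = P * P * P * P * P" by (simp add: eval_nat_numeral mult_ac)
  have "fps_cong 5 (Disc ^ 2 * E4 ^ a * P) ((1 - P ^ 2) ^ 2 * 1 ^ a * P)"
    by (intro fps_cong_mult[OF D] fps_cong_refl)
  also have "fps_cong 5 \<dots> (4 * (72 * P * x * x + 36 * P * P * (6 * P * x) + 12 * x * (6 * P * x)) - 4 * (6 * P * x))"
    by (rule fps_congI[of _ _ _ "- 1555 * P ^ 5 + 2606 * P ^ 3 - 1051 * P"])
       (simp add: x_def power2_eq_square power3_eq_cube P5 numeral_fps_const [symmetric] algebra_simps)
  also have "fps_cong 5 \<dots> (4 * qderiv (qderiv (qderiv (qderiv P))) - 4 * qderiv (qderiv P))"
    by (intro fps_cong_intros fps_cong_sym[OF d4] fps_cong_sym[OF d2])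
  finally show "fps_cong 5 (Disc ^ 2 * E4 ^ a * E6) (4 * (qderiv ^^ 4) E6 - 4 * (qderiv ^^ 2) E6)"
    by (simp add: P_def eval_nat_numeral)
qed

text \<open>Modulo 7, theta Q = 5 Q^3 - 5 for Q = E4, so theta raises the degree in Q by 2 modulo 3.
  Each product is matched by one derivative of Q and one of Q^2 in the same degree class; the square
  is admissible because E4^2 is the Eisenstein series of weight 8.\<close>

lemma Disc_square_mod_7:
  fixes b :: nat
  shows "fps_cong 7 (Disc ^ 2 * E6 ^ b) (2 * (qderiv ^^ 2) (E4 ^ 2) + 3 * qderiv E4)"
    and "fps_cong 7 (Disc ^ 2 * E6 ^ b * E4) (- (qderiv ^^ 3) E4 - 3 * qderiv (E4 ^ 2))"
    and "fps_cong 7 (Disc ^ 2 * E6 ^ b * E4 ^ 2) ((qderiv ^^ 3) (E4 ^ 2) + 5 * (qderiv ^^ 2) E4)"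
proof -
  define Q :: "int fps" where "Q = E4"
  define x where "x = 5 * Q ^ 3 - 5"
  have d1: "fps_cong 7 (qderiv Q) x" using qderiv_E4_mod_7 by (simp add: Q_def x_def)
  \<comment> \<open>The chain rule: \<open>G\<close> is a polynomial in Q and \<open>H\<close> its
    derivative with respect to Q.\<close>
  have step: "fps_cong 7 (qderiv F) (H * x)" if "fps_cong 7 F G" "qderiv G = H * qderiv Q" for F G H
    using fps_cong_qderiv[OF that(1)] fps_cong_mult[OF fps_cong_refl d1, of H]
    unfolding that(2) by (rule fps_cong_trans)
  have d2: "fps_cong 7 (qderiv (qderiv Q)) (15 * Q ^ 2 * x)"
    by (rule step[OF d1]) (simp add: x_def qderiv_diff qderiv_mult qderiv_numeral qderiv_power_numeral)
  also have "15 * Q ^ 2 * x = 75 * Q ^ 5 - 75 * Q ^ 2"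
    by (simp add: x_def algebra_simps flip: power_add)
  finally have d2': "fps_cong 7 (qderiv (qderiv Q)) (75 * Q ^ 5 - 75 * Q ^ 2)" .
  have d3: "fps_cong 7 (qderiv (qderiv (qderiv Q))) ((375 * Q ^ 4 - 150 * Q) * x)"
    by (rule step[OF d2']) (simp add: qderiv_diff qderiv_mult qderiv_numeral qderiv_power_numeral algebra_simps)
  have s1: "fps_cong 7 (qderiv (Q ^ 2)) (2 * Q * x)"
    by (rule step[OF fps_cong_refl]) (simp add: qderiv_power_numeral)
  also have "2 * Q * x = 10 * Q ^ 4 - 10 * Q"
    by (simp add: x_def algebra_simps power4_eq_xxxx power3_eq_cube)
  finally have s1': "fps_cong 7 (qderiv (Q ^ 2)) (10 * Q ^ 4 - 10 * Q)" .
  have s2: "fps_cong 7 (qderiv (qderiv (Q ^ 2))) ((40 * Q ^ 3 - 10) * x)"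
    by (rule step[OF s1']) (simp add: qderiv_diff qderiv_mult qderiv_numeral qderiv_power_numeral algebra_simps)
  also have "(40 * Q ^ 3 - 10) * x = 200 * Q ^ 6 - 250 * Q ^ 3 + 50"
    by (simp add: x_def algebra_simps flip: power_add)
  finally have s2': "fps_cong 7 (qderiv (qderiv (Q ^ 2))) (200 * Q ^ 6 - 250 * Q ^ 3 + 50)" .
  have s3: "fps_cong 7 (qderiv (qderiv (qderiv (Q ^ 2)))) ((1200 * Q ^ 5 - 750 * Q ^ 2) * x)"
    by (rule step[OF s2']) (simp add: qderiv_diff qderiv_add qderiv_mult qderiv_numeral qderiv_power_numeral algebra_simps)
  have "fps_cong 7 (Disc ^ 2 * E6 ^ b) ((Q ^ 3 - 1) ^ 2 * 1 ^ b)"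
    unfolding Q_def by (intro fps_cong_intros Disc_mod_7 E6_mod_7)
  hence D: "fps_cong 7 (Disc ^ 2 * E6 ^ b) ((Q ^ 3 - 1) ^ 2)" by simp
  note D
  also have "fps_cong 7 ((Q ^ 3 - 1) ^ 2) (2 * ((40 * Q ^ 3 - 10) * x) + 3 * x)"
    by (rule fps_congI[of _ _ _ "- 57 * Q ^ 6 + 69 * Q ^ 3 - 12"])
       (simp add: x_def power2_eq_square numeral_fps_const [symmetric] algebra_simps flip: power_add)
  also have "fps_cong 7 \<dots> (2 * qderiv (qderiv (Q ^ 2)) + 3 * qderiv Q)"
    by (intro fps_cong_intros fps_cong_sym[OF s2] fps_cong_sym[OF d1])
  finally show "fps_cong 7 (Disc ^ 2 * E6 ^ b) (2 * (qderiv ^^ 2) (E4 ^ 2) + 3 * qderiv E4)"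
    by (simp add: Q_def numeral_2_eq_2)
  have "fps_cong 7 (Disc ^ 2 * E6 ^ b * Q) ((Q ^ 3 - 1) ^ 2 * Q)"
    by (intro fps_cong_mult[OF D] fps_cong_refl)
  also have "fps_cong 7 \<dots> (0 - (375 * Q ^ 4 - 150 * Q) * x - 3 * (2 * Q * x))"
    by (rule fps_congI[of _ _ _ "268 * Q ^ 7 - 371 * Q ^ 4 + 103 * Q"])
       (simp add: x_def power2_eq_square numeral_fps_const [symmetric] algebra_simps flip: power_add power_Suc power_Suc2)
  also have "fps_cong 7 \<dots> (0 - qderiv (qderiv (qderiv Q)) - 3 * qderiv (Q ^ 2))"
    by (intro fps_cong_intros fps_cong_sym[OF d3] fps_cong_sym[OF s1])
  finally show "fps_cong 7 (Disc ^ 2 * E6 ^ b * E4) (- (qderiv ^^ 3) E4 - 3 * qderiv (E4 ^ 2))"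
    by (simp add: Q_def numeral_3_eq_3)
  have "fps_cong 7 (Disc ^ 2 * E6 ^ b * Q ^ 2) ((Q ^ 3 - 1) ^ 2 * Q ^ 2)"
    by (intro fps_cong_mult[OF D] fps_cong_refl)
  also have "fps_cong 7 \<dots> ((1200 * Q ^ 5 - 750 * Q ^ 2) * x + 5 * (15 * Q ^ 2 * x))"
    by (rule fps_congI[of _ _ _ "- 857 * Q ^ 8 + 1339 * Q ^ 5 - 482 * Q ^ 2"])
       (simp add: x_def power2_eq_square[of "Q ^ 3 - 1"] numeral_fps_const [symmetric] algebra_simps flip: power_add)
  also have "fps_cong 7 \<dots> (qderiv (qderiv (qderiv (Q ^ 2))) + 5 * qderiv (qderiv Q))"
    by (intro fps_cong_intros fps_cong_sym[OF s3] fps_cong_sym[OF d2])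
  finally show "fps_cong 7 (Disc ^ 2 * E6 ^ b * E4 ^ 2) ((qderiv ^^ 3) (E4 ^ 2) + 5 * (qderiv ^^ 2) E4)"
    by (simp add: Q_def numeral_3_eq_3 numeral_2_eq_2)
qed

section \<open>Coefficients at primes\<close>

lemma E4_nth_prime: "prime p \<Longrightarrow> fps_nth (E4 :: int fps) p = 240 * (1 + int p ^ 3)"
  and E6_nth_prime: "prime p \<Longrightarrow> fps_nth (E6 :: int fps) p = - 504 * (1 + int p ^ 5)"
  and E4_square_nth_prime: "prime p \<Longrightarrow> fps_nth ((E4 :: int fps) ^ 2) p = 480 * (1 + int p ^ 7)"
  unfolding E4_square_int
  by (auto simp: E4_def E6_def divisor_sum_prime dest: prime_gt_0_nat)

text \<open>By p^5 = p modulo 5, the two coefficients are p (p^2 - 1)(p + 1) and p^2 (p^2 - 1)(p +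
  1) up to units, and 2 and 3 are not zeros of these.\<close>

lemma Disc_square_nth_mod_5:
  assumes p: "prime p" "int p mod 5 = 2 \<or> int p mod 5 = 3"
  shows "fps_nth (Disc ^ 2 * E4 ^ a :: int fps) p \<noteq> 0" "fps_nth (Disc ^ 2 * E4 ^ a * E6 :: int fps) p \<noteq> 0"
proof -
  from p(2) obtain r where r: "r = 2 \<or> r = 3" "[int p = r] (mod 5)" by (auto simp: cong_def)
  have "[fps_nth (Disc ^ 2 * E4 ^ a) p = 3 * (int p ^ 3 * (- 504 * (1 + int p ^ 5))) + 2 * (int p * (- 504 * (1 + int p ^ 5)))] (mod 5)"
    using fps_cong_nth[OF Disc_square_mod_5(1), of a p]
    by (simp add: fps_nth_qderiv_funpow E6_nth_prime p(1))
  also have "[3 * (int p ^ 3 * (- 504 * (1 + int p ^ 5))) + 2 * (int p * (- 504 * (1 + int p ^ 5)))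
     = 3 * (r ^ 3 * (- 504 * (1 + r ^ 5))) + 2 * (r * (- 504 * (1 + r ^ 5)))] (mod 5)"
    by (intro cong_add cong_mult cong_pow cong_refl r)
  finally show "fps_nth (Disc ^ 2 * E4 ^ a :: int fps) p \<noteq> 0" using r(1) by (auto simp: cong_def)
  have "[fps_nth (Disc ^ 2 * E4 ^ a * E6) p = 4 * (int p ^ 4 * (- 504 * (1 + int p ^ 5))) - 4 * (int p ^ 2 * (- 504 * (1 + int p ^ 5)))] (mod 5)"
    using fps_cong_nth[OF Disc_square_mod_5(2), of a p]
    by (simp add: fps_nth_qderiv_funpow E6_nth_prime p(1))
  also have "[4 * (int p ^ 4 * (- 504 * (1 + int p ^ 5))) - 4 * (int p ^ 2 * (- 504 * (1 + int p ^ 5)))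
     = 4 * (r ^ 4 * (- 504 * (1 + r ^ 5))) - 4 * (r ^ 2 * (- 504 * (1 + r ^ 5)))] (mod 5)"
    by (intro cong_add cong_diff cong_mult cong_pow cong_refl r)
  finally show "fps_nth (Disc ^ 2 * E4 ^ a * E6 :: int fps) p \<noteq> 0" using r(1) by (auto simp: cong_def)
qed

text \<open>Only the residue of \<open>p\<close> matters, so four values decide. For a = 0, for
  instance, the coefficient is -p (p + 1)(p - 1)^2 modulo 7, by p^7 = p.\<close>

lemma Disc_square_nth_mod_7:
  assumes p: "prime p" "int p mod 7 \<in> {2, 3, 4, 5}" and a: "a \<le> 2"
  shows "fps_nth (Disc ^ 2 * E6 ^ b * E4 ^ a :: int fps) p \<noteq> 0"
proof -
  from p(2) obtain r where r: "r \<in> {2, 3, 4, 5}" "[int p = r] (mod 7)" by (auto simp: cong_def)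
  note nth = fps_nth_qderiv_funpow E4_nth_prime E4_square_nth_prime p(1)
  consider "a = 0" | "a = 1" | "a = 2" using a by linarith
  thus ?thesis
  proof cases
    case 1
    have "[fps_nth (Disc ^ 2 * E6 ^ b) p = 2 * (int p ^ 2 * (480 * (1 + int p ^ 7))) + 3 * (int p * (240 * (1 + int p ^ 3)))] (mod 7)"
      using fps_cong_nth[OF Disc_square_mod_7(1), of b p] by (simp add: nth)
    also have "[2 * (int p ^ 2 * (480 * (1 + int p ^ 7))) + 3 * (int p * (240 * (1 + int p ^ 3)))
      = 2 * (r ^ 2 * (480 * (1 + r ^ 7))) + 3 * (r * (240 * (1 + r ^ 3)))] (mod 7)"
      by (intro cong_add cong_diff cong_mult cong_pow cong_refl r)
    finally show ?thesis using r(1) 1 by (auto simp: cong_def)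
  next
    case 2
    have "[fps_nth (Disc ^ 2 * E6 ^ b * E4) p = 0 - int p ^ 3 * (240 * (1 + int p ^ 3)) - 3 * (int p * (480 * (1 + int p ^ 7)))] (mod 7)"
      using fps_cong_nth[OF Disc_square_mod_7(2), of b p] by (simp add: nth)
    also have "[0 - int p ^ 3 * (240 * (1 + int p ^ 3)) - 3 * (int p * (480 * (1 + int p ^ 7)))
      = 0 - r ^ 3 * (240 * (1 + r ^ 3)) - 3 * (r * (480 * (1 + r ^ 7)))] (mod 7)"
      by (intro cong_add cong_diff cong_mult cong_pow cong_refl r)
    finally show ?thesis using r(1) 2 by (auto simp: cong_def)
  next
    case 3
    have "[fps_nth (Disc ^ 2 * E6 ^ b * E4 ^ 2) p = int p ^ 3 * (480 * (1 + int p ^ 7)) + 5 * (int p ^ 2 * (240 * (1 + int p ^ 3)))] (mod 7)"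
      using fps_cong_nth[OF Disc_square_mod_7(3), of b p] by (simp add: nth)
    also have "[int p ^ 3 * (480 * (1 + int p ^ 7)) + 5 * (int p ^ 2 * (240 * (1 + int p ^ 3)))
      = r ^ 3 * (480 * (1 + r ^ 7)) + 5 * (r ^ 2 * (240 * (1 + r ^ 3)))] (mod 7)"
      by (intro cong_add cong_diff cong_mult cong_pow cong_refl r)
    finally show ?thesis using r(1) 3 by (auto simp: cong_def)
  qed
qed

lemma prime_residue_not_1:
  fixes p q :: nat
  assumes "prime p" "prime q" "p \<noteq> q"
  shows "int p mod int q \<noteq> 0"
  using assms by (metis of_nat_0 of_nat_eq_iff of_nat_mod mod_0_imp_dvd primes_dvd_imp_eq)

lemma mforms_Disc_monomial:
  "(Disc ^ m * E4 ^ a * E6 ^ b :: complex fps) \<in> mforms (12 * m + 4 * a + 6 * b)"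
  using mforms_mult[OF mforms_mult[OF mforms_power[OF Disc_mforms, of m] mforms_power[OF E4_E6_mforms(1), of a]]
      mforms_power[OF E4_E6_mforms(2), of b]]
  by (simp add: mult.commute)

text \<open>The form is Disc times a monomial in E4 and E6, with first coefficient 1728. Weight 14
  is left out because 2 is not of the form 4a + 6b.\<close>

lemma exists_integral_cusp_form:
  assumes "even k" "k \<ge> 12" "k \<noteq> 14"
  obtains G :: "int fps" where "of_int_fps G \<in> mforms k" "fps_nth G 0 = 0" "G \<noteq> 0"
proof -
  have "k \<noteq> 13" "k \<noteq> 15" using assms(1) by auto
  hence "k = 12 \<or> k \<ge> 16" using assms by linarith
  hence "\<exists>a b. k = 12 + 4 * a + 6 * b"
  proof
    assume k: "k \<ge> 16"
    obtain a b where "b \<le> (1 :: nat)" "k - 12 = 4 * a + 6 * b"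
      by (rule exists_weights[of "k - 12"]) (use assms k in auto)
    with k have "k = 12 + 4 * a + 6 * b" by linarith
    thus ?thesis by blast
  qed (auto intro: exI[of _ 0])
  then obtain a b where k: "k = 12 + 4 * a + 6 * b" by blast
  define G :: "int fps" where "G = Disc * E4 ^ a * E6 ^ b"
  have "of_int_fps G \<in> mforms k"
    using mforms_Disc_monomial[of 1 a b] by (simp add: G_def k)
  moreover have "fps_nth G 0 = 0" by (simp add: G_def)
  moreover have "fps_nth G (Suc 0) = 1728"
    by (simp add: G_def fps_mult_nth_low fps_power_zeroth)
  hence "G \<noteq> 0" by auto
  ultimately show thesis by (rule that)
qed

text \<open>The form is Disc^2 times a monomial in E4 and E6. The exponent of E6 is kept small if
  \<open>p\<close> is suitable modulo 5, the exponent of E4 if it is suitable modulo 7.\<close>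

lemma exists_integral_order_2_form:
  assumes k: "even k" "k \<ge> 24" "k \<noteq> 26" and p: "prime p"
    and res: "\<not> ([int p = 1] (mod 5) \<or> [int p = -1] (mod 5)) \<or>
     \<not> ([int p = 1] (mod 7) \<or> [int p = -1] (mod 7))"
  obtains G :: "int fps" where "of_int_fps G \<in> mforms k" "fps_nth G 0 = 0" "fps_nth G 1 = 0" "fps_nth G p \<noteq> 0"
proof -
  have order: "fps_nth (Disc ^ 2 * H) 0 = 0" "fps_nth (Disc ^ 2 * H) 1 = 0" for H :: "int fps"
    by (rule fps_mult_nth_order(1)[of 2]; simp add: Disc_power_nth)+
  \<comment> \<open>The primes 5 and 7 are suitable for the other modulus: 5 mod 7 = 5 and 7 mod 5 =
    2. All other primes have nonzero residues, and the hypothesis rules out 1 and -1 for one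
    modulus.\<close>
  have "int p mod 5 = 2 \<or> int p mod 5 = 3 \<or> int p mod 7 \<in> {2, 3, 4, 5}"
  proof (cases "p = 5 \<or> p = 7")
    case False
    have "prime (5 :: nat)" "prime (7 :: nat)" by simp_all
    with False have "int p mod 5 \<noteq> 0" "int p mod 7 \<noteq> 0"
      using prime_residue_not_1[OF p, of 5] prime_residue_not_1[OF p, of 7] by simp_all
    moreover from res have "(int p mod 5 \<noteq> 1 \<and> int p mod 5 \<noteq> 4) \<or> (int p mod 7 \<noteq> 1 \<and> int p mod 7 \<noteq> 6)"
      by (simp add: cong_def)
    moreover have "x mod 5 \<in> {0, 1, 2, 3, 4}" and "x mod 7 \<in> {0, 1, 2, 3, 4, 5, 6}" for x :: int
      by (simp, presburger)+
    hence "int p mod 5 \<in> {0, 1, 2, 3, 4}" "int p mod 7 \<in> {0, 1, 2, 3, 4, 5, 6}" by blast+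
    ultimately show ?thesis by (elim insertE emptyE) simp_all
  qed auto
  hence *: "(int p mod 5 = 2 \<or> int p mod 5 = 3) \<or> int p mod 7 \<in> {2, 3, 4, 5}" by blast
  have "k \<noteq> 25" "k \<noteq> 27" using k(1) by auto
  hence k': "k = 24 \<or> k \<ge> 28" using k by linarith
  from * show thesis
  proof
    assume r: "int p mod 5 = 2 \<or> int p mod 5 = 3"
    have "\<exists>a b. b \<le> 1 \<and> k = 24 + 4 * a + 6 * b"
      using k'
    proof
      assume k28: "k \<ge> 28"
      obtain a b where "b \<le> (1 :: nat)" "k - 24 = 4 * a + 6 * b"
        by (rule exists_weights[of "k - 24"]) (use k k28 in auto)
      with k28 have "b \<le> 1 \<and> k = 24 + 4 * a + 6 * b" by linarith
      thus ?thesis by blast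
    qed (auto intro: exI[of _ 0])
    then obtain a b where ab: "b \<le> 1" "k = 24 + 4 * a + 6 * b" by blast
    show thesis
    proof (rule that[of "Disc ^ 2 * E4 ^ a * E6 ^ b"])
      show "of_int_fps (Disc ^ 2 * E4 ^ a * E6 ^ b) \<in> mforms k"
        using mforms_Disc_monomial[of 2 a b] by (simp add: ab)
      show "fps_nth (Disc ^ 2 * E4 ^ a * E6 ^ b :: int fps) p \<noteq> 0"
        using Disc_square_nth_mod_5[OF p r, of a] ab(1) by (cases b) auto
    qed (simp_all only: order mult.assoc)
  next
    assume r: "int p mod 7 \<in> {2, 3, 4, 5}"
    have "\<exists>a b. a \<le> 2 \<and> k = 24 + 4 * a + 6 * b"
      using k'
    proof
      assume k28: "k \<ge> 28"
      obtain a b where "a \<le> (2 :: nat)" "k - 24 = 4 * a + 6 * b"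
        by (rule exists_weights'[of "k - 24"]) (use k k28 in auto)
      with k28 have "a \<le> 2 \<and> k = 24 + 4 * a + 6 * b" by linarith
      thus ?thesis by blast
    qed (auto intro: exI[of _ 0])
    then obtain a b where ab: "a \<le> 2" "k = 24 + 4 * a + 6 * b" by blast
    show thesis
    proof (rule that[of "Disc ^ 2 * E6 ^ b * E4 ^ a"])
      show "of_int_fps (Disc ^ 2 * E6 ^ b * E4 ^ a) \<in> mforms k"
        using mforms_Disc_monomial[of 2 a b] by (simp add: ab mult_ac)
      show "fps_nth (Disc ^ 2 * E6 ^ b * E4 ^ a :: int fps) p \<noteq> 0"
        by (rule Disc_square_nth_mod_7[OF p r ab(1)])
    qed (simp_all only: order mult.assoc)
  qed
qed

section \<open>Hecke operators on power series\<close>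

definition cusp_fps :: "nat \<Rightarrow> complex fps set" where
  "cusp_fps k = {F \<in> mforms k. fps_nth F 0 = 0}"

definition fun_of :: "complex fps \<Rightarrow> complex \<Rightarrow> complex" where
  "fun_of F = (\<lambda>z. if z \<in> upper_half_plane then qeval F z else 0)"

text \<open>The classical action of T_n on coefficients: the sum of a^(k-1) c(mn/a^2) over the
  common divisors a of m and n. The ring is arbitrary so that T_n also acts on rational
  series.\<close>

definition hecke_fps :: "nat \<Rightarrow> nat \<Rightarrow> 'a::comm_ring_1 fps \<Rightarrow> 'a fps" where
  "hecke_fps k n F = Abs_fps (\<lambda>m. \<Sum>a | a dvd n \<and> a dvd m. of_nat a ^ (k - 1) * fps_nth F (n div a * (m div a)))"

lemma hecke_fps_nth:
  "fps_nth (hecke_fps k n F) m = (\<Sum>a | a dvd n \<and> a dvd m. of_nat a ^ (k - 1) * fps_nth F (n div a * (m div a)))"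
  by (simp add: hecke_fps_def)

lemma radius_ge_1I:
  assumes "\<And>z. z \<in> upper_half_plane \<Longrightarrow> summable (\<lambda>m. fps_nth F m * nome z ^ m)"
  shows "fps_conv_radius F \<ge> 1"
  unfolding fps_conv_radius_def
proof (rule conv_radius_geI_ex')
  fix r :: real assume r: "0 < r" "ereal r < 1"
  obtain z where z: "nome z = complex_of_real r" using r(1) nome_surj[of "complex_of_real r"] by auto
  have "norm (nome z) < 1" using r z by simp
  hence "0 < 2 * pi * Im z" unfolding norm_nome by simp
  hence "z \<in> upper_half_plane" by (simp add: upper_half_plane_def zero_less_mult_iff)
  from assms[OF this] show "summable (\<lambda>n. fps_nth F n * complex_of_real r ^ n)" by (simp add: z)
qed

lemma qeval_sums:
  "fps_conv_radius F \<ge> 1 \<Longrightarrow> z \<in> upper_half_plane \<Longrightarrow> (\<lambda>m. fps_nth F m * nome z ^ m) sums qeval F z"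
  unfolding qeval_def by (intro sums_eval_fps nome_in_conv_radius)

lemma nome_power_exp: "nome z ^ m = exp (2 * of_real pi * \<i> * of_nat m * z)"
  by (simp add: nome_power) (simp add: nome_def mult_ac)

lemma fun_of_in_cusp_forms:
  assumes "F \<in> cusp_fps k" shows "fun_of F \<in> cusp_forms k"
proof -
  have F: "F \<in> mforms k" "fps_nth F 0 = 0" using assms by (simp_all add: cusp_fps_def)
  note r = mformsD_radius[OF F(1)]
  have "qeval F holomorphic_on upper_half_plane"
    using has_field_derivative_qeval[OF r] by (auto simp: holomorphic_on_def field_differentiable_def)
  hence "fun_of F holomorphic_on upper_half_plane"
    by (rule holomorphic_transform) (simp add: fun_of_def)
  moreover have "\<exists>q. q 0 = 0 \<and> (\<forall>z\<in>upper_half_plane.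
        (\<lambda>m. q m * exp (2 * of_real pi * \<i> * of_nat m * z)) sums fun_of F z)"
    using qeval_sums[OF r] F(2)
    by (intro exI[of _ "fps_nth F"]) (auto simp: fun_of_def nome_power_exp [symmetric])
  ultimately show ?thesis
    unfolding cusp_forms_def using F
    by (auto simp: fun_of_def moebius_1 mformsD)
qed

lemma cusp_forms_eq: "cusp_forms k = fun_of ` cusp_fps k"
proof (intro equalityI subsetI)
  fix f assume f: "f \<in> cusp_forms k"
  then obtain q where q: "q 0 = 0" "\<And>z. z \<in> upper_half_plane \<Longrightarrow>
      (\<lambda>m. q m * exp (2 * of_real pi * \<i> * of_nat m * z)) sums f z"
    unfolding cusp_forms_def by auto
  define F where "F = Abs_fps q"
  have s: "(\<lambda>m. fps_nth F m * nome z ^ m) sums f z" if "z \<in> upper_half_plane" for z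
    using q(2)[OF that] by (simp add: F_def nome_power_exp)
  have r: "fps_conv_radius F \<ge> 1" by (rule radius_ge_1I) (rule sums_summable[OF s])
  have ev: "qeval F z = f z" if "z \<in> upper_half_plane" for z
    using sums_unique2[OF qeval_sums[OF r that] s[OF that]] .
  have "F \<in> mforms k"
    by (rule mformsI[OF r]) (use f in \<open>simp add: ev moebius_1 cusp_forms_def\<close>)
  moreover have "f = fun_of F"
    using f by (auto simp: fun_of_def ev cusp_forms_def)
  ultimately show "f \<in> fun_of ` cusp_fps k" using q(1) by (auto simp: cusp_fps_def F_def)
qed (auto intro: fun_of_in_cusp_forms)

lemma cusp_fps_radius: "F \<in> cusp_fps k \<Longrightarrow> fps_conv_radius F \<ge> 1"
  by (simp add: cusp_fps_def mforms_def)

lemma fun_of_inj: "fps_conv_radius F \<ge> 1 \<Longrightarrow> fps_conv_radius G \<ge> 1 \<Longrightarrow> fun_of F = fun_of G \<Longrightarrow> F = G"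
proof -
  assume r: "fps_conv_radius F \<ge> 1" "fps_conv_radius G \<ge> 1" and eq: "fun_of F = fun_of G"
  have "F - G = 0"
  proof (rule qeval_eq_0_imp[of _ 1])
    fix z assume "Im z > 1"
    hence z: "z \<in> upper_half_plane" by (simp add: upper_half_plane_def)
    thus "qeval (F - G) z = 0" using fun_cong[OF eq, of z] by (simp add: qeval_diff r fun_of_def)
  qed (auto intro: radius_diff r)
  thus "F = G" by simp
qed

lemma sum_roots_of_unity:
  assumes d: "d > 0"
  shows "(\<Sum>b<d. exp (2 * of_real pi * \<i> * of_nat b / of_nat d) ^ m) = (if d dvd m then of_nat d else 0 :: complex)"
proof -
  define w where "w = exp (2 * of_real pi * \<i> * (of_nat m / of_nat d) :: complex)"
  have eq: "exp (2 * of_real pi * \<i> * of_nat b / of_nat d) ^ m = w ^ b" for b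
    by (simp add: w_def exp_of_nat_mult [symmetric] mult_ac)
  have wd: "w ^ d = 1"
  proof -
    have "w ^ d = exp (2 * of_real pi * \<i> * of_nat m)"
      using d by (simp add: w_def exp_of_nat_mult [symmetric])
    also have "\<dots> = 1" by (simp add: exp_eq_1) (metis mult.commute mult.left_commute of_int_of_nat_eq)
    finally show ?thesis .
  qed
  have w1: "w = 1 \<longleftrightarrow> d dvd m"
  proof
    assume "w = 1"
    then obtain n :: int where "2 * pi * (real m / real d) = of_int (2 * n) * pi"
      unfolding w_def exp_eq_1 by auto
    hence "real m = of_int n * real d" using d by (simp add: field_simps)
    hence "int m = n * int d" by (metis of_int_eq_iff of_int_mult of_int_of_nat_eq)
    thus "d dvd m" by (metis dvd_triv_right int_dvd_int_iff)
  next
    assume "d dvd m"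
    then obtain e where "m = d * e" by (elim dvdE)
    hence "w = exp (2 * of_real pi * \<i> * of_nat e)" using d by (simp add: w_def)
    also have "\<dots> = 1" by (simp add: exp_eq_1) (metis mult.commute mult.left_commute of_int_of_nat_eq)
    finally show "w = 1" .
  qed
  show ?thesis
  proof (cases "d dvd m")
    case True
    thus ?thesis using w1 by (simp add: eq)
  next
    case False
    have "(\<Sum>b<d. w ^ b) = (w ^ d - 1) / (w - 1)" using False w1 by (intro geometric_sum) auto
    thus ?thesis using False wd by (simp add: eq)
  qed
qed

text \<open>Orthogonality of roots of unity removes all exponents not divisible by d. The surviving
  exponent dj becomes q^(aj), because the nome of az/d has d-th power q^a. The two reindexings lead
  from multiples of d to j and from j to multiples of a.\<close>

lemma hecke_inner_sums:
  assumes r: "fps_conv_radius F \<ge> 1" and z: "z \<in> upper_half_plane" and a: "a > 0" and d: "d > 0"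
  shows "(\<lambda>m. if a dvd m then of_nat d * fps_nth F (d * (m div a)) * nome z ^ m else 0) sums
     (\<Sum>b<d. qeval F ((of_nat a * z + of_nat b) / of_nat d))"
proof -
  define \<zeta> where "\<zeta> = (\<lambda>b. exp (2 * of_real pi * \<i> * of_nat b / of_nat d) :: complex)"
  define x where "x = nome (of_nat a * z / of_nat d)"
  have u: "(of_nat a * z + of_nat b) / of_nat d \<in> upper_half_plane" for b
    using z a d by (simp add: upper_half_plane_def)
  have n: "nome ((of_nat a * z + of_nat b) / of_nat d) = x * \<zeta> b" for b
    by (simp add: nome_def x_def \<zeta>_def exp_add [symmetric] add_divide_distrib ring_distribs)
  have "(\<lambda>m. \<Sum>b<d. fps_nth F m * nome ((of_nat a * z + of_nat b) / of_nat d) ^ m) sums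
     (\<Sum>b<d. qeval F ((of_nat a * z + of_nat b) / of_nat d))"
    by (intro sums_sum qeval_sums r u)
  also have "(\<lambda>m. \<Sum>b<d. fps_nth F m * nome ((of_nat a * z + of_nat b) / of_nat d) ^ m) =
      (\<lambda>m. fps_nth F m * x ^ m * (\<Sum>b<d. \<zeta> b ^ m))"
    by (simp only: n power_mult_distrib sum_distrib_left mult.assoc)
  also have "\<dots> = (\<lambda>m. if d dvd m then of_nat d * fps_nth F m * x ^ m else 0)"
    unfolding \<zeta>_def sum_roots_of_unity[OF d] by auto
  also have "\<dots> sums (\<Sum>b<d. qeval F ((of_nat a * z + of_nat b) / of_nat d)) \<longleftrightarrow>
     (\<lambda>j. of_nat d * fps_nth F (d * j) * nome z ^ (a * j)) sums (\<Sum>b<d. qeval F ((of_nat a * z + of_nat b) / of_nat d))"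
  proof -
    have "x ^ d = nome z ^ a" using d by (simp add: x_def nome_power)
    hence x: "x ^ (d * j) = nome z ^ (a * j)" for j by (simp add: power_mult)
    show ?thesis
      using d by (subst sums_mono_reindex[of "\<lambda>j. d * j", symmetric])
        (auto simp: strict_mono_def x elim!: dvdE)
  qed
  also have "\<dots> \<longleftrightarrow> (\<lambda>m. if a dvd m then of_nat d * fps_nth F (d * (m div a)) * nome z ^ m else 0) sums
      (\<Sum>b<d. qeval F ((of_nat a * z + of_nat b) / of_nat d))"
    using a by (subst (2) sums_mono_reindex[of "\<lambda>j. a * j", symmetric])
        (auto simp: strict_mono_def elim!: dvdE)
  finally show ?thesis .
qed

definition hecke_value :: "nat \<Rightarrow> nat \<Rightarrow> complex fps \<Rightarrow> complex \<Rightarrow> complex" where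
  "hecke_value k n F z = 1 / of_nat n * (\<Sum>(a, d) \<in> {(a, d). a * d = n}. of_nat a ^ k *
        (\<Sum>b<d. qeval F ((of_nat a * z + of_nat b) / of_nat d)))"

lemma factor_pairs: "n > 0 \<Longrightarrow> {(a, d). a * d = n} = (\<lambda>a. (a, n div a)) ` {a. a dvd n}" for n :: nat
  by (auto simp: image_iff elim: dvdE)

lemma finite_factor_pairs: "n > 0 \<Longrightarrow> finite {(a, d). a * d = (n :: nat)}"
  by (simp add: factor_pairs finite_divisors_nat)

lemma hecke_fps_sums:
  assumes r: "fps_conv_radius F \<ge> 1" and z: "z \<in> upper_half_plane" and n: "n > 0" and k: "k > 0"
  shows "(\<lambda>m. fps_nth (hecke_fps k n F) m * nome z ^ m) sums hecke_value k n F z"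
proof -
  have "(\<lambda>m. 1 / of_nat n * (\<Sum>(a, d) \<in> {(a, d). a * d = n}. of_nat a ^ k *
      (if a dvd m then of_nat d * fps_nth F (d * (m div a)) * nome z ^ m else 0))) sums hecke_value k n F z"
    unfolding hecke_value_def
  proof (intro sums_mult sums_sum, clarify)
    fix a d assume "n = a * d"
    with n have "a > 0" "d > 0" by auto
    thus "(\<lambda>m. of_nat a ^ k * (if a dvd m then of_nat d * fps_nth F (d * (m div a)) * nome z ^ m else 0)) sums
       (of_nat a ^ k * (\<Sum>b<d. qeval F ((of_nat a * z + of_nat b) / of_nat d)))"
      by (intro sums_mult hecke_inner_sums[OF r z])
  qed
  moreover have "1 / of_nat n * (\<Sum>(a, d) \<in> {(a, d). a * d = n}. of_nat a ^ k *
      (if a dvd m then of_nat d * fps_nth F (d * (m div a)) * nome z ^ m else 0)) =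
      fps_nth (hecke_fps k n F) m * nome z ^ m" for m
  proof -
    have "1 / of_nat n * (\<Sum>(a, d) \<in> {(a, d). a * d = n}. of_nat a ^ k *
      (if a dvd m then of_nat d * fps_nth F (d * (m div a)) * nome z ^ m else 0)) =
      (\<Sum>a | a dvd n. 1 / of_nat n * (of_nat a ^ k *
      (if a dvd m then of_nat (n div a) * fps_nth F (n div a * (m div a)) * nome z ^ m else 0)))"
      unfolding factor_pairs[OF n] by (subst sum.reindex) (auto intro: inj_onI simp: sum_distrib_left)
    also have "\<dots> = (\<Sum>a | a dvd n. if a dvd m then of_nat a ^ (k - 1) * fps_nth F (n div a * (m div a)) * nome z ^ m else 0)"
    proof (rule sum.cong[OF refl])
      fix a assume "a \<in> {a. a dvd n}"
      then obtain d where nd: "n = a * d" by (auto elim: dvdE)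
      with n have ad: "a > 0" "d > 0" by auto
      have "of_nat a ^ k = of_nat a ^ (k - 1) * (of_nat a :: complex)"
        using k by (metis power_minus_mult)
      hence "1 / of_nat n * (of_nat a ^ k * of_nat d) = (of_nat a ^ (k - 1) :: complex)"
        using ad by (simp add: nd)
      hence "1 / of_nat n * (of_nat a ^ k * (of_nat d * w)) = of_nat a ^ (k - 1) * w" for w :: complex
        by (metis mult.assoc)
      thus "1 / of_nat n * (of_nat a ^ k *
          (if a dvd m then of_nat (n div a) * fps_nth F (n div a * (m div a)) * nome z ^ m else 0)) =
          (if a dvd m then of_nat a ^ (k - 1) * fps_nth F (n div a * (m div a)) * nome z ^ m else 0)"
        using ad by (simp add: nd mult.assoc)
    qed
    also have "\<dots> = (\<Sum>a | a dvd n \<and> a dvd m. of_nat a ^ (k - 1) * fps_nth F (n div a * (m div a)) * nome z ^ m)"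
      using n by (intro sum.mono_neutral_cong_right) (auto simp: finite_divisors_nat)
    finally show ?thesis by (simp add: hecke_fps_nth sum_distrib_right)
  qed
  ultimately show ?thesis by simp
qed

lemma radius_hecke_fps:
  "fps_conv_radius F \<ge> 1 \<Longrightarrow> n > 0 \<Longrightarrow> k > 0 \<Longrightarrow> fps_conv_radius (hecke_fps k n F) \<ge> 1"
  for F :: "complex fps"
  by (rule radius_ge_1I, rule sums_summable, rule hecke_fps_sums)

lemma qeval_hecke_fps:
  "fps_conv_radius F \<ge> 1 \<Longrightarrow> z \<in> upper_half_plane \<Longrightarrow> n > 0 \<Longrightarrow> k > 0 \<Longrightarrow>
    qeval (hecke_fps k n F) z = hecke_value k n F z"
  by (rule sums_unique2[OF qeval_sums hecke_fps_sums]) (auto intro: radius_hecke_fps)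

lemma hecke_op_fun_of:
  assumes F: "F \<in> cusp_fps k" and n: "n > 0" and k: "k > 0"
  shows "hecke_op k n (fun_of F) = fun_of (hecke_fps k n F)"
proof
  fix z
  have "(of_nat a * z + of_nat b) / of_nat d \<in> upper_half_plane \<longleftrightarrow> z \<in> upper_half_plane"
    if "n = a * d" for a b d
  proof -
    have "a > 0" "d > 0" using n that by auto
    thus ?thesis by (simp add: upper_half_plane_def zero_less_mult_iff zero_less_divide_iff)
  qed
  thus "hecke_op k n (fun_of F) z = fun_of (hecke_fps k n F) z"
    by (cases "z \<in> upper_half_plane")
       (auto simp: hecke_op_def fun_of_def qeval_hecke_fps cusp_fps_radius[OF F] n k hecke_value_def
          intro!: sum.cong sum.neutral)
qed

text \<open>
  Integral two-by-two matrices, as quadruples; \<open>hecke_reps n\<close> represents the left cosets of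
  \<open>SL\<^sub>2(\<int>)\<close> in the matrices of determinant \<open>n\<close>.
\<close>

type_synonym imat = "int \<times> int \<times> int \<times> int"

fun mmul :: "imat \<Rightarrow> imat \<Rightarrow> imat" where
  "mmul (a, b, c, d) (a', b', c', d') = (a * a' + b * c', a * b' + b * d', c * a' + d * c', c * b' + d * d')"

fun mdet :: "imat \<Rightarrow> int" where "mdet (a, b, c, d) = a * d - b * c"

fun madj :: "imat \<Rightarrow> imat" where "madj (a, b, c, d) = (d, - b, - c, a)"

fun mact :: "imat \<Rightarrow> complex \<Rightarrow> complex" where
  "mact (a, b, c, d) z = (of_int a * z + of_int b) / (of_int c * z + of_int d)"

fun mfac :: "imat \<Rightarrow> complex \<Rightarrow> complex" where
  "mfac (a, b, c, d) z = of_int c * z + of_int d"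

definition hecke_reps :: "nat \<Rightarrow> imat set" where
  "hecke_reps n = {(a, b, c, d). c = 0 \<and> a > 0 \<and> a * d = int n \<and> 0 \<le> b \<and> b < d}"

lemma mmul_assoc: "mmul (mmul A B) C = mmul A (mmul B C)"
  by (cases A; cases B; cases C) (simp add: algebra_simps)

lemma mdet_mmul: "mdet (mmul A B) = mdet A * mdet B"
  by (cases A; cases B) (simp add: algebra_simps)

lemma mdet_madj [simp]: "mdet (madj A) = mdet A"
  by (cases A) simp

lemma mmul_one [simp]: "mmul (1, 0, 0, 1) A = A" "mmul A (1, 0, 0, 1) = A"
  by (cases A; simp)+

lemma mmul_madj: "mdet A = 1 \<Longrightarrow> mmul (madj A) A = (1, 0, 0, 1)" "mdet A = 1 \<Longrightarrow> mmul A (madj A) = (1, 0, 0, 1)"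
  by (cases A; simp add: algebra_simps)+

lemma mfac_nonzero:
  assumes "mdet A > 0" "z \<in> upper_half_plane" shows "mfac A z \<noteq> 0"
proof -
  obtain a b c d where A: "A = (a, b, c, d)" by (cases A)
  have "c \<noteq> 0 \<or> d \<noteq> 0" using assms(1) by (auto simp: A)
  from automorphy_nonzero[OF assms(2) this] show ?thesis by (simp add: A)
qed

lemma mact_upper_half_plane: "mdet A > 0 \<Longrightarrow> z \<in> upper_half_plane \<Longrightarrow> mact A z \<in> upper_half_plane"
  by (cases A) (simp add: moebius_in_upper_half_plane)

lemma mfac_mmul:
  assumes "mdet B > 0" "z \<in> upper_half_plane"
  shows "mfac (mmul A B) z = mfac A (mact B z) * mfac B z"
proof -
  obtain a b c d where A: "A = (a, b, c, d)" by (cases A)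
  obtain a' b' c' d' where B: "B = (a', b', c', d')" by (cases B)
  define j where "j = of_int c' * z + of_int d'"
  have j: "j \<noteq> 0" using mfac_nonzero[OF assms] by (simp add: B j_def)
  have "(of_int c * ((of_int a' * z + of_int b') / j) + of_int d) * j = of_int c * (of_int a' * z + of_int b') + of_int d * j"
    using j by (simp add: ring_distribs)
  thus ?thesis by (simp add: A B flip: j_def) (simp add: j_def algebra_simps)
qed

lemma mact_mmul:
  assumes "mdet A > 0" "mdet B > 0" "z \<in> upper_half_plane"
  shows "mact (mmul A B) z = mact A (mact B z)"
proof -
  obtain a b c d where A: "A = (a, b, c, d)" by (cases A)
  obtain a' b' c' d' where B: "B = (a', b', c', d')" by (cases B)
  define j where "j = of_int c' * z + of_int d'"
  have j: "j \<noteq> 0" using mfac_nonzero[OF assms(2,3)] by (simp add: B j_def)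
  define w where "w = (of_int a' * z + of_int b') / j"
  have wj: "w * j = of_int a' * z + of_int b'" using j by (simp add: w_def)
  have "mact A w = ((of_int a * w + of_int b) * j) / ((of_int c * w + of_int d) * j)"
    using j by (simp add: A)
  also have "(of_int a * w + of_int b) * j = of_int a * (w * j) + of_int b * j" by (simp add: algebra_simps)
  also have "\<dots> = of_int (a * a' + b * c') * z + of_int (a * b' + b * d')"
    unfolding wj by (simp add: j_def algebra_simps)
  also have "(of_int c * w + of_int d) * j = of_int c * (w * j) + of_int d * j" by (simp add: algebra_simps)
  also have "\<dots> = of_int (c * a' + d * c') * z + of_int (c * b' + d * d')"
    unfolding wj by (simp add: j_def algebra_simps)
  finally show ?thesis by (simp add: A B w_def j_def)
qed

lemma hecke_reps_det: "M \<in> hecke_reps n \<Longrightarrow> mdet M = int n"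
  by (auto simp: hecke_reps_def)

lemma hecke_reps_eq_image:
  assumes n: "n > 0"
  shows "hecke_reps n = (\<lambda>((a, d), b). (int a, int b, 0 :: int, int d)) ` Sigma {(a, d). a * d = n} (\<lambda>(a, d). {..<d})"
proof (intro equalityI subsetI)
  fix M assume "M \<in> hecke_reps n"
  then obtain a b d where M: "M = (a, b, 0, d)" "a > 0" "a * d = int n" "0 \<le> b" "b < d"
    by (auto simp: hecke_reps_def)
  have d: "d > 0" using M by simp
  have "nat a * nat d = n" using M d by (simp flip: nat_mult_distrib)
  thus "M \<in> (\<lambda>((a, d), b). (int a, int b, 0 :: int, int d)) ` Sigma {(a, d). a * d = n} (\<lambda>(a, d). {..<d})"
    using M d by (intro image_eqI[of _ _ "((nat a, nat d), nat b)"]) auto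
next
  fix M :: imat assume "M \<in> (\<lambda>((a, d), b). (int a, int b, 0 :: int, int d)) ` Sigma {(a, d). a * d = n} (\<lambda>(a, d). {..<d})"
  then obtain a b d where M: "M = (int a, int b, 0, int d)" "a * d = n" "b < d" by auto
  have "a > 0" using M n by (cases a) auto
  thus "M \<in> hecke_reps n" using M by (auto simp: hecke_reps_def)
qed

lemma finite_hecke_reps: "n > 0 \<Longrightarrow> finite (hecke_reps n)"
  unfolding hecke_reps_eq_image by (intro finite_imageI finite_SigmaI finite_factor_pairs) auto

text \<open>The connecting matrix is upper triangular with positive diagonal, hence unipotent, and
  the reduction of the upper right entry modulo d leaves only the identity.\<close>

lemma hecke_reps_unique:
  assumes "M \<in> hecke_reps n" "M' \<in> hecke_reps n" "mdet G = 1" "M = mmul G M'"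
  shows "M = M'"
proof -
  obtain \<alpha> \<beta> \<gamma> \<delta> where G: "G = (\<alpha>, \<beta>, \<gamma>, \<delta>)" by (cases G)
  obtain a b d where M: "M = (a, b, 0, d)" "a > 0" "a * d = int n" "0 \<le> b" "b < d"
    using assms(1) by (auto simp: hecke_reps_def)
  obtain a' b' d' where M': "M' = (a', b', 0, d')" "a' > 0" "a' * d' = int n" "0 \<le> b'" "b' < d'"
    using assms(2) by (auto simp: hecke_reps_def)
  have eqs: "a = \<alpha> * a'" "b = \<alpha> * b' + \<beta> * d'" "0 = \<gamma> * a'" "d = \<gamma> * b' + \<delta> * d'"
    using assms(4) by (simp_all add: G M M')
  have "\<gamma> = 0" using eqs(3) M'(2) by simp
  moreover have "\<alpha> > 0" using eqs(1) M(2) M'(2) by (simp add: zero_less_mult_iff)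
  ultimately have "\<alpha> = 1" "\<delta> = 1" using assms(3) by (simp_all add: G zmult_eq_1_iff)
  with eqs \<open>\<gamma> = 0\<close> have e: "a = a'" "d = d'" "b = b' + \<beta> * d'" by simp_all
  have "b mod d' = b" using M(4,5) e(2) by (intro mod_pos_pos_trivial) simp_all
  moreover have "b' mod d' = b'" using M'(4,5) by (intro mod_pos_pos_trivial) simp_all
  ultimately have "b = b'" using e(3) by (metis mod_mult_self1)
  with e show ?thesis by (simp add: M M')
qed

text \<open>Hermite normal form: Bezout coefficients give a row operation that turns the first
  column into (gcd, 0), and a translation reduces the upper right entry modulo the lower right
  one.\<close>

lemma hecke_reps_exists:
  assumes M: "mdet M = int n" and n: "n > 0"
  obtains G where "mdet G = 1" "mmul G M \<in> hecke_reps n"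
proof -
  obtain a b c d where M': "M = (a, b, c, d)" by (cases M)
  have det: "a * d - b * c = int n" using M by (simp add: M')
  define g where "g = gcd a c"
  have "a \<noteq> 0 \<or> c \<noteq> 0" using det n by auto
  hence g: "g > 0" by (auto simp: g_def gcd_pos_int)
  obtain a' c' where ac: "a = g * a'" "c = g * c'" unfolding g_def by (metis dvdE gcd_dvd1 gcd_dvd2)
  obtain u v where "u * a + v * c = g" using bezout_int[of a c] by (auto simp: g_def)
  hence "g * (u * a' + v * c') = g * 1" by (simp add: ac algebra_simps)
  hence uv: "u * a' + v * c' = 1" using g by (subst (asm) mult_cancel_left) simp
  define e where "e = a' * d - c' * b"
  have ge: "g * e = int n" using det by (simp add: e_def ac algebra_simps)
  hence e: "e > 0" using g n by (metis of_nat_0_less_iff zero_less_mult_pos)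
  define B where "B = u * b + v * d"
  define t where "t = B div e"
  have B: "0 \<le> B - t * e" "B - t * e < e" using e by (simp_all add: t_def minus_div_mult_eq_mod)
  define G where "G = mmul (1, - t, 0, 1) (u, v, - c', a')"
  have "mdet G = 1" unfolding G_def mdet_mmul using uv by (simp add: algebra_simps)
  moreover have "mmul (u, v, - c', a') M = (g, B, 0, e)"
    using \<open>u * a + v * c = g\<close> by (simp add: M' B_def e_def ac algebra_simps)
  hence "mmul G M = (g, B - t * e, 0, e)" unfolding G_def mmul_assoc by simp
  hence "mmul G M \<in> hecke_reps n" using g ge B by (simp add: hecke_reps_def)
  ultimately show thesis by (rule that)
qed

text \<open>T_n as a sum over coset representatives, the shape in which modularity becomes visible.
  The weight a^k / n equals n^(k-1) d^(-k), and d is the automorphy factor of an upper triangular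
  matrix.\<close>

lemma hecke_value_reps:
  assumes n: "n > 0"
  shows "hecke_value k n F z = of_nat n ^ k / of_nat n * (\<Sum>M\<in>hecke_reps n. qeval F (mact M z) / mfac M z ^ k)"
proof -
  have inj: "inj_on (\<lambda>((a, d), b). (int a, int b, 0 :: int, int d)) S" for S by (auto intro!: inj_onI)
  have "(\<Sum>M\<in>hecke_reps n. qeval F (mact M z) / mfac M z ^ k) =
     (\<Sum>((a, d), b) \<in> Sigma {(a, d). a * d = n} (\<lambda>(a, d). {..<d}). qeval F ((of_nat a * z + of_nat b) / of_nat d) / of_nat d ^ k)"
    unfolding hecke_reps_eq_image[OF n] by (subst sum.reindex[OF inj]) (auto intro!: sum.cong)
  also have "\<dots> = (\<Sum>p\<in>{(a, d). a * d = n}. \<Sum>b\<in>(case p of (a, d) \<Rightarrow> {..<d}).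
      (case p of (a, d) \<Rightarrow> qeval F ((of_nat a * z + of_nat b) / of_nat d) / of_nat d ^ k))"
    by (subst sum.Sigma) (auto simp: finite_factor_pairs n intro!: sum.cong)
  finally have "of_nat n ^ k / of_nat n * (\<Sum>M\<in>hecke_reps n. qeval F (mact M z) / mfac M z ^ k) =
    1 / of_nat n * (\<Sum>p\<in>{(a, d). a * d = n}. of_nat n ^ k * (\<Sum>b\<in>(case p of (a, d) \<Rightarrow> {..<d}).
      (case p of (a, d) \<Rightarrow> qeval F ((of_nat a * z + of_nat b) / of_nat d) / of_nat d ^ k)))"
    by (simp add: sum_distrib_left)
  also have "\<dots> = hecke_value k n F z"
    unfolding hecke_value_def
  proof (intro arg_cong[of _ _ "\<lambda>x. 1 / of_nat n * x"] sum.cong refl, clarify)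
    fix a d assume nd: "n = a * d"
    hence d: "d > 0" using n by auto
    have "of_nat n ^ k / of_nat d ^ k = (of_nat a ^ k :: complex)" using d by (simp add: nd power_mult_distrib)
    hence "of_nat n ^ k * (w / of_nat d ^ k) = of_nat a ^ k * w" for w :: complex
      by (metis times_divide_eq_left times_divide_eq_right)
    thus "of_nat (a * d) ^ k * (\<Sum>b<d. qeval F ((of_nat a * z + of_nat b) / of_nat d) / of_nat d ^ k)
       = of_nat a ^ k * (\<Sum>b<d. qeval F ((of_nat a * z + of_nat b) / of_nat d))"
      unfolding nd sum_divide_distrib [symmetric] .
  qed
  finally show ?thesis ..
qed

text \<open>As F is modular, the summand \<open>\<Phi>\<close> depends only on the left coset of its
  matrix. Right multiplication by G permutes these cosets and produces the automorphy factor of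
  G.\<close>

lemma hecke_fps_mforms:
  assumes F: "F \<in> mforms k" and n: "n > 0" and k: "k > 0"
  shows "hecke_fps k n F \<in> mforms k"
proof (rule mformsI)
  note r = mformsD_radius[OF F]
  show "fps_conv_radius (hecke_fps k n F) \<ge> 1" by (rule radius_hecke_fps[OF r n k])
  fix a b c d :: int and z assume det: "a * d - b * c = 1" and z: "z \<in> upper_half_plane"
  define G where "G = (a, b, c, d)"
  have G: "mdet G = 1" using det by (simp add: G_def)
  have Gz: "mact G z \<in> upper_half_plane" using mact_upper_half_plane[of G z] G z by simp
  define \<Phi> where "\<Phi> = (\<lambda>M z. qeval F (mact M z) / mfac M z ^ k)"
  have left: "\<Phi> (mmul H M) w = \<Phi> M w" if H: "mdet H = 1" and M: "mdet M > 0" and w: "w \<in> upper_half_plane" for H M w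
  proof -
    have Mw: "mact M w \<in> upper_half_plane" by (rule mact_upper_half_plane[OF M w])
    obtain a b c d where H': "H = (a, b, c, d)" by (cases H)
    have "qeval F (mact H (mact M w)) = mfac H (mact M w) ^ k * qeval F (mact M w)"
      using mformsD[OF F, of a d b c "mact M w"] H Mw by (simp add: H')
    moreover have "mfac H (mact M w) \<noteq> 0" using mfac_nonzero[of H "mact M w"] H Mw by simp
    ultimately show ?thesis
      using H M w by (simp add: \<Phi>_def mact_mmul mfac_mmul power_mult_distrib)
  qed
  have right: "\<Phi> M (mact G z) = mfac G z ^ k * \<Phi> (mmul M G) z" if M: "mdet M > 0" for M
    using mfac_nonzero[of G z] G z M by (simp add: \<Phi>_def mact_mmul mfac_mmul power_mult_distrib)
  \<comment> \<open>\<open>rep M\<close> is the representative of the coset of \<open>M\<close>. The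
    map from \<open>M\<close> to \<open>rep (mmul M G)\<close> is injective on a finite set, hence a
    permutation.\<close>
  define P where "P = (\<lambda>M N. N \<in> hecke_reps n \<and> (\<exists>H. mdet H = 1 \<and> N = mmul H M))"
  define rep where "rep = (\<lambda>M. SOME N. P M N)"
  have rep: "P M (rep M)" if M: "mdet M = int n" for M
    unfolding rep_def
  proof (rule someI_ex)
    obtain H where "mdet H = 1" "mmul H M \<in> hecke_reps n" by (rule hecke_reps_exists[OF M n])
    thus "\<exists>N. P M N" unfolding P_def by blast
  qed
  have detG: "mdet (mmul M G) = int n" if "M \<in> hecke_reps n" for M
    using hecke_reps_det[OF that] G by (simp add: mdet_mmul)
  have inj: "inj_on (\<lambda>M. rep (mmul M G)) (hecke_reps n)"
  proof (rule inj_onI)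
    fix M N assume MN: "M \<in> hecke_reps n" "N \<in> hecke_reps n" "rep (mmul M G) = rep (mmul N G)"
    obtain H where H: "mdet H = 1" "rep (mmul M G) = mmul H (mmul M G)"
      using rep[OF detG[OF MN(1)]] unfolding P_def by blast
    obtain K where K: "mdet K = 1" "rep (mmul N G) = mmul K (mmul N G)"
      using rep[OF detG[OF MN(2)]] unfolding P_def by blast
    have "mmul (madj H) (mmul (mmul H (mmul M G)) (madj G)) = mmul (madj H) (mmul (mmul K (mmul N G)) (madj G))"
      using MN(3) H(2) K(2) by simp
    also have "mmul (madj H) (mmul (mmul H (mmul M G)) (madj G)) = mmul (mmul (madj H) H) (mmul M (mmul G (madj G)))"
      by (simp only: mmul_assoc)
    also have "\<dots> = M" using H G by (simp add: mmul_madj)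
    also have "mmul (madj H) (mmul (mmul K (mmul N G)) (madj G)) = mmul (mmul (madj H) K) (mmul N (mmul G (madj G)))"
      by (simp only: mmul_assoc)
    also have "\<dots> = mmul (mmul (madj H) K) N" using G by (simp add: mmul_madj)
    finally show "M = N"
      by (intro hecke_reps_unique[OF MN(1,2), of "mmul (madj H) K"]) (simp_all add: mdet_mmul H K)
  qed
  have sub: "(\<lambda>M. rep (mmul M G)) ` hecke_reps n \<subseteq> hecke_reps n"
    using rep[OF detG] by (auto simp: P_def)
  have bij: "bij_betw (\<lambda>M. rep (mmul M G)) (hecke_reps n) (hecke_reps n)"
    using inj endo_inj_surj[OF finite_hecke_reps[OF n] sub inj] by (simp add: bij_betw_def)
  have "(\<Sum>M\<in>hecke_reps n. \<Phi> M (mact G z)) = (\<Sum>M\<in>hecke_reps n. mfac G z ^ k * \<Phi> (rep (mmul M G)) z)"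
  proof (rule sum.cong[OF refl])
    fix M assume M: "M \<in> hecke_reps n"
    obtain H where H: "mdet H = 1" "rep (mmul M G) = mmul H (mmul M G)"
      using rep[OF detG[OF M]] unfolding P_def by blast
    have "\<Phi> (rep (mmul M G)) z = \<Phi> (mmul M G) z"
      unfolding H(2) by (rule left) (use H detG[OF M] n z in auto)
    thus "\<Phi> M (mact G z) = mfac G z ^ k * \<Phi> (rep (mmul M G)) z"
      using right[of M] hecke_reps_det[OF M] n by simp
  qed
  also have "\<dots> = mfac G z ^ k * (\<Sum>M\<in>hecke_reps n. \<Phi> (rep (mmul M G)) z)"
    by (simp add: sum_distrib_left)
  also have "(\<Sum>M\<in>hecke_reps n. \<Phi> (rep (mmul M G)) z) = (\<Sum>M\<in>hecke_reps n. \<Phi> M z)"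
    by (rule sum.reindex_bij_betw[OF bij])
  finally have "hecke_value k n F (mact G z) = mfac G z ^ k * hecke_value k n F z"
    by (simp add: hecke_value_reps[OF n] \<Phi>_def)
  thus "qeval (hecke_fps k n F) ((of_int a * z + of_int b) / (of_int c * z + of_int d))
      = (of_int c * z + of_int d) ^ k * qeval (hecke_fps k n F) z"
    using qeval_hecke_fps[OF r Gz n k] qeval_hecke_fps[OF r z n k] by (simp add: G_def)
qed

lemma hecke_fps_cusp: "F \<in> cusp_fps k \<Longrightarrow> n > 0 \<Longrightarrow> k > 0 \<Longrightarrow> hecke_fps k n F \<in> cusp_fps k"
  by (auto simp: cusp_fps_def hecke_fps_mforms hecke_fps_nth)

section \<open>Commutation of Hecke operators\<close>

lemma hecke_fps_prime_nth:
  assumes p: "prime p"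
  shows "fps_nth (hecke_fps k p F) m =
    fps_nth F (p * m) + (if p dvd m then of_nat p ^ (k - 1) * fps_nth F (m div p) else 0)"
proof -
  have p0: "p > 1" using p by (rule prime_gt_1_nat)
  have "{a. a dvd p \<and> a dvd m} = (if p dvd m then {1, p} else {1})"
    using p by (auto simp: prime_nat_iff)
  thus ?thesis using p0 by (simp add: hecke_fps_nth)
qed

text \<open>For prime p the formula for T_p has only two terms, so both composites are sums over
  divisors of n. They agree once these divisors are sorted by divisibility by p.\<close>

lemma hecke_fps_commute:
  fixes F :: "'a::comm_ring_1 fps"
  assumes p: "prime p" and n: "n > 0"
  shows "hecke_fps k p (hecke_fps k n F) = hecke_fps k n (hecke_fps k p F)"
proof (rule fps_ext)
  fix r
  define c where "c = k - 1"
  have p0: "p > 0" using p by (rule prime_gt_0_nat)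
  note fin = finite_subset[OF _ finite_divisors_nat[OF n]]
  \<comment> \<open>On the left, a divisor of pr that does not divide r is pe with e in
    \<open>B'\<close>, and the term at r/p contributes \<open>B''\<close>. On the right, p divides
    (n/d)(r/d) either through r/d, which is \<open>B''\<close>, or through n/d alone, which is
    \<open>B'\<close>.\<close>
  define A B B' B'' where "A = {d. d dvd n \<and> d dvd r}"
    and "B = {d. d dvd n \<and> d dvd p * r \<and> \<not> d dvd r}"
    and "B' = {e. p * e dvd n \<and> e dvd r \<and> \<not> p * e dvd r}"
    and "B'' = {e. e dvd n \<and> p * e dvd r}"
  have finA: "finite A" "finite B" "finite B'" "finite B''"
    by (rule fin; auto simp: A_def B_def B'_def B''_def dest: dvd_mult_right)+
  define g where "g = (\<lambda>e. of_nat e ^ c * (of_nat p ^ c * fps_nth F ((n div e * (r div e)) div p)))"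
  have L1: "fps_nth (hecke_fps k n F) (p * r) =
      (\<Sum>d\<in>A. of_nat d ^ c * fps_nth F (p * (n div d * (r div d)))) + (\<Sum>e\<in>B'. g e)"
  proof -
    have "{d. d dvd n \<and> d dvd p * r} = A \<union> B" by (auto simp: A_def B_def)
    hence "fps_nth (hecke_fps k n F) (p * r) = (\<Sum>d\<in>A \<union> B. of_nat d ^ c * fps_nth F (n div d * (p * r div d)))"
      by (simp add: hecke_fps_nth c_def)
    also have "\<dots> = (\<Sum>d\<in>A. of_nat d ^ c * fps_nth F (n div d * (p * r div d))) +
        (\<Sum>d\<in>B. of_nat d ^ c * fps_nth F (n div d * (p * r div d)))"
      by (rule sum.union_disjoint) (use finA in \<open>auto simp: A_def B_def\<close>)
    also have "(\<Sum>d\<in>A. of_nat d ^ c * fps_nth F (n div d * (p * r div d))) =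
        (\<Sum>d\<in>A. of_nat d ^ c * fps_nth F (p * (n div d * (r div d))))"
      by (rule sum.cong) (auto simp: A_def div_mult_swap mult_ac)
    also have "(\<Sum>d\<in>B. of_nat d ^ c * fps_nth F (n div d * (p * r div d))) = (\<Sum>e\<in>B'. g e)"
    proof (rule sum.reindex_bij_witness[of _ "\<lambda>e. p * e" "\<lambda>d. d div p"])
      fix d assume d: "d \<in> B"
      have "p dvd d"
      proof (rule ccontr)
        assume "\<not> p dvd d"
        with p have "coprime p d" by (rule prime_imp_coprime)
        hence "coprime d p" by (simp add: coprime_commute)
        with d show False by (auto simp: B_def coprime_dvd_mult_right_iff)
      qed
      then obtain e where e: "d = p * e" by (elim dvdE)
      show "p * (d div p) = d" "d div p \<in> B'" using d p0 by (auto simp: e B_def B'_def)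
      have "p * e dvd n" "e dvd r" using d p0 by (auto simp: B_def e)
      then obtain n' r' where nr: "n = p * e * n'" "r = e * r'" by (auto elim!: dvdE)
      have "e > 0" using n nr by auto
      thus "g (d div p) = of_nat d ^ c * fps_nth F (n div d * (p * r div d))"
        using p0 unfolding g_def e nr
        by (simp add: power_mult_distrib mult.assoc mult.left_commute[of e p] mult.left_commute[of e "_" p])
    next
      fix e assume e: "e \<in> B'"
      thus "p * e div p = e" "p * e \<in> B" using p0 by (auto simp: B_def B'_def)
    qed
    finally show ?thesis .
  qed
  have L2: "(if p dvd r then of_nat p ^ c * fps_nth (hecke_fps k n F) (r div p) else 0) = (\<Sum>e\<in>B''. g e)"
  proof (cases "p dvd r")
    case True
    then obtain s where s: "r = p * s" by (elim dvdE)
    have B: "B'' = {d. d dvd n \<and> d dvd s}" using p0 by (auto simp: B''_def s)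
    have "of_nat p ^ c * fps_nth (hecke_fps k n F) s = (\<Sum>e\<in>B''. g e)"
      unfolding B hecke_fps_nth sum_distrib_left
    proof (rule sum.cong[OF refl])
      fix d assume "d \<in> {d. d dvd n \<and> d dvd s}"
      then obtain n' s' where ns: "n = d * n'" "s = d * s'" by (auto elim!: dvdE)
      have "d > 0" using n ns by auto
      moreover have "p * (d * s') div d = p * s'" using \<open>d > 0\<close> by (simp add: mult.left_commute)
      moreover have "n' * (p * s') div p = n' * s'" using p0 by (simp add: mult.left_commute)
      ultimately show "of_nat p ^ c * (of_nat d ^ (k - 1) * fps_nth F (n div d * (s div d))) = g d"
        by (simp add: g_def s ns c_def mult.left_commute)
    qed
    thus ?thesis using True p0 by (simp add: s)
  next
    case False
    hence "B'' = {}" by (auto simp: B''_def dest: dvd_mult_left)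
    thus ?thesis using False by simp
  qed
  have R: "fps_nth (hecke_fps k n (hecke_fps k p F)) r =
     (\<Sum>d\<in>A. of_nat d ^ c * fps_nth F (p * (n div d * (r div d)))) + (\<Sum>e\<in>B' \<union> B''. g e)"
  proof -
    have "fps_nth (hecke_fps k n (hecke_fps k p F)) r =
      (\<Sum>d\<in>A. of_nat d ^ c * fps_nth F (p * (n div d * (r div d)))) +
      (\<Sum>d\<in>A. if p dvd n div d * (r div d) then g d else 0)"
      unfolding hecke_fps_nth[of k n] hecke_fps_prime_nth[OF p] A_def [symmetric] sum.distrib [symmetric]
      by (rule sum.cong) (auto simp: g_def c_def ring_distribs)
    also have "(\<Sum>d\<in>A. if p dvd n div d * (r div d) then g d else 0) = (\<Sum>e\<in>B' \<union> B''. g e)"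
    proof (rule sum.mono_neutral_cong_right)
      show "B' \<union> B'' \<subseteq> A" by (auto simp: A_def B'_def B''_def dest: dvd_mult_right)
      have "p dvd n div d * (r div d) \<longleftrightarrow> d \<in> B' \<union> B''" if "d \<in> A" for d
      proof -
        from that obtain n' r' where nr: "n = d * n'" "r = d * r'" by (auto simp: A_def elim!: dvdE)
        have d: "d > 0" using n nr by auto
        have "p * d dvd d * m \<longleftrightarrow> p dvd m" for m using d by (simp add: mult.commute[of p])
        thus ?thesis using d p by (auto simp: nr B'_def B''_def prime_dvd_mult_iff)
      qed
      thus "\<forall>i\<in>A - (B' \<union> B''). (if p dvd n div i * (r div i) then g i else 0) = 0"
        "\<And>x. x \<in> B' \<union> B'' \<Longrightarrow> (if p dvd n div x * (r div x) then g x else 0) = g x"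
        using \<open>B' \<union> B'' \<subseteq> A\<close> by auto
    qed (rule finA)
    finally show ?thesis .
  qed
  have "(\<Sum>e\<in>B' \<union> B''. g e) = (\<Sum>e\<in>B'. g e) + (\<Sum>e\<in>B''. g e)"
    by (rule sum.union_disjoint) (use finA in \<open>auto simp: B'_def B''_def\<close>)
  thus "fps_nth (hecke_fps k p (hecke_fps k n F)) r = fps_nth (hecke_fps k n (hecke_fps k p F)) r"
    unfolding hecke_fps_prime_nth[OF p] c_def [symmetric] L1 L2 R by (simp only: add.assoc)
qed

section \<open>Linear algebra\<close>

text \<open>Linearity is required on all functions, only invariance on V. The formula for a Hecke
  operator makes sense everywhere, and sums can then be moved without membership conditions.\<close>

definition linear_on_space :: "(complex \<Rightarrow> complex) set \<Rightarrow> ((complex \<Rightarrow> complex) \<Rightarrow> (complex \<Rightarrow> complex)) \<Rightarrow> bool" where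
  "linear_on_space V T \<longleftrightarrow> cfun.subspace V \<and> (\<forall>f\<in>V. T f \<in> V) \<and>
     (\<forall>f g. T (f + g) = T f + T g) \<and> (\<forall>c f. T (fscale c f) = fscale c (T f))"

lemma linear_on_space_sum:
  assumes "linear_on_space V T" shows "T (\<Sum>i\<in>I. f i) = (\<Sum>i\<in>I. T (f i))"
proof -
  have "T (fscale 0 0) = fscale 0 (T 0)" using assms by (simp only: linear_on_space_def)
  hence "T 0 = 0" by simp
  thus ?thesis using assms
    by (induction I rule: infinite_finite_induct) (auto simp: linear_on_space_def)
qed

text \<open>Applying T minus one eigenvalue removes its eigenvector and multiplies the other
  coefficients by nonzero differences, which allows induction.\<close>

lemma eigenvectors_independent:
  assumes T: "linear_on_space V T" and fin: "finite S"
    and e: "\<And>\<kappa>. \<kappa> \<in> S \<Longrightarrow> T (f \<kappa>) = fscale \<kappa> (f \<kappa>)" "\<And>\<kappa>. \<kappa> \<in> S \<Longrightarrow> f \<kappa> \<noteq> 0"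
    and sum: "(\<Sum>\<kappa>\<in>S. fscale (c \<kappa>) (f \<kappa>)) = 0" and \<mu>: "\<mu> \<in> S"
  shows "c \<mu> = 0"
  using fin e sum \<mu>
proof (induction S arbitrary: c \<mu> rule: finite_induct)
  case (insert \<nu> S)
  have s: "fscale (c \<nu>) (f \<nu>) + (\<Sum>\<kappa>\<in>S. fscale (c \<kappa>) (f \<kappa>)) = 0"
    using insert.prems(3) unfolding sum.insert[OF insert.hyps(1,2)] .
  have "T (fscale (c \<nu>) (f \<nu>) + (\<Sum>\<kappa>\<in>S. fscale (c \<kappa>) (f \<kappa>))) =
      fscale (c \<nu>) (T (f \<nu>)) + (\<Sum>\<kappa>\<in>S. fscale (c \<kappa>) (T (f \<kappa>)))"
  proof -
    have "T (f + g) = T f + T g" "T (fscale a f) = fscale a (T f)" for f g a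
      using T by (simp_all only: linear_on_space_def)
    thus ?thesis by (simp only: linear_on_space_sum[OF T])
  qed
  also have "\<dots> = fscale (c \<nu>) (fscale \<nu> (f \<nu>)) + (\<Sum>\<kappa>\<in>S. fscale (c \<kappa>) (fscale \<kappa> (f \<kappa>)))"
    using insert.prems(1) by (intro arg_cong2[of _ _ _ _ "(+)"] sum.cong) auto
  finally have "fscale (c \<nu>) (fscale \<nu> (f \<nu>)) + (\<Sum>\<kappa>\<in>S. fscale (c \<kappa>) (fscale \<kappa> (f \<kappa>))) = T 0"
    unfolding s by simp
  also have "T 0 = 0" using linear_on_space_sum[OF T, of _ "{}"] by simp
  finally have t: "fscale (c \<nu>) (fscale \<nu> (f \<nu>)) + (\<Sum>\<kappa>\<in>S. fscale (c \<kappa>) (fscale \<kappa> (f \<kappa>))) = 0" .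
  have "(\<Sum>\<kappa>\<in>S. fscale (c \<kappa> * (\<kappa> - \<nu>)) (f \<kappa>)) =
      (\<Sum>\<kappa>\<in>S. fscale (c \<kappa>) (fscale \<kappa> (f \<kappa>))) - fscale \<nu> (\<Sum>\<kappa>\<in>S. fscale (c \<kappa>) (f \<kappa>))"
    unfolding cfun.scale_sum_right sum_subtractf [symmetric]
    by (rule sum.cong) (auto simp: fscale_def fun_eq_iff algebra_simps)
  also have "\<dots> = (fscale (c \<nu>) (fscale \<nu> (f \<nu>)) + (\<Sum>\<kappa>\<in>S. fscale (c \<kappa>) (fscale \<kappa> (f \<kappa>))))
      - fscale \<nu> (fscale (c \<nu>) (f \<nu>) + (\<Sum>\<kappa>\<in>S. fscale (c \<kappa>) (f \<kappa>)))"
    by (simp add: cfun.scale_right_distrib mult_ac)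
  also have "\<dots> = 0" unfolding s t by simp
  finally have z: "(\<Sum>\<kappa>\<in>S. fscale (c \<kappa> * (\<kappa> - \<nu>)) (f \<kappa>)) = 0" .
  have c0: "c \<kappa> = 0" if "\<kappa> \<in> S" for \<kappa>
  proof -
    have "c \<kappa> * (\<kappa> - \<nu>) = 0" by (rule insert.IH[OF _ _ z that]) (use insert.prems in auto)
    moreover have "\<kappa> \<noteq> \<nu>" using that insert.hyps by auto
    ultimately show ?thesis by simp
  qed
  hence "fscale (c \<nu>) (f \<nu>) = 0" using s by simp
  hence "c \<nu> = 0" using insert.prems(2) by simp
  with c0 insert.prems(4) show ?case by auto
qed auto

definition comb :: "(complex \<Rightarrow> complex) list \<Rightarrow> complex vec \<Rightarrow> complex \<Rightarrow> complex" where
  "comb bs v = (\<Sum>i<length bs. fscale (vec_index v i) (bs ! i))"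

lemma basis_sum_nth: "distinct bs \<Longrightarrow> (\<Sum>i<length bs. g (bs ! i)) = (\<Sum>b\<in>set bs. g b)"
  by (rule sum.reindex_bij_betw) (rule bij_betw_nth; simp)

lemma basis_expand:
  assumes "basis_list V bs" "f \<in> V"
  shows "f = comb bs (vec (length bs) (\<lambda>i. cfun.representation (set bs) f (bs ! i)))"
proof -
  have "f = (\<Sum>b\<in>set bs. fscale (cfun.representation (set bs) f b) b)"
    using assms by (intro cfun.sum_representation_eq [symmetric]) (auto simp: basis_list_def)
  also have "\<dots> = (\<Sum>i<length bs. fscale (cfun.representation (set bs) f (bs ! i)) (bs ! i))"
    using assms by (intro basis_sum_nth [symmetric]) (auto simp: basis_list_def)
  finally show ?thesis by (simp add: comb_def)
qed

lemma comb_in: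
  assumes "basis_list V bs" shows "comb bs v \<in> V"
proof -
  have "comb bs v \<in> cfun.span (set bs)"
    unfolding comb_def by (intro cfun.span_sum cfun.span_scale cfun.span_base) auto
  thus ?thesis using assms by (simp add: basis_list_def)
qed

lemma comb_inj:
  assumes b: "basis_list V bs" and v: "v \<in> carrier_vec (length bs)" "w \<in> carrier_vec (length bs)"
    and eq: "comb bs v = comb bs w"
  shows "v = w"
proof (rule eq_vecI)
  have d: "distinct bs" and ind: "cfun.independent (set bs)" using b by (auto simp: basis_list_def)
  define u where "u = (\<lambda>b. vec_index v (THE i. i < length bs \<and> bs ! i = b) - vec_index w (THE i. i < length bs \<and> bs ! i = b))"
  have u: "u (bs ! i) = vec_index v i - vec_index w i" if "i < length bs" for i
  proof -
    have "(THE j. j < length bs \<and> bs ! j = bs ! i) = i"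
      using that d by (intro the_equality) (auto simp: nth_eq_iff_index_eq)
    thus ?thesis by (simp add: u_def)
  qed
  have "(\<Sum>b\<in>set bs. fscale (u b) b) = (\<Sum>i<length bs. fscale (u (bs ! i)) (bs ! i))"
    by (rule basis_sum_nth[OF d, symmetric])
  also have "\<dots> = comb bs v - comb bs w"
    unfolding comb_def sum_subtractf [symmetric] by (rule sum.cong) (simp_all add: u cfun.scale_left_diff_distrib)
  also have "\<dots> = 0" by (simp add: eq)
  finally have "u b = 0" if "b \<in> set bs" for b
    using cfun.independentD[OF ind finite_set order_refl _ that] by blast
  thus "vec_index v i = vec_index w i" if "i < dim_vec w" for i
    using that u[of i] v by simp
qed (use v in auto)

lemma matrix_of_comb:
  assumes b: "basis_list V bs" and T: "linear_on_space V T" and v: "v \<in> carrier_vec (length bs)"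
  shows "T (comb bs v) = comb bs (mult_mat_vec (matrix_of bs T) v)"
proof -
  let ?n = "length bs"
  have bV: "bs ! j \<in> V" if "j < ?n" for j
    using b that cfun.span_base[of "bs ! j" "set bs"] by (auto simp: basis_list_def)
  have "T (comb bs v) = (\<Sum>j<?n. fscale (vec_index v j) (T (bs ! j)))"
    using T unfolding comb_def linear_on_space_sum[OF T] by (simp add: linear_on_space_def)
  also have "\<dots> = (\<Sum>j<?n. fscale (vec_index v j) (\<Sum>i<?n. fscale (index_mat (matrix_of bs T) (i, j)) (bs ! i)))"
  proof (rule sum.cong[OF refl])
    fix j assume j: "j \<in> {..<?n}"
    have "T (bs ! j) \<in> V" using T bV j by (auto simp: linear_on_space_def)
    from basis_expand[OF b this] have "T (bs ! j) = (\<Sum>i<?n. fscale (index_mat (matrix_of bs T) (i, j)) (bs ! i))"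
      using j by (simp add: comb_def matrix_of_def)
    thus "fscale (vec_index v j) (T (bs ! j)) =
      fscale (vec_index v j) (\<Sum>i<?n. fscale (index_mat (matrix_of bs T) (i, j)) (bs ! i))" by simp
  qed
  also have "\<dots> = (\<Sum>i<?n. \<Sum>j<?n. fscale (vec_index v j) (fscale (index_mat (matrix_of bs T) (i, j)) (bs ! i)))"
    unfolding cfun.scale_sum_right by (rule sum.swap)
  also have "\<dots> = (\<Sum>i<?n. fscale (\<Sum>j<?n. index_mat (matrix_of bs T) (i, j) * vec_index v j) (bs ! i))"
    by (simp add: cfun.scale_sum_left mult.commute)
  also have "\<dots> = comb bs (mult_mat_vec (matrix_of bs T) v)"
    using v unfolding comb_def
    by (intro sum.cong refl) (simp add: matrix_of_def scalar_prod_def atLeast0LessThan)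
  finally show ?thesis .
qed

lemma comb_smult: "v \<in> carrier_vec (length bs) \<Longrightarrow> comb bs (smult_vec c v) = fscale c (comb bs v)"
  unfolding comb_def cfun.scale_sum_right by (rule sum.cong) auto

text \<open>The map \<open>comb bs\<close> from coordinate vectors to V is bijective and intertwines
  the matrix with T, so eigenvectors correspond.\<close>

lemma roots_char_poly_matrix_of:
  assumes b: "basis_list V bs" and T: "linear_on_space V T"
  shows "poly (char_poly (matrix_of bs T)) \<kappa> = 0 \<longleftrightarrow> (\<exists>f\<in>V. f \<noteq> 0 \<and> T f = fscale \<kappa> f)"
proof -
  let ?n = "length bs" and ?A = "matrix_of bs T"
  have A: "?A \<in> carrier_mat ?n ?n" by (simp add: matrix_of_def)
  have c0: "comb bs (zero_vec ?n) = 0" by (simp add: comb_def)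
  have "poly (char_poly ?A) \<kappa> = 0 \<longleftrightarrow> eigenvalue ?A \<kappa>"
    by (rule eigenvalue_root_char_poly [symmetric]) (rule A)
  also have "\<dots> \<longleftrightarrow> (\<exists>v\<in>carrier_vec ?n. v \<noteq> zero_vec ?n \<and> mult_mat_vec ?A v = smult_vec \<kappa> v)"
    using A by (auto simp: eigenvalue_def eigenvector_def)
  also have "\<dots> \<longleftrightarrow> (\<exists>f\<in>V. f \<noteq> 0 \<and> T f = fscale \<kappa> f)"
  proof
    assume "\<exists>v\<in>carrier_vec ?n. v \<noteq> zero_vec ?n \<and> mult_mat_vec ?A v = smult_vec \<kappa> v"
    then obtain v where v: "v \<in> carrier_vec ?n" "v \<noteq> zero_vec ?n" "mult_mat_vec ?A v = smult_vec \<kappa> v" by blast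
    have "comb bs v \<noteq> 0" using comb_inj[OF b v(1), of "zero_vec ?n"] v(2) c0 by auto
    moreover have "T (comb bs v) = fscale \<kappa> (comb bs v)"
      using matrix_of_comb[OF b T v(1)] comb_smult[OF v(1)] v(3) by simp
    ultimately show "\<exists>f\<in>V. f \<noteq> 0 \<and> T f = fscale \<kappa> f" using comb_in[OF b] by blast
  next
    assume "\<exists>f\<in>V. f \<noteq> 0 \<and> T f = fscale \<kappa> f"
    then obtain f where f: "f \<in> V" "f \<noteq> 0" "T f = fscale \<kappa> f" by blast
    define v where "v = vec ?n (\<lambda>i. cfun.representation (set bs) f (bs ! i))"
    have v: "v \<in> carrier_vec ?n" by (simp add: v_def)
    have fv: "f = comb bs v" unfolding v_def by (rule basis_expand[OF b f(1)])
    have "comb bs (mult_mat_vec ?A v) = comb bs (smult_vec \<kappa> v)"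
      using matrix_of_comb[OF b T v] comb_smult[OF v] f(3) by (simp add: fv)
    hence "mult_mat_vec ?A v = smult_vec \<kappa> v"
      using A v by (intro comb_inj[OF b]) auto
    moreover have "v \<noteq> zero_vec ?n" using f(2) c0 fv by auto
    ultimately show "\<exists>v\<in>carrier_vec ?n. v \<noteq> zero_vec ?n \<and> mult_mat_vec ?A v = smult_vec \<kappa> v"
      using v by blast
  qed
  finally show ?thesis .
qed

text \<open>Hides the chosen basis. What remains is a degree common to all operators, the roots as
  eigenvalues, and the dimension count by which d independent vectors span.\<close>

lemma charpoly_on_properties:
  assumes "\<exists>bs. basis_list V bs"
  obtains d where
    "\<And>T. linear_on_space V T \<Longrightarrow> Polynomial.degree (charpoly_on V T) = d \<and> poly.coeff (charpoly_on V T) d = 1"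
    "\<And>T. linear_on_space V T \<Longrightarrow> roots (charpoly_on V T) = {\<kappa>. \<exists>f\<in>V. f \<noteq> 0 \<and> T f = fscale \<kappa> f}"
    "\<And>B. cfun.independent B \<Longrightarrow> B \<subseteq> V \<Longrightarrow> card B = d \<Longrightarrow> finite B \<Longrightarrow> cfun.span B = V"
proof -
  define bs where "bs = (SOME bs. basis_list V bs)"
  have b: "basis_list V bs" unfolding bs_def using assms by (rule someI_ex)
  have cp: "charpoly_on V T = char_poly (matrix_of bs T)" for T by (simp add: charpoly_on_def bs_def)
  have A: "matrix_of bs T \<in> carrier_mat (length bs) (length bs)" for T by (simp add: matrix_of_def)
  show thesis
  proof (rule that[of "length bs"])
    fix T
    show "Polynomial.degree (charpoly_on V T) = length bs \<and> poly.coeff (charpoly_on V T) (length bs) = 1"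
      using degree_monic_char_poly[OF A] by (simp add: cp)
    assume T: "linear_on_space V T"
    show "roots (charpoly_on V T) = {\<kappa>. \<exists>f\<in>V. f \<noteq> 0 \<and> T f = fscale \<kappa> f}"
      unfolding roots_def cp roots_char_poly_matrix_of[OF b T] ..
  next
    fix B assume B: "cfun.independent B" "B \<subseteq> V" "card B = length bs" "finite B"
    have span: "cfun.span (set bs) = V" and d: "distinct bs" using b by (auto simp: basis_list_def)
    have "V \<subseteq> cfun.span B"
    proof
      fix x assume x: "x \<in> V"
      show "x \<in> cfun.span B"
      proof (rule ccontr)
        assume n: "x \<notin> cfun.span B"
        hence "x \<notin> B" using cfun.span_base by blast
        have "cfun.independent (insert x B)" using B(1) n by (simp add: cfun.independent_insert)
        moreover have "insert x B \<subseteq> cfun.span (set bs)" using B(2) x span by auto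
        ultimately have "card (insert x B) \<le> card (set bs)"
          using cfun.independent_span_bound[of "set bs" "insert x B"] by auto
        thus False using B(3,4) \<open>x \<notin> B\<close> d by (simp add: distinct_card)
      qed
    qed
    moreover have sV: "cfun.span V = V" using cfun.span_span[of "set bs"] unfolding span .
    have "cfun.span B \<subseteq> V" using cfun.span_mono[OF B(2)] unfolding sV .
    ultimately show "cfun.span B = V" by blast
  qed
qed

section \<open>The space of cusp forms and its Hecke operators\<close>

lemma fun_of_add: "fps_conv_radius F \<ge> 1 \<Longrightarrow> fps_conv_radius G \<ge> 1 \<Longrightarrow> fun_of (F + G) = fun_of F + fun_of G"
  by (rule ext) (simp add: fun_of_def qeval_add)

lemma fun_of_scale: "fps_conv_radius F \<ge> 1 \<Longrightarrow> fun_of (fps_const c * F) = fscale c (fun_of F)"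
  by (rule ext) (simp add: fun_of_def qeval_mult fscale_def)

lemma fun_of_0: "fun_of 0 = 0"
  by (rule ext) (simp add: fun_of_def qeval_def)

lemma cusp_fps_0: "0 \<in> cusp_fps k"
  by (simp add: cusp_fps_def)

lemma cusp_fps_add: "F \<in> cusp_fps k \<Longrightarrow> G \<in> cusp_fps k \<Longrightarrow> F + G \<in> cusp_fps k"
  by (simp add: cusp_fps_def mforms_add)

lemma cusp_fps_diff: "F \<in> cusp_fps k \<Longrightarrow> G \<in> cusp_fps k \<Longrightarrow> F - G \<in> cusp_fps k"
  by (simp add: cusp_fps_def mforms_diff)

lemma cusp_fps_scale: "F \<in> cusp_fps k \<Longrightarrow> fps_const c * F \<in> cusp_fps k"
  by (simp add: cusp_fps_def mforms_const_mult)

lemma cusp_fps_sum: "(\<And>i. i \<in> I \<Longrightarrow> F i \<in> cusp_fps k) \<Longrightarrow> (\<Sum>i\<in>I. F i) \<in> cusp_fps k"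
  by (induction I rule: infinite_finite_induct) (auto simp: cusp_fps_0 cusp_fps_add)

lemma fun_of_sum: "(\<And>i. i \<in> I \<Longrightarrow> F i \<in> cusp_fps k) \<Longrightarrow> fun_of (\<Sum>i\<in>I. F i) = (\<Sum>i\<in>I. fun_of (F i))"
proof (induction I rule: infinite_finite_induct)
  case (insert x I)
  have "F x \<in> cusp_fps k" "(\<Sum>i\<in>I. F i) \<in> cusp_fps k" using insert.prems by (auto intro: cusp_fps_sum)
  hence "fun_of (F x + (\<Sum>i\<in>I. F i)) = fun_of (F x) + fun_of (\<Sum>i\<in>I. F i)"
    by (intro fun_of_add cusp_fps_radius)
  also have "fun_of (\<Sum>i\<in>I. F i) = (\<Sum>i\<in>I. fun_of (F i))" using insert.prems by (intro insert.IH) auto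
  finally show ?case unfolding sum.insert[OF insert.hyps(1,2)] .
qed (simp_all add: fun_of_0)

lemma fun_of_eq_0: "F \<in> cusp_fps k \<Longrightarrow> fun_of F = 0 \<longleftrightarrow> F = 0"
  using fun_of_inj[of F 0] by (auto simp: fun_of_0 cusp_fps_radius)

lemma subspace_cusp_forms: "cfun.subspace (cusp_forms k)"
proof (rule cfun.subspaceI)
  show "0 \<in> cusp_forms k" using cusp_fps_0[of k] by (metis cusp_forms_eq fun_of_0 image_eqI)
  show "f + g \<in> cusp_forms k" if "f \<in> cusp_forms k" "g \<in> cusp_forms k" for f g
    using that unfolding cusp_forms_eq
    by (auto simp: fun_of_add [symmetric] cusp_fps_radius intro!: cusp_fps_add)
  show "fscale c f \<in> cusp_forms k" if "f \<in> cusp_forms k" for c f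
    using that unfolding cusp_forms_eq
    by (auto simp: fun_of_scale [symmetric] cusp_fps_radius intro!: cusp_fps_scale)
qed

text \<open>An echelon argument: for each order up to k one form of exactly that order is chosen, if
  there is any. Subtracting multiples of these raises the order of a given form beyond k, where it
  must be zero.\<close>

lemma cusp_forms_finite_span: "\<exists>S. finite S \<and> S \<subseteq> cusp_forms k \<and> cusp_forms k \<subseteq> cfun.span S"
proof -
  define P where "P = (\<lambda>i F. F \<in> cusp_fps k \<and> (\<forall>j<i. fps_nth F j = 0))"
  define G where "G = (\<lambda>i. SOME F. P i F \<and> fps_nth F i \<noteq> 0)"
  define I where "I = {i. i < Suc k \<and> (\<exists>F. P i F \<and> fps_nth F i \<noteq> 0)}"
  define S where "S = (\<lambda>i. fun_of (G i)) ` I"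
  have G: "P i (G i) \<and> fps_nth (G i) i \<noteq> 0" if "i \<in> I" for i
  proof -
    have "\<exists>F. P i F \<and> fps_nth F i \<noteq> 0" using that by (simp add: I_def)
    thus ?thesis unfolding G_def by (rule someI_ex)
  qed
  have "fun_of F \<in> cfun.span S" if "P i F" "i \<le> Suc k" for i F
    using that(2,1)
  proof (induction i arbitrary: F rule: inc_induct)
    case base
    have "F = 0" using base by (intro mforms_vanish[of F k "Suc k"]) (auto simp: P_def cusp_fps_def)
    thus ?case by (simp only: fun_of_0 cfun.span_zero)
  next
    case (step i)
    show ?case
    proof (cases "fps_nth F i = 0")
      case True
      hence "P (Suc i) F" using step.prems by (auto simp: P_def less_Suc_eq)
      thus ?thesis by (rule step.IH)
    next
      case False
      hence i: "i \<in> I" using step by (auto simp: I_def)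
      define c where "c = fps_nth F i / fps_nth (G i) i"
      have cusp: "F \<in> cusp_fps k" "G i \<in> cusp_fps k" using step.prems G[OF i] by (auto simp: P_def)
      have "P (Suc i) (F - fps_const c * G i)"
        using step.prems G[OF i] cusp
        by (auto simp: P_def less_Suc_eq c_def intro!: cusp_fps_diff cusp_fps_scale)
      hence "fun_of (F - fps_const c * G i) \<in> cfun.span S" by (rule step.IH)
      moreover have "fscale c (fun_of (G i)) \<in> cfun.span S"
        using i by (intro cfun.span_scale cfun.span_base) (auto simp: S_def)
      ultimately have "fun_of (F - fps_const c * G i) + fscale c (fun_of (G i)) \<in> cfun.span S"
        by (rule cfun.span_add)
      also have "fscale c (fun_of (G i)) = fun_of (fps_const c * G i)"
        using cusp by (simp add: fun_of_scale cusp_fps_radius)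
      also have "fun_of (F - fps_const c * G i) + fun_of (fps_const c * G i) = fun_of F"
        using cusp by (subst fun_of_add [symmetric])
          (auto intro!: cusp_fps_radius[of _ k] cusp_fps_diff cusp_fps_scale)
      finally show ?thesis .
    qed
  qed
  from this[of 0] have "cusp_forms k \<subseteq> cfun.span S" by (auto simp: cusp_forms_eq P_def)
  moreover have "S \<subseteq> cusp_forms k" using G by (auto simp: S_def P_def intro!: fun_of_in_cusp_forms)
  moreover have "finite S" by (simp add: S_def I_def)
  ultimately show ?thesis by blast
qed

lemma cusp_forms_basis: "\<exists>bs. basis_list (cusp_forms k) bs"
proof -
  obtain S where S: "finite S" "S \<subseteq> cusp_forms k" "cusp_forms k \<subseteq> cfun.span S"
    using cusp_forms_finite_span by blast
  obtain B where B: "B \<subseteq> S" "cfun.independent B" "S \<subseteq> cfun.span B"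
    by (rule cfun.maximal_independent_subset)
  have "finite B" using B(1) S(1) by (rule finite_subset)
  then obtain bs where bs: "set bs = B" "distinct bs" using finite_distinct_list by blast
  have "cfun.span B \<subseteq> cusp_forms k"
    using B(1) S(2) by (intro cfun.span_minimal subspace_cusp_forms) auto
  moreover have "cusp_forms k \<subseteq> cfun.span B"
    using S(3) cfun.span_mono[OF B(3)] by (simp add: cfun.span_span)
  ultimately have "basis_list (cusp_forms k) bs" using B(2) bs by (simp add: basis_list_def)
  thus ?thesis by blast
qed

lemma hecke_op_linear:
  assumes "n > 0" "k > 0"
  shows "linear_on_space (cusp_forms k) (hecke_op k n)"
  unfolding linear_on_space_def
proof (intro conjI ballI allI)
  show "hecke_op k n f \<in> cusp_forms k" if "f \<in> cusp_forms k" for f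
    using that assms unfolding cusp_forms_eq by (auto simp: hecke_op_fun_of intro!: hecke_fps_cusp)
  show "hecke_op k n (f + g) = hecke_op k n f + hecke_op k n g" for f g
    by (simp add: hecke_op_def fun_eq_iff sum.distrib case_prod_unfold ring_distribs add_divide_distrib)
  show "hecke_op k n (fscale c f) = fscale c (hecke_op k n f)" for c f
    by (simp add: hecke_op_def fscale_def fun_eq_iff sum_distrib_left case_prod_unfold mult_ac)
qed (rule subspace_cusp_forms)

lemma hecke_poly_properties:
  assumes k: "k > 0"
  obtains d where
    "\<And>n. n > 0 \<Longrightarrow> Polynomial.degree (hecke_poly n k) = d"
    "\<And>n. n > 0 \<Longrightarrow> poly.coeff (hecke_poly n k) d = 1"
    "\<And>n. n > 0 \<Longrightarrow> roots (hecke_poly n k) =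
       {l. \<exists>F\<in>cusp_fps k. F \<noteq> 0 \<and> hecke_fps k n F = fps_const l * F}"
    "\<And>B. cfun.independent B \<Longrightarrow> B \<subseteq> cusp_forms k \<Longrightarrow> card B = d \<Longrightarrow> finite B \<Longrightarrow> cfun.span B = cusp_forms k"
proof -
  obtain d where d:
    "\<And>T. linear_on_space (cusp_forms k) T \<Longrightarrow> Polynomial.degree (charpoly_on (cusp_forms k) T) = d \<and>
        poly.coeff (charpoly_on (cusp_forms k) T) d = 1"
    "\<And>T. linear_on_space (cusp_forms k) T \<Longrightarrow> roots (charpoly_on (cusp_forms k) T) =
        {l. \<exists>f\<in>cusp_forms k. f \<noteq> 0 \<and> T f = fscale l f}"
    "\<And>B. cfun.independent B \<Longrightarrow> B \<subseteq> cusp_forms k \<Longrightarrow> card B = d \<Longrightarrow> finite B \<Longrightarrow> cfun.span B = cusp_forms k"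
    by (rule charpoly_on_properties[OF cusp_forms_basis[of k]]) blast
  show thesis
  proof (rule that[of d])
    fix n :: nat assume n: "n > 0"
    note lin = hecke_op_linear[OF n k]
    show "Polynomial.degree (hecke_poly n k) = d" "poly.coeff (hecke_poly n k) d = 1"
      using d(1)[OF lin] by (simp_all add: hecke_poly_def)
    have "hecke_op k n (fun_of F) = fscale l (fun_of F) \<longleftrightarrow> hecke_fps k n F = fps_const l * F"
      if F: "F \<in> cusp_fps k" for F l
    proof -
      have "hecke_op k n (fun_of F) = fscale l (fun_of F) \<longleftrightarrow> fun_of (hecke_fps k n F) = fun_of (fps_const l * F)"
        using F by (simp add: hecke_op_fun_of[OF F n k] fun_of_scale cusp_fps_radius)
      also have "\<dots> \<longleftrightarrow> hecke_fps k n F = fps_const l * F"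
        using fun_of_inj[OF cusp_fps_radius[OF hecke_fps_cusp[OF F n k]] cusp_fps_radius[OF cusp_fps_scale[OF F, of l]]]
        by (intro iffI) simp_all
      finally show ?thesis .
    qed
    thus "roots (hecke_poly n k) = {l. \<exists>F\<in>cusp_fps k. F \<noteq> 0 \<and> hecke_fps k n F = fps_const l * F}"
      unfolding hecke_poly_def d(2)[OF lin] by (auto simp: cusp_forms_eq fun_of_eq_0)
  qed (rule d(3))
qed

lemma hecke_fps_scale: "hecke_fps k n (fps_const c * F) = fps_const c * hecke_fps k n F"
  by (rule fps_ext) (simp add: hecke_fps_nth sum_distrib_left mult_ac)

lemma hecke_fps_add: "hecke_fps k n (F + G) = hecke_fps k n F + hecke_fps k n G"
  by (rule fps_ext) (simp add: hecke_fps_nth sum.distrib ring_distribs)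

lemma hecke_fps_0: "hecke_fps k n 0 = 0"
  by (rule fps_ext) (simp add: hecke_fps_nth)

lemma hecke_fps_sum: "hecke_fps k n (\<Sum>i\<in>I. F i) = (\<Sum>i\<in>I. hecke_fps k n (F i))"
  by (induction I rule: infinite_finite_induct) (simp_all add: hecke_fps_add hecke_fps_0)

text \<open>By the hypothesis on the roots, T_n has as many distinct eigenvalues as the dimension.
  So its eigenforms are a basis, its eigenspaces are lines, and T_p preserves these lines because it
  commutes with T_n.\<close>

lemma hecke_eigenbasis:
  assumes k: "k > 0" and n: "n > 0" and p: "prime p"
    and card: "card (roots (hecke_poly n k)) = Polynomial.degree (hecke_poly n k)"
  defines "L \<equiv> roots (hecke_poly n k)"
  obtains F \<mu> where "finite L"
    "\<And>l. l \<in> L \<Longrightarrow> F l \<in> cusp_fps k" "\<And>l. l \<in> L \<Longrightarrow> F l \<noteq> 0"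
    "\<And>l. l \<in> L \<Longrightarrow> hecke_fps k n (F l) = fps_const l * F l"
    "\<And>l. l \<in> L \<Longrightarrow> hecke_fps k p (F l) = fps_const (\<mu> l) * F l"
    "\<And>W. W \<in> cusp_fps k \<Longrightarrow> \<exists>b. W = (\<Sum>l\<in>L. fps_const (b l) * F l)"
    "\<And>c l. (\<Sum>l\<in>L. fps_const (c l) * F l) = 0 \<Longrightarrow> l \<in> L \<Longrightarrow> c l = 0"
proof -
  obtain d where d:
    "\<And>n. n > 0 \<Longrightarrow> Polynomial.degree (hecke_poly n k) = d"
    "\<And>n. n > 0 \<Longrightarrow> poly.coeff (hecke_poly n k) d = 1"
    "\<And>n. n > 0 \<Longrightarrow> roots (hecke_poly n k) =
       {l. \<exists>F\<in>cusp_fps k. F \<noteq> 0 \<and> hecke_fps k n F = fps_const l * F}"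
    "\<And>B. cfun.independent B \<Longrightarrow> B \<subseteq> cusp_forms k \<Longrightarrow> card B = d \<Longrightarrow> finite B \<Longrightarrow> cfun.span B = cusp_forms k"
    by (rule hecke_poly_properties[OF k]) blast
  have "hecke_poly n k \<noteq> 0" using d(2)[OF n] by auto
  hence fin: "finite L" unfolding L_def roots_def by (rule poly_roots_finite)
  have "\<forall>l\<in>L. \<exists>F. F \<in> cusp_fps k \<and> F \<noteq> 0 \<and> hecke_fps k n F = fps_const l * F"
    unfolding L_def d(3)[OF n] by blast
  then obtain F where F: "\<And>l. l \<in> L \<Longrightarrow> F l \<in> cusp_fps k" "\<And>l. l \<in> L \<Longrightarrow> F l \<noteq> 0"
    "\<And>l. l \<in> L \<Longrightarrow> hecke_fps k n (F l) = fps_const l * F l"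
    by metis
  define f where "f = (\<lambda>l. fun_of (F l))"
  have f: "hecke_op k n (f l) = fscale l (f l)" "f l \<noteq> 0" "f l \<in> cusp_forms k" if "l \<in> L" for l
    using F[OF that] by (simp_all add: f_def hecke_op_fun_of n k fun_of_scale cusp_fps_radius fun_of_eq_0 fun_of_in_cusp_forms)
  note lin = hecke_op_linear[OF n k]
  have ind: "c l = 0" if "(\<Sum>l\<in>L. fscale (c l) (f l)) = 0" "l \<in> L" for c l
    by (rule eigenvectors_independent[OF lin fin f(1,2) that])
  have fun_comb: "fun_of (\<Sum>l\<in>L. fps_const (c l) * F l) = (\<Sum>l\<in>L. fscale (c l) (f l))" for c
  proof -
    have "fun_of (\<Sum>l\<in>L. fps_const (c l) * F l) = (\<Sum>l\<in>L. fun_of (fps_const (c l) * F l))"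
      by (rule fun_of_sum[of _ _ k]) (intro cusp_fps_scale F)
    also have "\<dots> = (\<Sum>l\<in>L. fscale (c l) (f l))"
      by (rule sum.cong) (auto simp: f_def fun_of_scale cusp_fps_radius[OF F(1)])
    finally show ?thesis .
  qed
  have ind': "c l = 0" if "(\<Sum>l\<in>L. fps_const (c l) * F l) = 0" "l \<in> L" for c l
    using ind[of c l] fun_comb[of c] that by (simp add: fun_of_0)
  have inj: "inj_on f L"
  proof (rule inj_onI, rule ccontr)
    fix l l' assume l: "l \<in> L" "l' \<in> L" "f l = f l'" "l \<noteq> l'"
    have "(\<Sum>x\<in>L. fscale (if x = l then 1 else if x = l' then -1 else 0) (f x)) =
        (\<Sum>x\<in>{l, l'}. fscale (if x = l then 1 else if x = l' then -1 else 0) (f x))"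
      using l fin by (intro sum.mono_neutral_right) auto
    also have "\<dots> = 0" using l by (simp add: fscale_def fun_eq_iff)
    finally show False using ind[of "\<lambda>x. if x = l then 1 else if x = l' then -1 else 0" l] l by simp
  qed
  have indep: "cfun.independent (f ` L)"
  proof (rule cfun.independent_if_scalars_zero)
    fix u v assume u: "(\<Sum>x\<in>f ` L. fscale (u x) x) = 0" and "v \<in> f ` L"
    then obtain l where l: "l \<in> L" "v = f l" by blast
    have "(\<Sum>l\<in>L. fscale (u (f l)) (f l)) = 0" using u by (simp add: sum.reindex[OF inj])
    from ind[OF this l(1)] show "u v = 0" by (simp add: l)
  qed (simp add: fin)
  have span: "cfun.span (f ` L) = cusp_forms k"
  proof (rule d(4)[OF indep])
    have "card (f ` L) = card L" by (rule card_image[OF inj])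
    also have "\<dots> = d" using card d(1)[OF n] by (simp add: L_def)
    finally show "card (f ` L) = d" .
  qed (use f(3) fin in auto)
  have expand: "\<exists>b. W = (\<Sum>l\<in>L. fps_const (b l) * F l)" if W: "W \<in> cusp_fps k" for W
  proof -
    have "fun_of W \<in> cfun.span (f ` L)" using W span by (simp add: fun_of_in_cusp_forms)
    then obtain u where "fun_of W = (\<Sum>x\<in>f ` L. fscale (u x) x)"
      using cfun.span_finite[of "f ` L"] fin by auto
    also have "\<dots> = (\<Sum>l\<in>L. fscale (u (f l)) (f l))" by (simp add: sum.reindex[OF inj])
    also have "\<dots> = fun_of (\<Sum>l\<in>L. fps_const (u (f l)) * F l)" by (rule fun_comb [symmetric])
    finally have "fun_of W = fun_of (\<Sum>l\<in>L. fps_const (u (f l)) * F l)" .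
    hence "W = (\<Sum>l\<in>L. fps_const (u (f l)) * F l)"
      by (rule fun_of_inj[rotated 2]) (auto intro!: cusp_fps_radius[of _ k] W cusp_fps_sum cusp_fps_scale F)
    thus ?thesis by (rule exI[of _ "\<lambda>l. u (f l)"])
  qed
  have "\<exists>m. hecke_fps k p (F l) = fps_const m * F l" if l: "l \<in> L" for l
  proof -
    obtain b where b: "hecke_fps k p (F l) = (\<Sum>x\<in>L. fps_const (b x) * F x)"
      using expand[OF hecke_fps_cusp[OF F(1)[OF l] prime_gt_0_nat[OF p] k]] by blast
    have "hecke_fps k n (hecke_fps k p (F l)) = fps_const l * hecke_fps k p (F l)"
      using hecke_fps_commute[OF p n, of k "F l"] F(3)[OF l] by (simp add: hecke_fps_scale)
    moreover have "hecke_fps k n (\<Sum>x\<in>L. fps_const (b x) * F x) = (\<Sum>x\<in>L. fps_const (b x * x) * F x)"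
      unfolding hecke_fps_sum hecke_fps_scale
      by (rule sum.cong) (auto simp: F(3) mult.assoc simp flip: fps_const_mult)
    ultimately have "(\<Sum>x\<in>L. fps_const (b x * x) * F x) = (\<Sum>x\<in>L. fps_const (l * b x) * F x)"
      unfolding b by (simp add: sum_distrib_left mult.assoc flip: fps_const_mult)
    hence "(\<Sum>x\<in>L. fps_const (b x * x - l * b x) * F x) = 0"
      by (simp add: left_diff_distrib sum_subtractf flip: fps_const_sub)
    \<comment> \<open>Comparing coordinates gives b(x) (x - l) = 0, so only the coordinate at l can
      be nonzero.\<close>
    from ind'[OF this] have "b x * x - l * b x = 0" if "x \<in> L" for x using that .
    hence "b x = 0 \<or> x = l" if "x \<in> L" for x using that by (simp add: mult.commute)
    hence bx: "b x = 0" if "x \<in> L" "x \<noteq> l" for x using that by blast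
    have "(\<Sum>x\<in>L. fps_const (b x) * F x) = (\<Sum>x\<in>{l}. fps_const (b x) * F x)"
      using l bx fin by (intro sum.mono_neutral_right) auto
    thus ?thesis unfolding b by auto
  qed
  then obtain \<mu> where "\<And>l. l \<in> L \<Longrightarrow> hecke_fps k p (F l) = fps_const (\<mu> l) * F l" by metis
  with fin F expand ind' show thesis by (intro that[of F \<mu>]) auto
qed

section \<open>Rational structure\<close>

text \<open>The vector 1 is linearly independent over the rationals, so a linear map may be
  prescribed on it. Such a map replaces the complex scalars in an identity between rational series
  by rational ones.\<close>

lemma exists_rational_functional:
  obtains \<phi> :: "complex \<Rightarrow> rat" where "\<And>x y. \<phi> (x + y) = \<phi> x + \<phi> y"
    "\<And>r x. \<phi> (of_rat r * x) = r * \<phi> x" "\<phi> 1 = 1"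
proof -
  interpret V: vector_space "\<lambda>(r :: rat) (x :: complex). of_rat r * x"
    by standard (auto simp: algebra_simps of_rat_add of_rat_mult)
  interpret Q: vector_space "\<lambda>(r :: rat) (x :: rat). r * x"
    by standard (auto simp: algebra_simps)
  interpret P: vector_space_pair "\<lambda>(r :: rat) (x :: complex). of_rat r * x" "\<lambda>(r :: rat) (x :: rat). r * x" ..
  have "V.independent {1}" by simp
  from P.linear_independent_extend[OF this, of "\<lambda>_. 1"] obtain g where
    g: "Vector_Spaces.linear (\<lambda>(r :: rat) (x :: complex). of_rat r * x) (\<lambda>(r :: rat) (x :: rat). r * x) g" "g 1 = 1"
    by auto
  interpret g: Vector_Spaces.linear "\<lambda>(r :: rat) (x :: complex). of_rat r * x" "\<lambda>(r :: rat) (x :: rat). r * x" g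
    by (rule g(1))
  show thesis by (rule that[of g]) (simp_all add: g.add g.scale g(2))
qed

section \<open>Rational polynomials and rational power series\<close>

abbreviation crat_poly :: "rat poly \<Rightarrow> complex poly" where
  "crat_poly \<equiv> map_poly of_rat"

lemma crat_poly_mult: "crat_poly (g * h) = crat_poly g * crat_poly h"
  by (rule poly_eqI) (simp add: coeff_mult of_rat_sum of_rat_mult)

lemma crat_poly_add: "crat_poly (g + h) = crat_poly g + crat_poly h"
  by (rule poly_eqI) (simp add: of_rat_add)

lemma crat_poly_1: "crat_poly 1 = 1"
  by (rule poly_eqI) simp

lemma crat_poly_pCons: "crat_poly (pCons a g) = pCons (of_rat a) (crat_poly g)"
  by (rule poly_eqI) (simp add: coeff_pCons split: nat.split)

lemma poly_crat_pcompose: "poly (crat_poly (pcompose g h)) z = poly (crat_poly g) (poly (crat_poly h) z)"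
proof (induction g)
  case (pCons a g)
  thus ?case
    by (simp add: pcompose_pCons crat_poly_add crat_poly_mult crat_poly_pCons)
qed simp

text \<open>Otherwise the two polynomials would be coprime, and a Bezout identity evaluated at the
  common root would read 0 = 1.\<close>

lemma irreducible_dvd_of_common_root:
  assumes g: "irreducible (g :: rat poly)" and z: "poly (crat_poly g) z = 0" "poly (crat_poly h) z = 0"
  shows "g dvd h"
proof (rule ccontr)
  assume n: "\<not> g dvd h"
  have "prime_elem g" using g by (simp add: irreducible_imp_prime_elem_gcd)
  hence "coprime g h" using n by (rule prime_elem_imp_coprime)
  then obtain u v where "u * g + v * h = 1"
    using bezout_coefficients_fst_snd[of g h] by (metis coprime_iff_gcd_eq_1)
  hence "poly (crat_poly (u * g + v * h)) z = 1" by (simp add: crat_poly_1)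
  thus False using z by (simp add: crat_poly_add crat_poly_mult)
qed

definition of_rat_fps :: "rat fps \<Rightarrow> complex fps" where
  "of_rat_fps F = Abs_fps (\<lambda>n. of_rat (fps_nth F n))"

lemma of_rat_fps_nth [simp]: "fps_nth (of_rat_fps F) n = of_rat (fps_nth F n)"
  by (simp add: of_rat_fps_def)

lemma of_rat_fps_of_int: "of_rat_fps (of_int_fps G) = of_int_fps G"
  by (rule fps_ext) simp

lemma of_rat_fps_0: "of_rat_fps 0 = 0"
  by (rule fps_ext) simp

lemma hecke_of_rat_fps: "hecke_fps k n (of_rat_fps F) = of_rat_fps (hecke_fps k n F)"
  by (rule fps_ext) (simp add: hecke_fps_nth of_rat_sum of_rat_mult of_rat_power)

lemma hecke_funpow_of_rat_fps: "(hecke_fps k n ^^ j) (of_rat_fps F) = of_rat_fps ((hecke_fps k n ^^ j) F)"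
  by (induction j) (simp_all add: hecke_of_rat_fps)

lemma fps_const_mult_assoc: "fps_const x * (fps_const y * F) = fps_const (x * y) * F"
  for F :: "'a::comm_ring_1 fps"
  by (simp only: fps_const_mult mult.assoc [symmetric])

lemma hecke_funpow_eigen:
  assumes "\<And>l. l \<in> L \<Longrightarrow> hecke_fps k n (F l) = fps_const (s l) * F l"
  shows "(hecke_fps k n ^^ j) (\<Sum>l\<in>L. fps_const (b l) * F l) = (\<Sum>l\<in>L. fps_const (b l * s l ^ j) * F l)"
proof (induction j)
  case (Suc j)
  have "(hecke_fps k n ^^ Suc j) (\<Sum>l\<in>L. fps_const (b l) * F l) =
      (\<Sum>l\<in>L. fps_const (b l * s l ^ j) * hecke_fps k n (F l))"
    by (simp add: Suc hecke_fps_sum hecke_fps_scale)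
  also have "\<dots> = (\<Sum>l\<in>L. fps_const (b l * s l ^ Suc j) * F l)"
  proof (rule sum.cong[OF refl])
    fix l assume l: "l \<in> L"
    show "fps_const (b l * s l ^ j) * hecke_fps k n (F l) = fps_const (b l * s l ^ Suc j) * F l"
      by (simp only: assms[OF l] fps_const_mult_assoc power_Suc2 mult.assoc)
  qed
  finally show ?case .
qed simp

text \<open>
  Applying the \<open>\<rat>\<close>-linear functional \<open>\<phi>\<close> to the coefficients of a complex polynomial \<open>c\<close>
  does not change the vector \<open>c(T) W\<close> if \<open>W\<close> and \<open>c(T) W\<close> are rational.
\<close>

lemma rational_interpolation:
  fixes \<phi> :: "complex \<Rightarrow> rat"
  assumes \<phi>: "\<And>x y. \<phi> (x + y) = \<phi> x + \<phi> y" "\<And>r x. \<phi> (of_rat r * x) = r * \<phi> x" "\<phi> 1 = 1"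
    and ind: "\<And>c l. (\<Sum>l\<in>L. fps_const (c l) * F l) = 0 \<Longrightarrow> l \<in> L \<Longrightarrow> c l = 0"
    and eig: "\<And>l. l \<in> L \<Longrightarrow> hecke_fps k n (F l) = fps_const (s l) * F l"
    and W: "(\<Sum>l\<in>L. fps_const (b l) * F l) = of_rat_fps w"
    and U: "(\<Sum>l\<in>L. fps_const (b l * x l) * F l) = of_rat_fps u"
    and c: "\<And>l. l \<in> L \<Longrightarrow> b l \<noteq> 0 \<Longrightarrow> poly c (s l) = x l"
    and l: "l \<in> L" "b l \<noteq> 0"
  shows "poly (crat_poly (map_poly \<phi> c)) (s l) = x l"
proof -
  define T where "T = (\<lambda>j. (hecke_fps k n ^^ j) w)"
  define m where "m = Polynomial.degree c"
  have \<phi>0: "\<phi> 0 = 0" using \<phi>(2)[of 0 0] by simp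
  have \<phi>sum: "\<phi> (\<Sum>i\<in>I. f i) = (\<Sum>i\<in>I. \<phi> (f i))" for I :: "nat set" and f
    by (induction I rule: infinite_finite_induct) (simp_all add: \<phi> \<phi>0)
  have Tw: "of_rat_fps (T j) = (\<Sum>l\<in>L. fps_const (b l * s l ^ j) * F l)" for j
    unfolding T_def hecke_funpow_of_rat_fps [symmetric] W [symmetric] by (rule hecke_funpow_eigen[OF eig])
  have poly_eval: "(\<Sum>j\<le>m. fps_const (a j) * of_rat_fps (T j)) =
      (\<Sum>l\<in>L. fps_const (b l * (\<Sum>j\<le>m. a j * s l ^ j)) * F l)" for a
  proof -
    have "(\<Sum>j\<le>m. fps_const (a j) * of_rat_fps (T j)) =
        (\<Sum>j\<le>m. \<Sum>l\<in>L. fps_const (b l * (a j * s l ^ j)) * F l)"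
      unfolding Tw sum_distrib_left fps_const_mult_assoc
      by (intro sum.cong refl arg_cong2[of _ _ _ _ "(*)"] arg_cong[of _ _ fps_const] mult.left_commute)
    also have "\<dots> = (\<Sum>l\<in>L. \<Sum>j\<le>m. fps_const (b l * (a j * s l ^ j)) * F l)" by (rule sum.swap)
    also have "\<dots> = (\<Sum>l\<in>L. fps_const (b l * (\<Sum>j\<le>m. a j * s l ^ j)) * F l)"
    proof (rule sum.cong[OF refl])
      fix l
      have "fps_const (\<Sum>j\<in>J. g j) = (\<Sum>j\<in>J. fps_const (g j))" for J :: "nat set" and g :: "nat \<Rightarrow> complex"
        by (induction J rule: infinite_finite_induct) (simp_all flip: fps_const_add)
      thus "(\<Sum>j\<le>m. fps_const (b l * (a j * s l ^ j)) * F l) = fps_const (b l * (\<Sum>j\<le>m. a j * s l ^ j)) * F l"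
        by (simp add: sum_distrib_left sum_distrib_right)
    qed
    finally show ?thesis .
  qed
  have "(\<Sum>j\<le>m. fps_const (poly.coeff c j) * of_rat_fps (T j)) = (\<Sum>l\<in>L. fps_const (b l * poly c (s l)) * F l)"
    unfolding poly_eval by (simp add: poly_altdef m_def)
  also have "\<dots> = (\<Sum>l\<in>L. fps_const (b l * x l) * F l)"
    by (rule sum.cong) (use c in auto)
  finally have 1: "(\<Sum>j\<le>m. fps_const (poly.coeff c j) * of_rat_fps (T j)) = of_rat_fps u" unfolding U .
  have 2: "(\<Sum>j\<le>m. \<phi> (poly.coeff c j) * fps_nth (T j) i) = fps_nth u i" for i
  proof -
    have "(\<Sum>j\<le>m. of_rat (fps_nth (T j) i) * poly.coeff c j) = of_rat (fps_nth u i) * 1"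
      using arg_cong[OF 1, of "\<lambda>F. fps_nth F i"] by (simp add: fps_sum_nth mult.commute)
    hence "\<phi> (\<Sum>j\<le>m. of_rat (fps_nth (T j) i) * poly.coeff c j) = \<phi> (of_rat (fps_nth u i) * 1)" by (rule arg_cong)
    thus ?thesis unfolding \<phi>sum \<phi>(2,3) by (simp add: mult.commute)
  qed
  define h where "h = crat_poly (map_poly \<phi> c)"
  have h: "poly.coeff h j = of_rat (\<phi> (poly.coeff c j))" for j
    by (simp add: h_def coeff_map_poly \<phi>0)
  have "Polynomial.degree h \<le> m" unfolding m_def
    by (rule degree_le) (simp add: h coeff_eq_0 \<phi>0)
  hence hz: "poly h z = (\<Sum>j\<le>m. poly.coeff h j * z ^ j)" for z
    unfolding poly_altdef by (intro sum.mono_neutral_left) (auto simp: coeff_eq_0)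
  have "(\<Sum>j\<le>m. fps_const (poly.coeff h j) * of_rat_fps (T j)) = of_rat_fps u"
  proof (rule fps_ext)
    fix i
    have "of_rat (\<Sum>j\<le>m. \<phi> (poly.coeff c j) * fps_nth (T j) i) = (of_rat (fps_nth u i) :: complex)"
      unfolding 2 ..
    thus "fps_nth (\<Sum>j\<le>m. fps_const (poly.coeff h j) * of_rat_fps (T j)) i = fps_nth (of_rat_fps u) i"
      by (simp add: fps_sum_nth h of_rat_sum of_rat_mult)
  qed
  hence "(\<Sum>l\<in>L. fps_const (b l * poly h (s l)) * F l) = (\<Sum>l\<in>L. fps_const (b l * x l) * F l)"
    unfolding poly_eval U hz .
  hence "(\<Sum>l\<in>L. fps_const (b l * poly h (s l) - b l * x l) * F l) = 0"
    by (simp add: left_diff_distrib sum_subtractf flip: fps_const_sub)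
  \<comment> \<open>Coordinates in the eigenbasis are unique, and b(l) can be cancelled; so values
    are controlled exactly on the support of b.\<close>
  from ind[OF this l(1)] have "b l * (poly h (s l) - x l) = 0" by (simp add: right_diff_distrib)
  thus ?thesis using l(2) by (simp add: h_def)
qed

lemma interpolation_poly_exists:
  assumes "finite S" shows "\<exists>c. \<forall>s\<in>S. poly c s = (f s :: complex)"
  using assms
proof (induction S rule: finite_induct)
  case (insert a S)
  then obtain c where c: "\<forall>s\<in>S. poly c s = f s" by blast
  define m where "m = (\<Prod>s\<in>S. [:- s, 1:])"
  have "poly m s = 0" if "s \<in> S" for s using that insert.hyps(1) by (auto simp: m_def poly_prod)
  moreover have "poly m a \<noteq> 0" using insert.hyps by (auto simp: m_def poly_prod)
  ultimately have "\<forall>s\<in>insert a S. poly (c + Polynomial.smult ((f a - poly c a) / poly m a) m) s = f s"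
    using c insert.hyps by auto
  thus ?case by blast
qed simp

lemma monic_poly_eqI:
  fixes p q :: "complex poly"
  assumes "Polynomial.degree p = d" "Polynomial.degree q = d" "poly.coeff p d = 1" "poly.coeff q d = 1"
    and S: "finite S" "card S = d" "\<And>x. x \<in> S \<Longrightarrow> poly p x = 0" "\<And>x. x \<in> S \<Longrightarrow> poly q x = 0"
  shows "p = q"
proof (rule ccontr)
  assume "p \<noteq> q"
  hence ne: "p - q \<noteq> 0" by simp
  have le: "Polynomial.degree (p - q) \<le> d" by (rule degree_diff_le) (use assms(1,2) in simp_all)
  have "poly.coeff (p - q) d = 0" using assms(3,4) by simp
  hence "Polynomial.degree (p - q) \<noteq> d" using ne leading_coeff_0_iff[of "p - q"] by auto
  with le have "Polynomial.degree (p - q) < d" by simp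
  moreover have "card S \<le> card {x. poly (p - q) x = 0}"
    by (rule card_mono[OF poly_roots_finite[OF ne]]) (use S in auto)
  moreover have "card {x. poly (p - q) x = 0} \<le> Polynomial.degree (p - q)"
    by (rule card_poly_roots_bound[OF ne])
  ultimately show False using S(2) by linarith
qed

lemma monic_prod_linear:
  assumes "finite S"
  shows "Polynomial.degree (\<Prod>s\<in>S. [:- s, 1 :: complex:]) = card S \<and> poly.coeff (\<Prod>s\<in>S. [:- s, 1:]) (card S) = 1"
proof -
  have "Polynomial.degree (\<Prod>s\<in>S. [:- s, 1 :: complex:]) = (\<Sum>s\<in>S. Polynomial.degree [:- s, 1 :: complex:])"
    by (rule degree_prod_eq_sum_degree) auto
  hence deg: "Polynomial.degree (\<Prod>s\<in>S. [:- s, 1 :: complex:]) = card S" by simp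
  have "Polynomial.lead_coeff (\<Prod>s\<in>S. [:- s, 1 :: complex:]) = (\<Prod>s\<in>S. Polynomial.lead_coeff [:- s, 1 :: complex:])"
    by (rule lead_coeff_prod)
  thus ?thesis using deg by simp
qed

section \<open>Galois groups\<close>

lemma ring_of_type_algebra_simps:
  "carrier (ring_of_type_algebra :: complex ring) = UNIV"
  "monoid.mult (ring_of_type_algebra :: complex ring) x y = x * y"
  "ring.add (ring_of_type_algebra :: complex ring) x y = x + y"
  "monoid.one (ring_of_type_algebra :: complex ring) = 1"
  "ring.zero (ring_of_type_algebra :: complex ring) = 0"
  by (simp_all add: ring_of_type_algebra_def)

abbreviation cfield :: "complex set \<Rightarrow> complex set" where
  "cfield M \<equiv> generate_field ring_of_type_algebra M"

lemma a_inv_ring_of_type_algebra: "a_inv (ring_of_type_algebra :: complex ring) x = - x"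
proof -
  interpret field "ring_of_type_algebra :: complex ring" by (rule field_from_type_algebra)
  show ?thesis by (rule minus_equality) (simp_all add: ring_of_type_algebra_simps)
qed

lemma m_inv_ring_of_type_algebra: "x \<noteq> 0 \<Longrightarrow> m_inv (ring_of_type_algebra :: complex ring) x = inverse x"
proof -
  assume x: "x \<noteq> 0"
  interpret field "ring_of_type_algebra :: complex ring" by (rule field_from_type_algebra)
  show ?thesis by (rule inv_unique' [symmetric]) (simp_all add: ring_of_type_algebra_simps x)
qed

lemma cfield_add: "x \<in> cfield M \<Longrightarrow> y \<in> cfield M \<Longrightarrow> x + y \<in> cfield M"
  using generate_field.eng_add[of x ring_of_type_algebra M y] by (simp add: ring_of_type_algebra_simps)

lemma cfield_mult: "x \<in> cfield M \<Longrightarrow> y \<in> cfield M \<Longrightarrow> x * y \<in> cfield M"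
  using generate_field.eng_mult[of x ring_of_type_algebra M y] by (simp add: ring_of_type_algebra_simps)

lemma cfield_1: "1 \<in> cfield M"
  using generate_field.one[of ring_of_type_algebra M] by (simp add: ring_of_type_algebra_simps)

lemma cfield_minus: "x \<in> cfield M \<Longrightarrow> - x \<in> cfield M"
  using generate_field.a_inv[of x ring_of_type_algebra M] by (simp add: a_inv_ring_of_type_algebra)

lemma cfield_inverse: "x \<in> cfield M \<Longrightarrow> x \<noteq> 0 \<Longrightarrow> inverse x \<in> cfield M"
  using generate_field.m_inv[of x ring_of_type_algebra M]
  by (simp add: m_inv_ring_of_type_algebra ring_of_type_algebra_simps)

lemma cfield_0: "0 \<in> cfield M"
  using cfield_add[OF cfield_1 cfield_minus[OF cfield_1], of M] by simp

lemma cfield_of_rat: "of_rat r \<in> cfield M"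
proof -
  have n: "of_nat m \<in> cfield M" for m
    by (induction m) (simp_all add: cfield_0 cfield_1 cfield_add)
  have i: "of_int m \<in> cfield M" for m
    by (cases m rule: int_cases2) (simp_all add: n cfield_minus)
  obtain a b where r: "r = of_int a / of_int b" "b > 0"
    by (cases r) (auto simp: Fract_of_int_quotient)
  have "of_rat r = (of_int a * inverse (of_int b) :: complex)" by (simp add: r of_rat_divide divide_inverse of_rat_mult of_rat_inverse)
  also have "\<dots> \<in> cfield M" using r(2) by (intro cfield_mult cfield_inverse i) auto
  finally show ?thesis .
qed

lemma cfield_poly: "z \<in> cfield M \<Longrightarrow> poly (crat_poly h) z \<in> cfield M"
  by (induction h) (simp_all add: cfield_0 crat_poly_pCons cfield_add cfield_mult cfield_of_rat)

lemma cfield_mono: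
  assumes "M \<subseteq> cfield N" shows "cfield M \<subseteq> cfield N"
proof
  fix x assume "x \<in> cfield M"
  thus "x \<in> cfield N"
    by (induction rule: generate_field.induct) (use assms in \<open>auto intro: generate_field.intros\<close>)
qed

section \<open>Automorphisms of the splitting field\<close>

lemma galois_group_carrier:
  assumes "s \<in> carrier (galois_group f)"
  defines "K \<equiv> splitting_field f"
  shows "s \<in> Bij K" "\<And>x y. x \<in> K \<Longrightarrow> y \<in> K \<Longrightarrow> s (x + y) = s x + s y"
    "\<And>x y. x \<in> K \<Longrightarrow> y \<in> K \<Longrightarrow> s (x * y) = s x * s y" "\<And>r. s (of_rat r) = of_rat r"
proof -
  have s: "s \<in> extensional K" "s \<in> ring_iso (ring_of_type_algebra\<lparr>carrier := K\<rparr>) (ring_of_type_algebra\<lparr>carrier := K\<rparr>)"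
    "\<And>x. x \<in> \<rat> \<Longrightarrow> s x = x"
    using assms(1) by (auto simp: galois_group_def Let_def K_def)
  have hom: "s \<in> Ring.ring_hom (ring_of_type_algebra\<lparr>carrier := K\<rparr>) (ring_of_type_algebra\<lparr>carrier := K\<rparr>)"
    and bij: "bij_betw s K K" using s(2) by (auto simp: ring_iso_def)
  show "s \<in> Bij K" using s(1) bij by (simp add: Bij_def)
  show "s (x + y) = s x + s y" "s (x * y) = s x * s y" if "x \<in> K" "y \<in> K" for x y
    using Ring.ring_hom_add[OF hom, of x y] Ring.ring_hom_mult[OF hom, of x y] that
    by (simp_all add: ring_of_type_algebra_simps)
  show "s (of_rat r) = of_rat r" for r by (rule s(3)) simp
qed

lemma galois_group_poly:
  assumes "s \<in> carrier (galois_group f)" "z \<in> splitting_field f"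
  shows "s (poly (crat_poly h) z) = poly (crat_poly h) (s z)"
proof (induction h)
  case 0
  show ?case using galois_group_carrier(4)[OF assms(1), of 0] by simp
next
  case (pCons a h)
  have "poly (crat_poly h) z \<in> splitting_field f" "of_rat a \<in> splitting_field f"
    using assms(2) unfolding splitting_field_def by (auto intro: cfield_poly cfield_of_rat)
  moreover from this have "z * poly (crat_poly h) z \<in> splitting_field f"
    using assms(2) unfolding splitting_field_def by (intro cfield_mult)
  ultimately show ?case
    using galois_group_carrier[OF assms(1)] assms(2) pCons by (simp add: crat_poly_pCons)
qed

lemma roots_in_splitting_field: "l \<in> roots f \<Longrightarrow> l \<in> splitting_field f"
  unfolding splitting_field_def by (rule generate_field.incl)

lemma full_galois_group_permutes:
  assumes "full_galois_group f" "s \<in> carrier (galois_group f)"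
  shows "bij_betw s (roots f) (roots f)"
proof -
  have "restrict s (roots f) \<in> carrier (BijGroup (roots f))"
    using assms by (auto simp: full_galois_group_def iso_def hom_def)
  hence "bij_betw (restrict s (roots f)) (roots f) (roots f)" by (simp add: BijGroup_def Bij_def)
  thus ?thesis by (subst (asm) bij_betw_cong[of _ _ s]) auto
qed

lemma full_galois_group_realizes:
  assumes "full_galois_group f" "bij_betw \<pi> (roots f) (roots f)"
  obtains s where "s \<in> carrier (galois_group f)" "\<And>l. l \<in> roots f \<Longrightarrow> s l = \<pi> l"
proof -
  have "restrict \<pi> (roots f) \<in> Bij (roots f)"
    using assms(2) unfolding Bij_def by (auto intro: bij_betw_cong[THEN iffD1, rotated])
  moreover have "(\<lambda>s. restrict s (roots f)) ` carrier (galois_group f) = Bij (roots f)"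
    using assms(1) by (auto simp: full_galois_group_def iso_def bij_betw_def BijGroup_def)
  ultimately obtain s where s: "s \<in> carrier (galois_group f)" "restrict s (roots f) = restrict \<pi> (roots f)"
    by (metis imageE)
  have "s l = \<pi> l" if "l \<in> roots f" for l
    using fun_cong[OF s(2), of l] that by simp
  with s(1) show thesis by (rule that)
qed

lemma galois_group_mult:
  "s \<in> carrier (galois_group f) \<Longrightarrow> t \<in> carrier (galois_group f) \<Longrightarrow>
    monoid.mult (galois_group f) s t = compose (splitting_field f) s t"
  using galois_group_carrier(1)[of s f] galois_group_carrier(1)[of t f]
  by (simp add: galois_group_def Let_def BijGroup_def)

text \<open>\<open>h\<close> and \<open>e\<close> give inverse bijections between the two root sets.
  Each root set thus lies in the field generated by the other, the Galois groups coincide, and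
  \<open>h\<close> conjugates one action into the other because automorphisms commute with rational
  polynomials.\<close>

lemma full_galois_group_transfer:
  fixes h e :: "rat poly"
  assumes full: "full_galois_group f" and fin: "finite (roots f)"
    and g: "roots g = poly (crat_poly h) ` roots f" "card (roots g) = Polynomial.degree g"
    and e: "\<And>l. l \<in> roots f \<Longrightarrow> poly (crat_poly e) (poly (crat_poly h) l) = l"
  shows "full_galois_group g"
proof -
  define H E where "H = poly (crat_poly h)" and "E = poly (crat_poly e)"
  define L N where "L = roots f" and "N = roots g"
  have N: "N = H ` L" and EH: "\<And>l. l \<in> L \<Longrightarrow> E (H l) = l"
    using g(1) e by (auto simp: H_def E_def L_def N_def)
  have HE: "H (E y) = y" "E y \<in> L" if "y \<in> N" for y using that EH by (auto simp: N)
  have "cfield N = cfield L"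
  proof
    show "cfield N \<subseteq> cfield L"
      by (rule cfield_mono) (auto simp: N H_def intro!: cfield_poly[OF generate_field.incl])
    show "cfield L \<subseteq> cfield N"
    proof (rule cfield_mono, rule subsetI)
      fix l assume l: "l \<in> L"
      have "E (H l) \<in> cfield N" unfolding E_def
        by (intro cfield_poly generate_field.incl) (use l in \<open>simp add: N\<close>)
      thus "l \<in> cfield N" using EH[OF l] by simp
    qed
  qed
  hence K: "splitting_field g = splitting_field f" by (simp add: splitting_field_def L_def N_def)
  hence gal: "galois_group g = galois_group f" by (simp add: galois_group_def)
  have LK: "l \<in> splitting_field f" if "l \<in> L" for l using that by (simp add: L_def roots_in_splitting_field)
  have NK: "y \<in> splitting_field f" if "y \<in> N" for y
    using that roots_in_splitting_field[of y g] by (simp add: N_def K)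
  have sH: "s (H l) = H (s l)" if "s \<in> carrier (galois_group f)" "l \<in> L" for s l
    unfolding H_def by (rule galois_group_poly[OF that(1) LK[OF that(2)]])
  have sE: "s (E y) = E (s y)" if "s \<in> carrier (galois_group f)" "y \<in> N" for s y
    unfolding E_def by (rule galois_group_poly[OF that(1) NK[OF that(2)]])
  have HLN: "bij_betw H L N" by (rule bij_betwI[of _ _ _ E]) (use HE EH N in auto)
  have ENL: "bij_betw E N L" by (rule bij_betwI[of _ _ _ H]) (use HE EH N in auto)
  have sN: "bij_betw s N N" if s: "s \<in> carrier (galois_group f)" for s
  proof -
    have "bij_betw s L L" using full_galois_group_permutes[OF full s] by (simp add: L_def)
    hence "bij_betw (H \<circ> (s \<circ> E)) N N" using ENL HLN by (intro bij_betw_trans)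
    thus ?thesis
    proof (rule bij_betw_cong[THEN iffD1, rotated])
      show "(H \<circ> (s \<circ> E)) y = s y" if "y \<in> N" for y
        using sH[OF s HE(2)[OF that]] HE(1)[OF that] by simp
    qed
  qed
  have res: "restrict s N \<in> Bij N" if "s \<in> carrier (galois_group f)" for s
    using sN[OF that] unfolding Bij_def by (auto intro: bij_betw_cong[THEN iffD1, rotated])
  have "(\<lambda>s. restrict s N) \<in> iso (galois_group f) (BijGroup N)"
    unfolding iso_def
  proof (intro CollectI conjI)
    show "(\<lambda>s. restrict s N) \<in> hom (galois_group f) (BijGroup N)"
    proof (rule homI)
      show "restrict s N \<in> carrier (BijGroup N)" if "s \<in> carrier (galois_group f)" for s
        using res[OF that] by (simp add: BijGroup_def)
      fix s t assume st: "s \<in> carrier (galois_group f)" "t \<in> carrier (galois_group f)"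
      have "restrict (compose (splitting_field f) s t) N = compose N (restrict s N) (restrict t N)"
        using sN[OF st(2)] NK by (auto simp: compose_def fun_eq_iff restrict_def bij_betw_def)
      thus "restrict (monoid.mult (galois_group f) s t) N =
          monoid.mult (BijGroup N) (restrict s N) (restrict t N)"
        using res st by (simp add: galois_group_mult BijGroup_def)
    qed
    show "bij_betw (\<lambda>s. restrict s N) (carrier (galois_group f)) (carrier (BijGroup N))"
      unfolding bij_betw_def
    proof
      show "inj_on (\<lambda>s. restrict s N) (carrier (galois_group f))"
      proof (rule inj_onI)
        fix s t assume st: "s \<in> carrier (galois_group f)" "t \<in> carrier (galois_group f)"
          "restrict s N = restrict t N"
        have "s l = t l" if l: "l \<in> L" for l
        proof -
          have Hl: "H l \<in> N" using l by (simp add: N)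
          have "s (H l) = t (H l)" using fun_cong[OF st(3), of "H l"] Hl by simp
          thus ?thesis using sE[OF st(1) Hl] sE[OF st(2) Hl] EH[OF l] by simp
        qed
        hence "restrict s (roots f) = restrict t (roots f)" by (auto simp: L_def restrict_def)
        moreover have "inj_on (\<lambda>s. restrict s (roots f)) (carrier (galois_group f))"
          using full by (auto simp: full_galois_group_def iso_def bij_betw_def)
        ultimately show "s = t" using st(1,2) by (auto dest: inj_onD)
      qed
      show "(\<lambda>s. restrict s N) ` carrier (galois_group f) = carrier (BijGroup N)"
      proof (intro equalityI subsetI)
        fix \<pi> assume "\<pi> \<in> carrier (BijGroup N)"
        hence \<pi>: "bij_betw \<pi> N N" "\<pi> \<in> extensional N" by (auto simp: BijGroup_def Bij_def)
        \<comment> \<open>The permutation of N is conjugated to one of L, which is realised by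
          fullness for \<open>f\<close>.\<close>
        have "bij_betw (E \<circ> (\<pi> \<circ> H)) L L" using ENL HLN \<pi>(1) by (intro bij_betw_trans)
        then obtain s where s: "s \<in> carrier (galois_group f)" "\<And>l. l \<in> L \<Longrightarrow> s l = (E \<circ> (\<pi> \<circ> H)) l"
          using full_galois_group_realizes[OF full, of "E \<circ> (\<pi> \<circ> H)"] unfolding L_def by blast
        have "s y = \<pi> y" if y: "y \<in> N" for y
        proof -
          have "s y = H (s (E y))" using sH[OF s(1) HE(2)[OF y]] HE(1)[OF y] by simp
          also have "\<dots> = H (E (\<pi> y))" using s(2)[OF HE(2)[OF y]] HE(1)[OF y] by simp
          also have "\<dots> = \<pi> y" using \<pi>(1) y by (intro HE(1)) (auto simp: bij_betw_def)
          finally show ?thesis .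
        qed
        hence "restrict s N = \<pi>" using \<pi>(2) by (auto simp: restrict_def extensional_def)
        thus "\<pi> \<in> (\<lambda>s. restrict s N) ` carrier (galois_group f)" using s(1) by blast
      qed (use res in \<open>auto simp: BijGroup_def\<close>)
    qed
  qed
  thus ?thesis using g(2) by (simp add: full_galois_group_def gal N_def)
qed

section \<open>The main theorem\<close>

lemma irreducible_degree_pos:
  assumes "irreducible (g :: rat poly)" shows "Polynomial.degree g > 0"
proof (rule ccontr)
  assume "\<not> Polynomial.degree g > 0"
  moreover have "g \<noteq> 0" using assms by auto
  ultimately have "g dvd 1" using is_unit_iff_degree[of g] by simp
  thus False using assms by (simp add: Factorial_Ring.irreducible_def)
qed

text \<open>If a nonzero rational u vanishes at h(l0), then g divides the composite of u with h, so
  u vanishes at all h(l) and has degree at least that of g. Hence a factor of q that vanishes at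
  h(l0) has full degree, and its cofactor is a unit.\<close>

lemma irreducible_of_root_param:
  fixes g h q :: "rat poly"
  assumes g: "irreducible g" and deg: "Polynomial.degree q = Polynomial.degree g"
    and L: "finite L" "card L = Polynomial.degree g" "\<And>l. l \<in> L \<Longrightarrow> poly (crat_poly g) l = 0"
    and inj: "inj_on (poly (crat_poly h)) L"
    and q: "\<And>l. l \<in> L \<Longrightarrow> poly (crat_poly q) (poly (crat_poly h) l) = 0"
  shows "irreducible q"
proof -
  have dpos: "Polynomial.degree g > 0" by (rule irreducible_degree_pos[OF g])
  hence q0: "q \<noteq> 0" using deg by auto
  have "L \<noteq> {}" using L(2) dpos by auto
  then obtain l0 where l0: "l0 \<in> L" by blast
  have full_degree: "Polynomial.degree g \<le> Polynomial.degree u"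
    if u: "u \<noteq> 0" "poly (crat_poly u) (poly (crat_poly h) l0) = 0" for u
  proof -
    have "g dvd pcompose u h"
      by (rule irreducible_dvd_of_common_root[OF g L(3)[OF l0]]) (simp add: poly_crat_pcompose u)
    then obtain v where v: "pcompose u h = g * v" by (elim dvdE)
    have root: "poly (crat_poly u) (poly (crat_poly h) l) = 0" if "l \<in> L" for l
      unfolding poly_crat_pcompose [symmetric] v using L(3)[OF that] by (simp add: crat_poly_mult)
    have u0: "crat_poly u \<noteq> 0"
    proof
      assume "crat_poly u = 0"
      hence "poly.coeff (crat_poly u) i = 0" for i by simp
      hence "u = 0" by (intro poly_eqI) simp
      with u(1) show False by simp
    qed
    have "card L = card (poly (crat_poly h) ` L)" by (rule card_image[OF inj, symmetric])
    also have "\<dots> \<le> card {z. poly (crat_poly u) z = 0}"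
      by (rule card_mono[OF poly_roots_finite[OF u0]]) (use root in auto)
    also have "\<dots> \<le> Polynomial.degree (crat_poly u)" by (rule card_poly_roots_bound[OF u0])
    finally show ?thesis using L(2) by simp
  qed
  have unit: "v dvd 1" if uv: "q = u * v" and r: "poly (crat_poly u) (poly (crat_poly h) l0) = 0" for u v
  proof -
    have u0: "u \<noteq> 0" "v \<noteq> 0" using uv q0 by auto
    have "Polynomial.degree q = Polynomial.degree u + Polynomial.degree v"
      unfolding uv by (rule degree_mult_eq[OF u0])
    hence "Polynomial.degree v = 0" using full_degree[OF u0(1) r] deg by linarith
    thus ?thesis using u0(2) is_unit_iff_degree[of v] by simp
  qed
  show ?thesis
  proof (rule Factorial_Ring.irreducibleI)
    show "q \<noteq> 0" by (rule q0)
    show "\<not> q dvd 1" using is_unit_iff_degree[OF q0] deg dpos by simp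
    fix u v assume uv: "q = u * v"
    have "poly (crat_poly u) (poly (crat_poly h) l0) * poly (crat_poly v) (poly (crat_poly h) l0) = 0"
      using q[OF l0] unfolding uv by (simp add: crat_poly_mult)
    hence "poly (crat_poly u) (poly (crat_poly h) l0) = 0 \<or> poly (crat_poly v) (poly (crat_poly h) l0) = 0"
      by simp
    thus "u dvd 1 \<or> v dvd 1"
    proof
      assume "poly (crat_poly u) (poly (crat_poly h) l0) = 0"
      from unit[OF uv this] show ?thesis ..
    next
      assume "poly (crat_poly v) (poly (crat_poly h) l0) = 0"
      from unit[OF _ this, of u] show ?thesis by (simp add: uv mult.commute)
    qed
  qed
qed

text \<open>
  The full symmetric group is doubly transitive, so a rational polynomial that identifies two
  roots identifies all of them.
\<close>

lemma full_galois_group_poly_constant: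
  assumes full: "full_galois_group f" and l: "l1 \<in> roots f" "l2 \<in> roots f" "l1 \<noteq> l2"
    "poly (crat_poly h) l1 = poly (crat_poly h) l2" and l': "l \<in> roots f"
  shows "poly (crat_poly h) l = poly (crat_poly h) l1"
proof (cases "l = l1")
  case False
  define \<pi> where "\<pi> = (\<lambda>x. if x = l2 then l else if x = l then l2 else x)"
  have "bij_betw \<pi> (roots f) (roots f)"
    by (rule bij_betwI[of _ _ _ \<pi>]) (use l l' in \<open>auto simp: \<pi>_def\<close>)
  then obtain s where s: "s \<in> carrier (galois_group f)" "\<And>x. x \<in> roots f \<Longrightarrow> s x = \<pi> x"
    using full_galois_group_realizes[OF full] by blast
  note K = galois_group_poly[OF s(1) roots_in_splitting_field, of _ h]
  have "poly (crat_poly h) (s l1) = poly (crat_poly h) (s l2)"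
    using K[OF l(1)] K[OF l(2)] l(4) by simp
  moreover have "s l1 = l1" using s(2)[OF l(1)] l(3) False by (auto simp: \<pi>_def)
  moreover have "s l2 = l" using s(2)[OF l(2)] by (simp add: \<pi>_def)
  ultimately show ?thesis by simp
qed simp

text \<open>
  If \<open>T\<^sub>p\<close> is a scalar, then \<open>a\<^sub>p(f) = a\<^sub>1(T\<^sub>p f)\<close> is a fixed multiple of \<open>a\<^sub>1(f)\<close> for all \<open>f\<close>, which
  contradicts the existence of a form with \<open>a\<^sub>1 = 0\<close> and \<open>a\<^sub>p \<noteq> 0\<close>.
\<close>

lemma hecke_prime_not_scalar:
  assumes p: "prime p"
    and res: "\<not> ([int p = 1] (mod 5) \<or> [int p = -1] (mod 5)) \<or>
     \<not> ([int p = 1] (mod 7) \<or> [int p = -1] (mod 7))"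
    and F: "F \<in> cusp_fps k" "fps_nth F 1 = 0" "F \<noteq> 0"
  shows "\<exists>W\<in>cusp_fps k. hecke_fps k p W \<noteq> fps_const m * W"
proof -
  have wt: "even k \<and> k \<ge> 24 \<and> k \<noteq> 26"
    using F by (intro weight_of_order_2_form[of F]) (auto simp: cusp_fps_def)
  obtain G :: "int fps" where G: "of_int_fps G \<in> mforms k" "fps_nth G 0 = 0" "fps_nth G 1 = 0" "fps_nth G p \<noteq> 0"
    by (rule exists_integral_order_2_form[of k p]) (use wt p res in auto)
  have "of_int_fps G \<in> cusp_fps k" using G by (simp add: cusp_fps_def)
  moreover have "fps_nth (hecke_fps k p (of_int_fps G)) 1 = of_int (fps_nth G p)"
    using prime_gt_1_nat[OF p] by (simp add: hecke_fps_prime_nth[OF p])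
  hence "hecke_fps k p (of_int_fps G) \<noteq> fps_const m * of_int_fps G"
    using G(3,4) by (metis fps_mult_left_const_nth mult_zero_right of_int_0 of_int_eq_0_iff of_int_fps_nth)
  ultimately show ?thesis by blast
qed

theorem theorem1:
  fixes k :: nat
  assumes "k > 0"
    and "\<exists>n>0. irreducible_over_Q (hecke_poly n k) \<and> full_galois_group (hecke_poly n k)"
  shows "\<forall>p::nat. prime p \<longrightarrow>
    (\<not> ([int p = 1] (mod 5) \<or> [int p = -1] (mod 5)) \<or>
     \<not> ([int p = 1] (mod 7) \<or> [int p = -1] (mod 7))) \<longrightarrow>
    irreducible_over_Q (hecke_poly p k) \<and> full_galois_group (hecke_poly p k)"
proof (intro allI impI)
  fix p :: nat
  assume p: "prime p" and res: "\<not> ([int p = 1] (mod 5) \<or> [int p = -1] (mod 5)) \<or>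
     \<not> ([int p = 1] (mod 7) \<or> [int p = -1] (mod 7))"
  note k = assms(1)
  have p0: "p > 0" using p by (rule prime_gt_0_nat)
  obtain n where n: "n > 0" and irr: "irreducible_over_Q (hecke_poly n k)"
    and full: "full_galois_group (hecke_poly n k)" using assms(2) by blast
  obtain g where g: "hecke_poly n k = crat_poly g" "irreducible g"
    using irr by (auto simp: irreducible_over_Q_def)
  have card: "card (roots (hecke_poly n k)) = Polynomial.degree (hecke_poly n k)"
    using full by (simp add: full_galois_group_def)
  define L where "L = roots (hecke_poly n k)"
  obtain d where d:
    "\<And>n. n > 0 \<Longrightarrow> Polynomial.degree (hecke_poly n k) = d"
    "\<And>n. n > 0 \<Longrightarrow> poly.coeff (hecke_poly n k) d = 1"
    "\<And>n. n > 0 \<Longrightarrow> roots (hecke_poly n k) =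
       {l. \<exists>F\<in>cusp_fps k. F \<noteq> 0 \<and> hecke_fps k n F = fps_const l * F}"
    by (rule hecke_poly_properties[OF k]) blast
  obtain F \<mu> where fin: "finite L"
    and F: "\<And>l. l \<in> L \<Longrightarrow> F l \<in> cusp_fps k" "\<And>l. l \<in> L \<Longrightarrow> F l \<noteq> 0"
    and eig_n: "\<And>l. l \<in> L \<Longrightarrow> hecke_fps k n (F l) = fps_const l * F l"
    and eig_p: "\<And>l. l \<in> L \<Longrightarrow> hecke_fps k p (F l) = fps_const (\<mu> l) * F l"
    and expand: "\<And>W. W \<in> cusp_fps k \<Longrightarrow> \<exists>b. W = (\<Sum>l\<in>L. fps_const (b l) * F l)"
    and ind: "\<And>c l. (\<Sum>l\<in>L. fps_const (c l) * F l) = 0 \<Longrightarrow> l \<in> L \<Longrightarrow> c l = 0"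
    by (rule hecke_eigenbasis[OF k n p card]) (unfold L_def [symmetric], blast)
  have degg: "Polynomial.degree g = d" using d(1)[OF n] by (simp add: g(1))
  have dpos: "d > 0" using irreducible_degree_pos[OF g(2)] degg by simp
  have cardL: "card L = d" using card d(1)[OF n] by (simp add: L_def)
  have rootL: "poly (crat_poly g) l = 0" if "l \<in> L" for l using that by (simp add: L_def roots_def g(1))
  obtain l0 where l0: "l0 \<in> L" using cardL dpos by (metis card.empty equals0I less_irrefl)
  \<comment> \<open>An eigenform shows that the weight admits cusp forms, hence an integral one;
    this is the rational vector on which the interpolation rests.\<close>
  have "even k \<and> k \<ge> 12 \<and> k \<noteq> 14"
    using F[OF l0] by (intro weight_of_cusp_form[of "F l0"]) (auto simp: cusp_fps_def)
  then obtain G :: "int fps" where G: "of_int_fps G \<in> mforms k" "fps_nth G 0 = 0" "G \<noteq> 0"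
    using exists_integral_cusp_form[of k] by blast
  define W :: "complex fps" where "W = of_int_fps G"
  define w :: "rat fps" where "w = of_int_fps G"
  have Ww: "W = of_rat_fps w" by (simp add: W_def w_def of_rat_fps_of_int)
  have W: "W \<in> cusp_fps k" using G by (simp add: W_def cusp_fps_def)
  have W0: "W \<noteq> 0" using G(3) by (auto simp: W_def fps_eq_iff)
  obtain b where b: "W = (\<Sum>l\<in>L. fps_const (b l) * F l)" using expand[OF W] by blast
  have WL: "(\<Sum>l\<in>L. fps_const (b l) * F l) = of_rat_fps w" using b Ww by simp
  obtain \<phi> :: "complex \<Rightarrow> rat" where \<phi>: "\<And>x y. \<phi> (x + y) = \<phi> x + \<phi> y"
    "\<And>r x. \<phi> (of_rat r * x) = r * \<phi> x" "\<phi> 1 = 1" by (rule exists_rational_functional) blast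
  have \<phi>0: "\<phi> 0 = 0" using \<phi>(2)[of 0 0] by simp
  have interp: "poly (crat_poly (map_poly \<phi> c)) (s l) = x l"
    if "\<And>l. l \<in> L \<Longrightarrow> hecke_fps k m (F l) = fps_const (s l) * F l"
      "(\<Sum>l\<in>L. fps_const (b l * x l) * F l) = of_rat_fps u"
      "\<And>l. l \<in> L \<Longrightarrow> b l \<noteq> 0 \<Longrightarrow> poly c (s l) = x l" "l \<in> L" "b l \<noteq> 0" for c s x u m l
    by (rule rational_interpolation[where \<phi> = \<phi> and L = L and F = F and k = k and n = m and s = s
        and b = b and w = w and x = x and u = u]; fact \<phi> ind WL that)
  \<comment> \<open>As the functional maps 1 to 1, monic polynomials keep their degree and stay
    monic.\<close>
  have monic: "Polynomial.degree (map_poly \<phi> c) = Polynomial.degree c \<and> poly.coeff (map_poly \<phi> c) (Polynomial.degree c) = 1"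
    if "poly.coeff c (Polynomial.degree c) = 1" for c
  proof -
    have c: "poly.coeff (map_poly \<phi> c) i = \<phi> (poly.coeff c i)" for i by (simp add: coeff_map_poly \<phi>0)
    have "poly.coeff (map_poly \<phi> c) (Polynomial.degree c) = 1" by (simp add: c that \<phi>(3))
    moreover from this have "Polynomial.degree c \<le> Polynomial.degree (map_poly \<phi> c)" by (intro le_degree) simp
    moreover have "Polynomial.degree (map_poly \<phi> c) \<le> Polynomial.degree c" by (rule degree_map_poly_le)
    ultimately show ?thesis by simp
  qed
  have T1: "hecke_fps k m (\<Sum>l\<in>L. fps_const (v l) * F l) = (\<Sum>l\<in>L. fps_const (v l * s l) * F l)"
    if "\<And>l. l \<in> L \<Longrightarrow> hecke_fps k m (F l) = fps_const (s l) * F l" for m s v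
  proof -
    have "(hecke_fps k m ^^ 1) (\<Sum>l\<in>L. fps_const (v l) * F l) = (\<Sum>l\<in>L. fps_const (v l * s l ^ 1) * F l)"
      by (rule hecke_funpow_eigen[where L = L and F = F and s = s]; fact that)
    thus ?thesis by simp
  qed
  have T1_n: "hecke_fps k n (\<Sum>l\<in>L. fps_const (v l) * F l) = (\<Sum>l\<in>L. fps_const (v l * l) * F l)" for v
    by (rule T1[where s = "\<lambda>l. l"]; fact eig_n)
  have T1_p: "hecke_fps k p (\<Sum>l\<in>L. fps_const (v l) * F l) = (\<Sum>l\<in>L. fps_const (v l * \<mu> l) * F l)" for v
    by (rule T1; fact eig_p)
  have zero_U: "(\<Sum>l\<in>L. fps_const (b l * 0) * F l) = of_rat_fps 0" by (simp add: of_rat_fps_0)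

  \<comment> \<open>W has a component along every eigenform. The monic polynomial \<open>c\<close>
    with simple zeros at the eigenvalues in the support of b has a rational counterpart that
    vanishes at them too. So g divides this counterpart, whose degree is the size of the
    support.\<close>
  have b_nz: "b l \<noteq> 0" if l: "l \<in> L" for l
  proof -
    define L0 where "L0 = {l \<in> L. b l \<noteq> 0}"
    have fin0: "finite L0" using fin by (simp add: L0_def)
    have "L0 \<noteq> {}"
    proof
      assume "L0 = {}"
      hence "W = 0" unfolding b by (intro sum.neutral) (auto simp: L0_def)
      with W0 show False by simp
    qed
    then obtain l1 where l1: "l1 \<in> L" "b l1 \<noteq> 0" by (auto simp: L0_def)
    define c where "c = (\<Prod>s\<in>L0. [:- s, 1 :: complex:])"
    have c: "Polynomial.degree c = card L0" "poly.coeff c (card L0) = 1"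
      using monic_prod_linear[OF fin0] by (simp_all add: c_def)
    have c0: "poly c s = 0" if "s \<in> L" "b s \<noteq> 0" for s
      using that fin0 by (auto simp: c_def poly_prod L0_def)
    have "poly (crat_poly (map_poly \<phi> c)) l1 = 0"
      by (rule interp[where s = "\<lambda>l. l" and x = "\<lambda>_. 0" and m = n and u = 0]; fact eig_n zero_U c0 l1)
    hence dvd: "g dvd map_poly \<phi> c" using rootL[OF l1(1)] g(2) by (intro irreducible_dvd_of_common_root[of g l1])
    have m: "Polynomial.degree (map_poly \<phi> c) = card L0" "poly.coeff (map_poly \<phi> c) (card L0) = 1"
      using monic[of c] c by simp_all
    hence "map_poly \<phi> c \<noteq> 0" by auto
    hence "card L \<le> card L0" using dvd_imp_degree_le[OF dvd] m(1) degg cardL by simp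
    hence "L0 = L" using fin by (intro card_seteq) (auto simp: L0_def)
    thus ?thesis using l by (auto simp: L0_def)
  qed

  have U: "(\<Sum>l\<in>L. fps_const (b l * \<mu> l) * F l) = of_rat_fps (hecke_fps k p w)"
    using T1_p[of b] unfolding WL by (simp add: hecke_of_rat_fps)
  \<comment> \<open>A complex polynomial in T_n that acts as T_p. Since W and T_p W are rational,
    the functional turns it into a rational polynomial with the same values.\<close>
  obtain c where c: "\<forall>l\<in>L. poly c l = \<mu> l" using interpolation_poly_exists[OF fin] by blast
  define h where "h = map_poly \<phi> c"
  have h: "poly (crat_poly h) l = \<mu> l" if "l \<in> L" for l
    unfolding h_def
    by (rule interp[where s = "\<lambda>l. l" and x = \<mu> and m = n, OF _ U])
      (use c that in \<open>simp_all add: eig_n b_nz\<close>)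

  have inj: "inj_on \<mu> L"
  proof (rule inj_onI, rule ccontr)
    fix l1 l2 assume l: "l1 \<in> L" "l2 \<in> L" "\<mu> l1 = \<mu> l2" "l1 \<noteq> l2"
    have const: "\<mu> x = \<mu> l1" if "x \<in> L" for x
      using full_galois_group_poly_constant[OF full, of l1 l2 h x] l that h by (simp add: L_def)
    have scalar: "hecke_fps k p V = fps_const (\<mu> l1) * V" if "V \<in> cusp_fps k" for V
    proof -
      obtain v where v: "V = (\<Sum>l\<in>L. fps_const (v l) * F l)" using expand[OF \<open>V \<in> cusp_fps k\<close>] by blast
      have "hecke_fps k p V = (\<Sum>l\<in>L. fps_const (v l * \<mu> l) * F l)"
        unfolding v by (rule T1_p)
      also have "\<dots> = (\<Sum>l\<in>L. fps_const (\<mu> l1) * (fps_const (v l) * F l))"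
        by (rule sum.cong) (simp_all only: const fps_const_mult_assoc mult.commute[of "\<mu> l1"])
      finally show ?thesis by (simp only: v sum_distrib_left)
    qed
    \<comment> \<open>Two eigenforms span a nonzero form with first coefficient 0: either one of
      them already has it, or the first coefficients are cancelled against each other.\<close>
    define V where "V = (if fps_nth (F l1) 1 = 0 then F l1 else
        fps_const (fps_nth (F l2) 1) * F l1 - fps_const (fps_nth (F l1) 1) * F l2)"
    have V: "V \<in> cusp_fps k" "fps_nth V 1 = 0"
      using F l by (auto simp: V_def intro!: cusp_fps_diff cusp_fps_scale)
    have "V \<noteq> 0"
    proof
      assume V0: "V = 0"
      have ne: "fps_nth (F l1) 1 \<noteq> 0" using V0 F(2)[OF l(1)] by (auto simp: V_def)
      define v where "v = (\<lambda>x. if x = l1 then fps_nth (F l2) 1 else if x = l2 then - fps_nth (F l1) 1 else 0)"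
      have "(\<Sum>x\<in>L. fps_const (v x) * F x) = (\<Sum>x\<in>{l1, l2}. fps_const (v x) * F x)"
        using fin l by (intro sum.mono_neutral_right) (auto simp: v_def)
      also have "\<dots> = V" using l(4) ne by (simp add: v_def V_def flip: fps_const_neg)
      finally have "v l2 = 0" using ind[of v l2] l(2) V0 by simp
      thus False using l(4) ne by (simp add: v_def)
    qed
    from hecke_prime_not_scalar[OF p res V this, of "\<mu> l1"] scalar show False by blast
  qed

  \<comment> \<open>The interpolation is repeated with T_n and T_p exchanged and yields a rational
    inverse of \<open>h\<close> on the eigenvalues.\<close>
  have "\<exists>c. \<forall>m\<in>\<mu> ` L. poly c m = inv_into L \<mu> m"
    using fin by (intro interpolation_poly_exists) simp
  then obtain c' where c': "\<forall>m\<in>\<mu> ` L. poly c' m = inv_into L \<mu> m" by blast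
  define e where "e = map_poly \<phi> c'"
  have Un: "(\<Sum>l\<in>L. fps_const (b l * l) * F l) = of_rat_fps (hecke_fps k n w)"
    using T1_n[of b] unfolding WL by (simp add: hecke_of_rat_fps)
  have e: "poly (crat_poly e) (\<mu> l) = l" if "l \<in> L" for l
    unfolding e_def
    by (rule interp[where s = \<mu> and x = "\<lambda>l. l" and m = p, OF _ Un])
       (use c' inj that in \<open>simp_all add: eig_p b_nz\<close>)

  let ?P = "hecke_poly p k"
  have "?P \<noteq> 0" using d(2)[OF p0] by auto
  hence finP: "finite (roots ?P)" unfolding roots_def by (rule poly_roots_finite)
  have sub: "\<mu> ` L \<subseteq> roots ?P" unfolding d(3)[OF p0] using F eig_p by blast
  have cardN: "card (\<mu> ` L) = d" using card_image[OF inj] cardL by simp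
  have "card (roots ?P) \<le> d"
    using card_poly_roots_bound[OF \<open>?P \<noteq> 0\<close>] d(1)[OF p0] by (simp add: roots_def)
  hence rootsP: "roots ?P = \<mu> ` L" using card_seteq[OF finP sub] cardN by simp

  \<comment> \<open>The candidate for the characteristic polynomial of T_p. Its image under the
    functional is rational and monic with the same degree and roots, which proves that the
    characteristic polynomial is rational.\<close>
  define c2 where "c2 = (\<Prod>s\<in>\<mu> ` L. [:- s, 1 :: complex:])"
  have c2: "Polynomial.degree c2 = d" "poly.coeff c2 d = 1"
    using monic_prod_linear[of "\<mu> ` L"] fin cardN by (simp_all add: c2_def)
  define q where "q = map_poly \<phi> c2"
  have q: "Polynomial.degree q = d" "poly.coeff q d = 1" using monic[of c2] c2 by (simp_all add: q_def)
  have c20: "poly c2 (\<mu> l) = 0" if "l \<in> L" for l using that fin by (auto simp: c2_def poly_prod)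
  have qroot: "poly (crat_poly q) (\<mu> l) = 0" if "l \<in> L" for l
    unfolding q_def
    by (rule interp[where s = \<mu> and x = "\<lambda>_. 0" and m = p, OF _ zero_U])
       (use c20 that in \<open>simp_all add: eig_p b_nz\<close>)
  have Pq: "?P = crat_poly q"
  proof (rule monic_poly_eqI[of _ d _ "\<mu> ` L"])
    show "poly ?P x = 0" if "x \<in> \<mu> ` L" for x using that sub by (auto simp: roots_def)
  qed (use d(1,2)[OF p0] q fin cardN qroot in auto)

  have "irreducible q"
  proof (rule irreducible_of_root_param[OF g(2), of q L h])
    show "inj_on (poly (crat_poly h)) L" using inj h by (simp cong: inj_on_cong)
  qed (use q degg fin cardL rootL qroot h in auto)
  hence "irreducible_over_Q ?P" unfolding irreducible_over_Q_def using Pq by blast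
  moreover have "full_galois_group ?P"
  proof (rule full_galois_group_transfer[OF full, of ?P h e])
    show "finite (roots (hecke_poly n k))" using fin by (simp add: L_def)
    show "roots ?P = poly (crat_poly h) ` roots (hecke_poly n k)"
      unfolding rootsP L_def [symmetric] using h by (intro image_cong) auto
    show "card (roots ?P) = Polynomial.degree ?P" using rootsP cardN d(1)[OF p0] by simp
    show "poly (crat_poly e) (poly (crat_poly h) l) = l" if "l \<in> roots (hecke_poly n k)" for l
      using that h e by (simp add: L_def)
  qed
  ultimately show "irreducible_over_Q ?P \<and> full_galois_group ?P" ..
qed

end
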